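(* Let (A1)–(A4) of the context hold and suppose that $f(x)-q(x,0)\ge 0$ for a.e. $x\in S$. Consider a family of simplicial triangulations $\mathcal T_h$ ($h>0$) as in the context satisfying, with a constant $\sigma_0>0$ independent of $i,j$ and $h$, $$\nabla_{S_h}\chi_i\cdot\nabla_{S_h}\chi_j\le-\frac{\sigma_0}{h^2}<0\quad\text{on }\operatorname{supp}\chi_i\cap\operatorname{supp}\chi_j\subset S_h$$ for all $i=1,\dots,n$, $j=1,\dots,\bar n$, $i\ne j$, and suppose there are constants $m_1,m_2>0$ such that $m_1h^d\le\operatorname{meas}(T)\le m_2h^d$ for every $h>0$ and every simplex $T\in\mathcal T_h$, where $\operatorname{meas}$ denotes $d$-dimensional measure. Then for all sufficiently small $h$, every solution $u_h\in V_h$ of the discrete problem in the context satisfies $$\min_{\overline S}u_h^l\ge\min\{0,\min_{\partial S}g_h^l\}.$$ In particular, if $g\le0$ then $\min_{\overline S}u_h^l=\min_{\partial S}g_h^l$, and if $g\ge0$ then $\min_{\overline S}u_h^l\ge0$.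
   Context: Continuous data. $\mathcal M$ is a smooth complete $d$-dimensional Riemannian manifold, $S\subset\mathcal M$ a closed bounded regular subdomain, a smooth manifold with nonempty boundary $\partial S$. $S$ is embedded as a hypersurface in $\mathbb R^{d+1}$ with unit normal $\nu$, with an associated signed distance function $\delta$ such that $S=\{\delta=0\}$ and $\nabla\delta=\nu$ (on the set of points $P+s\nu(P)$, $P\in S$, $|s|$ small, where $\delta(P+s\nu(P))=s$). $p'=p/(p-1)$. The underlying boundary value problem is $-\operatorname{div}_S(b(x,u,\nabla_Su)\nabla_Su)+q(x,u)=f$ on $S$, $u=g$ on $\partial S$, with: (A1) $p\ge2$ is a given parameter. (A2) $b:S\times\mathbb R\times\mathbb R^{d+1}\to\mathbb R$, $q:\overline S\times\mathbb R\to\mathbb R$ are continuous; $f\in L^{p'}(S)$; $g=g^*|_{\partial S}$ for some $g^*\in W^{1,\gamma}(S)$, where $\gamma\ge p$ if $p>d$ and $\gamma>d$ if $p\le d$. (A3) There are constants $\mu_0,\mu_1,M_0,M_1>0$ with $\mu_0+\mu_1|\xi|^{p-2}\le b(x,z,\xi)\le M_0+M_1|\xi|^{p-2}$ for all $(x,z,\xi)\in S\times\mathbb R\times\mathbb R^{d+1}$. (A4) $2\le p_1<+\infty$ if $d\le p$, or $2\le p_1<\frac{2d}{d-p}$ if $d>p$; there are $\alpha,\beta\ge0$ such that for every $x\in S$: $0\le q(x,0)=q(x,z)$ for all $z\le0$, and $0\le q(x,z)-q(x,0)\le\alpha z+\beta z^{p_1-1}$ for all $z\ge0$. Discretization. $S$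 is approximated by a polyhedral surface $S_h=\bigcup_{T\in\mathcal T_h}T\subset\mathbb R^{d+1}$, where $\mathcal T_h$ is an admissible triangulation by $d$-simplices: $h$ is the maximal diameter, every $T$ has inradius at least $ch$ with $c>0$ independent of $h$, and $S_h$ is not a global double covering of $S$. The vertices $B_1,\dots,B_{\bar n}$ lie on $S$; $B_1,\dots,B_n$ (with $n<\bar n$) are those not on $\partial S_h$, and $B_{n+1},\dots,B_{\bar n}$ are those on $\partial S_h$, which lie on $\partial S$. $\nabla_{S_h}\phi=\nabla\phi-(\nabla\phi\cdot\nu_h)\nu_h$ (elementwise, $\nu_h$ the normal to $S_h$). $\chi_j$ is the continuous piecewise linear function on $S_h$ with $\chi_j(B_i)=\delta_{ij}$; $V_h=\operatorname{span}\{\chi_1,\dots,\chi_{\bar n}\}$, $V_h^0=\operatorname{span}\{\chi_1,\dots,\chi_n\}$. $g_h=\sum_{j=n+1}^{\bar n}g_j\chi_j$ with $g_j=g(B_j)$. Lift. Each $x\in S_h$ determines a unique $P=P(x)\in S$ by $x=P+\nu(P)\delta(x)$; $h$ is small enough that this is well defined, and $x\mapsto P(x)$ is regarded as a bijection of $S_h$ onto $S$ mapping $\partial S_h$ onto $\partial S$. The lift of $\eta_h:S_h\to\mathbb R$ is $\eta_h^l(P(x))=\eta_h(x)$. For the data, $b^{-l}(x,\cdot,\cdot)=b(P(x),\cdot,\cdot)$, $q^{-l}(x,\cdot)=q(P(x),\cdot)$, $f^{-l}(x)=f(P(x))$. Discrete problem: find $u_h\in V_h$ with $u_h-g_h\in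 V_h^0$ and $$\int_{S_h}\bigl(b^{-l}(x,u_h,\nabla_{S_h}u_h)\nabla_{S_h}u_h\cdot\nabla_{S_h}v_h+\hat q^{-l}(x,u_h)v_h\bigr)=\int_{S_h}\hat f^{-l}v_h\quad\forall v_h\in V_h^0,$$ where $\hat q^{-l}(x,z)=q^{-l}(x,z)-q^{-l}(x,0)$ and $\hat f^{-l}(x)=f^{-l}(x)-q^{-l}(x,0)$. *)

theory Defs
  imports "HOL-Analysis.Analysis"
begin

section \<open>Powers and function classes\<close>

text \<open>In the library \<open>0 powr 0 = 0\<close>; the growth conditions need \<open>0\<^sup>0 = 1\<close>
  (this matters for \<open>\<bar>\<xi>\<bar>\<^sup>p\<^sup>-\<^sup>2\<close> at \<open>\<xi> = 0\<close> when \<open>p = 2\<close>).\<close>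

definition rpow :: "real \<Rightarrow> real \<Rightarrow> real" where
  "rpow x a = (if a = 0 then 1 else x powr a)"

text \<open>\<open>C\<^sup>k\<close> on an open set, by iterated directional derivatives.\<close>

primrec Ck_on :: "nat \<Rightarrow> 'a::euclidean_space set \<Rightarrow> ('a \<Rightarrow> 'b::euclidean_space) \<Rightarrow> bool" where
  "Ck_on 0 U f \<longleftrightarrow> continuous_on U f"
| "Ck_on (Suc k) U f \<longleftrightarrow>
     (\<forall>x\<in>U. f differentiable (at x)) \<and>
     (\<forall>v. Ck_on k U (\<lambda>x. frechet_derivative f (at x) v))"

definition smooth_on :: "'a::euclidean_space set \<Rightarrow> ('a \<Rightarrow> 'b::euclidean_space) \<Rightarrow> bool" where
  "smooth_on U f \<longleftrightarrow> open U \<and> (\<forall>k. Ck_on k U f)"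

definition Lp_fun :: "'a measure \<Rightarrow> real \<Rightarrow> ('a \<Rightarrow> 'b::euclidean_space) \<Rightarrow> bool" where
  "Lp_fun M r w \<longleftrightarrow> w \<in> borel_measurable M \<and> integrable M (\<lambda>x. norm (w x) powr r)"

definition is_minimum :: "('a \<Rightarrow> real) \<Rightarrow> 'a set \<Rightarrow> real \<Rightarrow> bool" where
  "is_minimum F A m \<longleftrightarrow> m \<in> F ` A \<and> (\<forall>x\<in>A. m \<le> F x)"


section \<open>\<open>d\<close>-dimensional measure\<close>

text \<open>Normalized \<open>d\<close>-dimensional Hausdorff measure, for \<open>d \<ge> 1\<close> (so that empty covering
  sets contribute \<open>0\<close>). It is the Riemannian volume on a \<open>d\<close>-dimensional submanifold
  and the elementary volume on a \<open>d\<close>-simplex.\<close>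

definition hausdorff_premeasure :: "nat \<Rightarrow> real \<Rightarrow> 'a::metric_space set \<Rightarrow> ennreal" where
  "hausdorff_premeasure d r A =
     (INF C \<in> {C :: nat \<Rightarrow> 'a set. A \<subseteq> (\<Union>i. C i) \<and> (\<forall>i. bounded (C i) \<and> diameter (C i) \<le> r)}.
        \<Sum>i. ennreal (unit_ball_vol (real d) * (diameter (C i) / 2) ^ d))"

definition hausdorff_outer :: "nat \<Rightarrow> 'a::metric_space set \<Rightarrow> ennreal" where
  "hausdorff_outer d A = (SUP r \<in> {0<..}. hausdorff_premeasure d r A)"

definition hausdorff_measure :: "nat \<Rightarrow> 'a::metric_space measure" where
  "hausdorff_measure d = measure_of UNIV (sets borel) (hausdorff_outer d)"

definition surface_measure :: "nat \<Rightarrow> 'a::metric_space set \<Rightarrow> 'a measure" where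
  "surface_measure d A = completion (restrict_space (hausdorff_measure d) A)"


section \<open>Smooth hypersurfaces with boundary\<close>

text \<open>\<open>\<Phi>\<close> is a diffeomorphism of a neighbourhood \<open>U\<close> of \<open>x\<close> in the ambient space onto an
  open set which flattens \<open>S\<close> to a piece of a coordinate hyperplane, respectively of a
  coordinate half-hyperplane having the image of \<open>x\<close> on its edge.\<close>

definition local_diffeo ::
  "'a::euclidean_space \<Rightarrow> 'a set \<Rightarrow> ('a \<Rightarrow> 'a) \<Rightarrow> ('a \<Rightarrow> 'a) \<Rightarrow> bool" where
  "local_diffeo x U \<Phi> \<Psi> \<longleftrightarrow>
     x \<in> U \<and> smooth_on U \<Phi> \<and> smooth_on (\<Phi> ` U) \<Psi> \<and> (\<forall>y\<in>U. \<Psi> (\<Phi> y) = y)"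

definition interior_chart_at :: "'a::euclidean_space set \<Rightarrow> 'a \<Rightarrow> bool" where
  "interior_chart_at S x \<longleftrightarrow>
     (\<exists>U \<Phi> \<Psi>. \<exists>e\<in>Basis. local_diffeo x U \<Phi> \<Psi> \<and>
        \<Phi> ` (S \<inter> U) = {y \<in> \<Phi> ` U. y \<bullet> e = 0})"

definition boundary_chart_at :: "'a::euclidean_space set \<Rightarrow> 'a \<Rightarrow> bool" where
  "boundary_chart_at S x \<longleftrightarrow>
     (\<exists>U \<Phi> \<Psi>. \<exists>e\<in>Basis. \<exists>e'\<in>Basis. e \<noteq> e' \<and> local_diffeo x U \<Phi> \<Psi> \<and> \<Phi> x \<bullet> e' = 0 \<and>
        \<Phi> ` (S \<inter> U) = {y \<in> \<Phi> ` U. y \<bullet> e = 0 \<and> y \<bullet> e' \<ge> 0})"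

definition smooth_hypersurface :: "'a::euclidean_space set \<Rightarrow> bool" where
  "smooth_hypersurface S \<longleftrightarrow> (\<forall>x\<in>S. interior_chart_at S x \<or> boundary_chart_at S x)"

definition surface_boundary :: "'a::euclidean_space set \<Rightarrow> 'a set" where
  "surface_boundary S = {x \<in> S. boundary_chart_at S x}"

text \<open>One-sided velocities of curves in \<open>S\<close>; the span makes up for the half-space
  obtained at boundary points.\<close>

definition tangent_space :: "'a::euclidean_space set \<Rightarrow> 'a \<Rightarrow> 'a set" where
  "tangent_space S x = span {v. \<exists>\<gamma>. \<gamma> 0 = x \<and> (\<forall>t\<in>{0..1::real}. \<gamma> t \<in> S) \<and>
     (\<gamma> has_vector_derivative v) (at 0 within {0..1})}"

definition unit_normal_field :: "'a::euclidean_space set \<Rightarrow> ('a \<Rightarrow> 'a) \<Rightarrow> bool" where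
  "unit_normal_field S \<nu> \<longleftrightarrow> continuous_on S \<nu> \<and>
     (\<forall>x\<in>S. norm (\<nu> x) = 1 \<and> (\<forall>v\<in>tangent_space S x. v \<bullet> \<nu> x = 0))"

definition normal_tube :: "'a::euclidean_space set \<Rightarrow> ('a \<Rightarrow> 'a) \<Rightarrow> real \<Rightarrow> 'a set" where
  "normal_tube S \<nu> \<epsilon> = {P + s *\<^sub>R \<nu> P | P s. P \<in> S \<and> \<bar>s\<bar> < \<epsilon>}"

definition signed_distance ::
  "'a::euclidean_space set \<Rightarrow> ('a \<Rightarrow> 'a) \<Rightarrow> real \<Rightarrow> ('a \<Rightarrow> real) \<Rightarrow> bool" where
  "signed_distance S \<nu> \<epsilon> \<delta> \<longleftrightarrow> 0 < \<epsilon> \<and>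
     S = {x \<in> normal_tube S \<nu> \<epsilon>. \<delta> x = 0} \<and>
     (\<forall>P\<in>S. \<forall>s. \<bar>s\<bar> < \<epsilon> \<longrightarrow>
        \<delta> (P + s *\<^sub>R \<nu> P) = s \<and>
        (\<delta> has_derivative (\<lambda>v. \<nu> P \<bullet> v)) (at (P + s *\<^sub>R \<nu> P) within normal_tube S \<nu> \<epsilon>))"

text \<open>\<open>W\<^sup>1\<^sup>,\<^sup>\<gamma>(S)\<close> by weak tangential gradients, tested with smooth tangential fields which
  vanish near the boundary (\<open>S\<close> is compact, so such fields have compact support in the
  interior). On \<open>S\<close> the divergence depends only on the restriction of the field to \<open>S\<close>.\<close>

definition tangential_divergence :: "('a \<Rightarrow> 'a) \<Rightarrow> ('a::euclidean_space \<Rightarrow> 'a) \<Rightarrow> 'a \<Rightarrow> real" where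
  "tangential_divergence \<nu> X x =
     (let D = frechet_derivative X (at x) in (\<Sum>e\<in>Basis. D e \<bullet> e) - D (\<nu> x) \<bullet> \<nu> x)"

definition test_field :: "'a::euclidean_space set \<Rightarrow> ('a \<Rightarrow> 'a) \<Rightarrow> ('a \<Rightarrow> 'a) \<Rightarrow> bool" where
  "test_field S \<nu> X \<longleftrightarrow> smooth_on UNIV X \<and> (\<forall>x\<in>S. X x \<bullet> \<nu> x = 0) \<and>
     (\<exists>U. open U \<and> surface_boundary S \<subseteq> U \<and> (\<forall>x\<in>S \<inter> U. X x = 0))"

definition sobolev_W1 ::
  "nat \<Rightarrow> 'a::euclidean_space set \<Rightarrow> ('a \<Rightarrow> 'a) \<Rightarrow> real \<Rightarrow> ('a \<Rightarrow> real) \<Rightarrow> bool" where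
  "sobolev_W1 d S \<nu> \<gamma> w \<longleftrightarrow>
     (let \<sigma> = surface_measure d S in
      Lp_fun \<sigma> \<gamma> w \<and>
      (\<exists>G. Lp_fun \<sigma> \<gamma> G \<and> (AE x in \<sigma>. G x \<bullet> \<nu> x = 0) \<and>
         (\<forall>X. test_field S \<nu> X \<longrightarrow>
            (LINT x|\<sigma>. w x * tangential_divergence \<nu> X x) = - (LINT x|\<sigma>. G x \<bullet> X x))))"


section \<open>Polyhedral surfaces and finite elements\<close>

definition inradius :: "'a::euclidean_space set \<Rightarrow> real" where
  "inradius T = Sup {r. 0 \<le> r \<and> (\<exists>x\<in>T. cball x r \<inter> affine hull T \<subseteq> T)}"

definition poly_boundary :: "'a::euclidean_space set set \<Rightarrow> 'a set" where
  "poly_boundary \<T> = \<Union>{F. \<exists>!T. T \<in> \<T> \<and> F facet_of T}"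

definition simplex_normal :: "'a::euclidean_space set \<Rightarrow> 'a" where
  "simplex_normal T = (SOME m. norm m = 1 \<and> (\<forall>x\<in>T. \<forall>y\<in>T. m \<bullet> (x - y) = 0))"

text \<open>\<open>\<nabla>\<phi> - (\<nabla>\<phi> \<cdot> \<nu>\<^sub>h) \<nu>\<^sub>h\<close> on a \<open>d\<close>-simplex, where \<open>\<nabla>\<phi>\<close> is the gradient of an affine extension
  to the ambient space; the result depends neither on the extension nor on the sign
  of the normal.\<close>

definition simplex_gradient :: "'a::euclidean_space set \<Rightarrow> ('a \<Rightarrow> real) \<Rightarrow> 'a" where
  "simplex_gradient T \<phi> =
     (let a = (SOME a. \<exists>c. \<forall>x\<in>T. \<phi> x = a \<bullet> x + c); m = simplex_normal T
      in a - (a \<bullet> m) *\<^sub>R m)"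

text \<open>The gradient is undefined on the (null) set of common faces; it is set to \<open>0\<close> there.\<close>

definition open_simplices :: "'a::euclidean_space set set \<Rightarrow> 'a set" where
  "open_simplices \<T> = (\<Union>T\<in>\<T>. rel_interior T)"

definition surface_gradient :: "'a::euclidean_space set set \<Rightarrow> ('a \<Rightarrow> real) \<Rightarrow> 'a \<Rightarrow> 'a" where
  "surface_gradient \<T> \<phi> x =
     (if x \<in> open_simplices \<T>
      then simplex_gradient (THE T. T \<in> \<T> \<and> x \<in> rel_interior T) \<phi> else 0)"

text \<open>Functions on \<open>S\<^sub>h = \<Union>\<T>\<close> are represented by their extension by zero.\<close>

definition piecewise_linear :: "'a::euclidean_space set set \<Rightarrow> ('a \<Rightarrow> real) \<Rightarrow> bool" where
  "piecewise_linear \<T> \<phi> \<longleftrightarrow> continuous_on (\<Union>\<T>) \<phi> \<and>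
     (\<forall>T\<in>\<T>. \<exists>a c. \<forall>x\<in>T. \<phi> x = a \<bullet> x + c) \<and> (\<forall>x. x \<notin> \<Union>\<T> \<longrightarrow> \<phi> x = 0)"

definition nodal_basis ::
  "'a::euclidean_space set set \<Rightarrow> (nat \<Rightarrow> 'a) \<Rightarrow> nat \<Rightarrow> nat \<Rightarrow> 'a \<Rightarrow> real" where
  "nodal_basis \<T> B nb j =
     (THE \<phi>. piecewise_linear \<T> \<phi> \<and> (\<forall>i\<in>{1..nb}. \<phi> (B i) = (if i = j then 1 else 0)))"

definition nodal_support ::
  "'a::euclidean_space set set \<Rightarrow> (nat \<Rightarrow> 'a) \<Rightarrow> nat \<Rightarrow> nat \<Rightarrow> 'a set" where
  "nodal_support \<T> B nb j = closure {x \<in> \<Union>\<T>. nodal_basis \<T> B nb j x \<noteq> 0}"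

text \<open>The span of the first \<open>k\<close> of the \<open>nb\<close> nodal basis functions: \<open>V\<^sub>h\<close> for \<open>k = nb\<close>, and
  \<open>V\<^sub>h\<^sup>0\<close> when \<open>k\<close> is the number of interior vertices.\<close>

definition fe_space ::
  "'a::euclidean_space set set \<Rightarrow> (nat \<Rightarrow> 'a) \<Rightarrow> nat \<Rightarrow> nat \<Rightarrow> ('a \<Rightarrow> real) set" where
  "fe_space \<T> B nb k = {\<lambda>x. \<Sum>j=1..k. a j * nodal_basis \<T> B nb j x | a. True}"

definition boundary_interpolant ::
  "'a::euclidean_space set set \<Rightarrow> (nat \<Rightarrow> 'a) \<Rightarrow> nat \<Rightarrow> nat \<Rightarrow> ('a \<Rightarrow> real) \<Rightarrow> 'a \<Rightarrow> real" where
  "boundary_interpolant \<T> B n nb g x = (\<Sum>j=n+1..nb. g (B j) * nodal_basis \<T> B nb j x)"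

definition admissible_triangulation ::
  "nat \<Rightarrow> 'a::euclidean_space set \<Rightarrow> real \<Rightarrow> real \<Rightarrow>
   'a set set \<Rightarrow> (nat \<Rightarrow> 'a) \<Rightarrow> nat \<Rightarrow> nat \<Rightarrow> bool" where
  "admissible_triangulation d S c h \<T> B n nb \<longleftrightarrow>
     triangulation \<T> \<and> \<T> \<noteq> {} \<and> (\<forall>T\<in>\<T>. int d simplex T) \<and>
     h = Max (diameter ` \<T>) \<and> (\<forall>T\<in>\<T>. c * h \<le> inradius T) \<and>
     n < nb \<and> inj_on B {1..nb} \<and>
     B ` {1..nb} = {x. \<exists>T\<in>\<T>. x extreme_point_of T} \<and> B ` {1..nb} \<subseteq> S \<and>
     (\<forall>i\<in>{1..n}. B i \<notin> poly_boundary \<T>) \<and>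
     (\<forall>i\<in>{n+1..nb}. B i \<in> poly_boundary \<T> \<and> B i \<in> surface_boundary S)"


section \<open>Lift\<close>

definition foot_point ::
  "'a::euclidean_space set \<Rightarrow> ('a \<Rightarrow> 'a) \<Rightarrow> ('a \<Rightarrow> real) \<Rightarrow> 'a \<Rightarrow> 'a" where
  "foot_point S \<nu> \<delta> x = (THE P. P \<in> S \<and> x = P + \<delta> x *\<^sub>R \<nu> P)"

text \<open>In particular the projection is injective on \<open>S\<^sub>h\<close>, so that \<open>S\<^sub>h\<close> is not a double
  covering of \<open>S\<close>.\<close>

definition lift_well_defined ::
  "'a::euclidean_space set \<Rightarrow> ('a \<Rightarrow> 'a) \<Rightarrow> real \<Rightarrow> ('a \<Rightarrow> real) \<Rightarrow> 'a set set \<Rightarrow> bool" where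
  "lift_well_defined S \<nu> \<epsilon> \<delta> \<T> \<longleftrightarrow>
     \<Union>\<T> \<subseteq> normal_tube S \<nu> \<epsilon> \<and>
     (\<forall>x\<in>\<Union>\<T>. \<exists>!P. P \<in> S \<and> x = P + \<delta> x *\<^sub>R \<nu> P) \<and>
     bij_betw (foot_point S \<nu> \<delta>) (\<Union>\<T>) S \<and>
     foot_point S \<nu> \<delta> ` poly_boundary \<T> = surface_boundary S"

definition lift ::
  "'a::euclidean_space set \<Rightarrow> ('a \<Rightarrow> 'a) \<Rightarrow> ('a \<Rightarrow> real) \<Rightarrow> 'a set set \<Rightarrow>
   ('a \<Rightarrow> real) \<Rightarrow> 'a \<Rightarrow> real" where
  "lift S \<nu> \<delta> \<T> \<eta> y = \<eta> (inv_into (\<Union>\<T>) (foot_point S \<nu> \<delta>) y)"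


section \<open>The discrete problem\<close>

definition discrete_solution ::
  "nat \<Rightarrow> 'a::euclidean_space set \<Rightarrow> ('a \<Rightarrow> 'a) \<Rightarrow> ('a \<Rightarrow> real) \<Rightarrow>
   ('a \<Rightarrow> real \<Rightarrow> 'a \<Rightarrow> real) \<Rightarrow> ('a \<Rightarrow> real \<Rightarrow> real) \<Rightarrow> ('a \<Rightarrow> real) \<Rightarrow> ('a \<Rightarrow> real) \<Rightarrow>
   'a set set \<Rightarrow> (nat \<Rightarrow> 'a) \<Rightarrow> nat \<Rightarrow> nat \<Rightarrow> ('a \<Rightarrow> real) \<Rightarrow> bool" where
  "discrete_solution d S \<nu> \<delta> b q f g \<T> B n nb u \<longleftrightarrow>
     (let P = foot_point S \<nu> \<delta>; \<sigma> = surface_measure d (\<Union>\<T>); grad = surface_gradient \<T> in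
      u \<in> fe_space \<T> B nb nb \<and>
      (\<lambda>x. u x - boundary_interpolant \<T> B n nb g x) \<in> fe_space \<T> B nb n \<and>
      (\<forall>v\<in>fe_space \<T> B nb n.
         (LINT x|\<sigma>. b (P x) (u x) (grad u x) * (grad u x \<bullet> grad v x)
                    + (q (P x) (u x) - q (P x) 0) * v x)
         = (LINT x|\<sigma>. (f (P x) - q (P x) 0) * v x)))"

end

theory Submission
  imports Defs
begin

text \<open>
  Let \<open>u\<close> be a discrete solution, \<open>M = min 0 (min g\<^sub>h)\<close>, and let \<open>w\<close> be the nodal interpolant of the part
  of \<open>u\<close> below \<open>M\<close>. It vanishes at the boundary vertices, so it may be used as a test function. Write
  \<open>Z\<close> and \<open>W\<close> for the sums over the vertices of a simplex of the nodal values above and below \<open>M\<close>. Since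
  the gradients of different hat functions have products at most \<open>-\<sigma>0/h\<^sup>2\<close>, on every simplex
  \<open>\<nabla>u \<bullet> \<nabla>w \<le> -\<bar>\<nabla>w\<bar>\<^sup>2 - (\<sigma>0/h\<^sup>2) Z W\<close>. The source \<open>f - q(\<cdot>,0)\<close> is nonnegative, so the only term of the
  equation that can have the wrong sign is the reaction, and it does so only on a simplex that has both a
  vertex below \<open>M\<close> and a point where \<open>u > 0\<close>; there it is at most \<open>(\<alpha> Z + \<beta> Z\<^bsup>p1-1\<^esup>) W\<close>. It is therefore
  absorbed as soon as \<open>\<alpha> + \<beta> Z\<^bsup>p1-2\<^esup> \<le> \<mu>0 \<sigma>0/h\<^sup>2\<close> on such simplices, and then \<open>\<nabla>w = 0\<close>, whence \<open>w = 0\<close>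
  (\<open>integrand_below\<close>, \<open>lower_bound\<close>).

  The bound on \<open>Z\<close> comes from an a priori estimate (\<open>upper_energy_bound\<close>). Test with the nodal
  interpolant \<open>v\<close> of the part of \<open>u\<close> above a level \<open>K \<ge> max 0 (max g)\<close>. The angle condition gives
  \<open>\<nabla>u \<bullet> \<nabla>v \<ge> \<bar>\<nabla>v\<bar>\<^sup>2\<close> and the reaction now has the good sign, so that \<open>\<mu>1 \<integral>\<bar>\<nabla>v\<bar>\<^sup>p \<le> \<integral>(f - q(\<cdot>,0)) v\<close>;
  Young's and Poincare's inequalities bound \<open>\<integral>\<bar>\<nabla>v\<bar>\<^sup>p\<close> independently of \<open>h\<close>. Cutting at the level \<open>K\<close>
  instead of subtracting \<open>g\<^sub>h\<close> avoids the gradient of \<open>g\<^sub>h\<close>, which is of order \<open>1/h\<close> next to the boundary.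
  On a simplex with a vertex below \<open>M\<close> the function \<open>v\<close> has a zero, so its nodal values are at most
  \<open>h \<bar>\<nabla>v\<bar>\<close>, which is at most of order \<open>h\<^bsup>1-d/p\<^esup>\<close> because the simplex has measure at least \<open>m1 h\<^sup>d\<close>
  (\<open>crossing_bound\<close>). For \<open>d > p\<close> the bound \<open>p1 < 2d/(d-p)\<close> says precisely that \<open>(h\<^bsup>1-d/p\<^esup>)\<^bsup>p1-2\<^esup> = o(h\<^sup>-\<^sup>2)\<close>
  (\<open>subcritical_smallness\<close>).

  A Poincare constant independent of \<open>h\<close> is obtained by working on the fixed surface \<open>S\<close>
  (\<open>poincare_inequality\<close>), for functions that are controlled along Lipschitz curves by an upper
  gradient. A lifted finite element function is Lipschitz on the image of every simplex, and this is enough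
  to have one (\<open>upper_gradient_piecewise_lipschitz\<close>). The inequality itself moves points of \<open>S\<close> along
  coordinate lines of charts: such motions are bi-Lipschitz, so they distort Hausdorff measure by a bounded
  factor; near the boundary they end on \<open>\<partial>S\<close>, and connectedness carries the estimate from there to all
  of \<open>S\<close>.

  Passing between \<open>S\<^sub>h\<close> and \<open>S\<close> costs only constants: for small \<open>h\<close> the foot point map is 2-bi-Lipschitz
  on each simplex (\<open>foot_point_bilipschitz\<close>), since the vertices lie on \<open>S\<close>, which deviates from its
  tangent planes to second order, and the lower bound on the inradius makes the simplices almost tangent.
\<close>

section \<open>Hausdorff measure\<close>

text \<open>The preimages of the members of a covering of \<open>A\<close> form a covering, and their diameters grow at
  most by the factor \<open>L\<close>.\<close>

lemma hausdorff_outer_expanding: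
  fixes \<phi> :: "'a::real_normed_vector \<Rightarrow> 'b::metric_space"
  assumes d: "1 \<le> d" and L: "0 < L"
    and exp: "\<And>y y'. y \<in> D \<Longrightarrow> y' \<in> D \<Longrightarrow> dist y y' \<le> L * dist (\<phi> y) (\<phi> y')"
  shows "hausdorff_outer d {y \<in> D. \<phi> y \<in> A} \<le> ennreal (L ^ d) * hausdorff_outer d A"
proof -
  have pre: "hausdorff_premeasure d (L * r) {y \<in> D. \<phi> y \<in> A} \<le> ennreal (L ^ d) * hausdorff_premeasure d r A"
    if r: "0 < r" for r
  proof -
    have "hausdorff_premeasure d (L * r) {y \<in> D. \<phi> y \<in> A} \<le> 
       ennreal (L ^ d) * (\<Sum>i. ennreal (unit_ball_vol (real d) * (diameter (C i) / 2) ^ d))"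
      if C: "A \<subseteq> (\<Union>i. C i)" "\<And>i. bounded (C i)" "\<And>i. diameter (C i) \<le> r" for C :: "nat \<Rightarrow> 'b set"
    proof -
      define E where "E i = {y \<in> D. \<phi> y \<in> C i}" for i
      have E: "bounded (E i) \<and> diameter (E i) \<le> L * diameter (C i)" for i
      proof -
        have *: "dist y y' \<le> L * diameter (C i)" if "y \<in> E i" "y' \<in> E i" for y y'
        proof -
          have "dist y y' \<le> L * dist (\<phi> y) (\<phi> y')" using exp that by (auto simp: E_def)
          also have "\<dots> \<le> L * diameter (C i)"
            using that L C(2) by (intro mult_left_mono diameter_bounded_bound) (auto simp: E_def)
          finally show ?thesis .
        qed
        have "bounded (E i)" unfolding bounded_two_points using * by blast
        moreover have "diameter (E i) \<le> L * diameter (C i)"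
        proof (rule diameter_le)
          show "E i \<noteq> {} \<or> 0 \<le> L * diameter (C i)" using L diameter_ge_0[OF C(2)] by simp
        qed (use * in \<open>auto simp: dist_norm\<close>)
        ultimately show ?thesis by simp
      qed
      have "hausdorff_premeasure d (L * r) {y \<in> D. \<phi> y \<in> A} \<le>
          (\<Sum>i. ennreal (unit_ball_vol (real d) * (diameter (E i) / 2) ^ d))"
        unfolding hausdorff_premeasure_def
      proof (rule INF_lower, safe)
        fix y assume "y \<in> D" "\<phi> y \<in> A" then show "y \<in> (\<Union>i. E i)" using C(1) by (auto simp: E_def)
      next
        fix i show "bounded (E i)" using E by blast
        show "diameter (E i) \<le> L * r"
          using E[of i] C(3)[of i] L by (meson mult_left_mono order.trans less_imp_le)
      qed
      also have "\<dots> \<le> (\<Sum>i. ennreal (L ^ d) * ennreal (unit_ball_vol (real d) * (diameter (C i) / 2) ^ d))"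
      proof (intro suminf_le)
        fix i
        have "unit_ball_vol (real d) * (diameter (E i) / 2) ^ d \<le> unit_ball_vol (real d) * (L * diameter (C i) / 2) ^ d"
          using E[of i] diameter_ge_0[of "E i"]
          by (intro mult_left_mono power_mono) auto
        also have "\<dots> = L ^ d * (unit_ball_vol (real d) * (diameter (C i) / 2) ^ d)"
          by (simp add: power_mult_distrib power_divide)
        finally show "ennreal (unit_ball_vol (real d) * (diameter (E i) / 2) ^ d) \<le> 
            ennreal (L ^ d) * ennreal (unit_ball_vol (real d) * (diameter (C i) / 2) ^ d)"
          using L by (simp add: ennreal_mult'[symmetric] ennreal_leI)
      qed auto
      also have "\<dots> = ennreal (L ^ d) * (\<Sum>i. ennreal (unit_ball_vol (real d) * (diameter (C i) / 2) ^ d))"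
        by (rule ennreal_suminf_cmult)
      finally show ?thesis .
    qed
    then have le: "hausdorff_premeasure d (L * r) {y \<in> D. \<phi> y \<in> A} / ennreal (L ^ d) \<le> hausdorff_premeasure d r A"
      unfolding hausdorff_premeasure_def[of d r A] using L
      by (intro INF_greatest divide_le_posI_ennreal) auto
    have "hausdorff_premeasure d (L * r) {y \<in> D. \<phi> y \<in> A} = 
        ennreal (L ^ d) * (hausdorff_premeasure d (L * r) {y \<in> D. \<phi> y \<in> A} / ennreal (L ^ d))"
      using L by (subst ennreal_times_divide, subst mult.commute, subst ennreal_mult_divide_eq) auto
    then show ?thesis using mult_left_mono[OF le, of "ennreal (L ^ d)"] by simp
  qed
  show ?thesis
    unfolding hausdorff_outer_def[of d "{y \<in> D. \<phi> y \<in> A}"]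
  proof (rule SUP_least)
    fix r :: real assume "r \<in> {0<..}"
    then have r: "0 < r / L" using L by auto
    have "hausdorff_premeasure d r {y \<in> D. \<phi> y \<in> A} = hausdorff_premeasure d (L * (r / L)) {y \<in> D. \<phi> y \<in> A}"
      using L by simp
    also have "\<dots> \<le> ennreal (L ^ d) * hausdorff_premeasure d (r / L) A" by (rule pre[OF r])
    also have "\<dots> \<le> ennreal (L ^ d) * hausdorff_outer d A"
      unfolding hausdorff_outer_def using r by (intro mult_left_mono SUP_upper) auto
    finally show "hausdorff_premeasure d r {y \<in> D. \<phi> y \<in> A} \<le> ennreal (L ^ d) * hausdorff_outer d A" .
  qed
qed

lemma space_hausdorff [simp]: "space (hausdorff_measure d) = UNIV"
  by (simp add: hausdorff_measure_def)

lemma sets_hausdorff [simp, measurable_cong]: "sets (hausdorff_measure d) = sets borel"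
  unfolding hausdorff_measure_def by (simp add: sets_measure_of_conv sets.sigma_sets_eq[of borel, simplified])

text \<open>A measure built from a set function that is not countably additive on the Borel sets is constantly zero. So
  one set of nonzero measure certifies additivity, and the measure of a Borel set is the outer measure.\<close>

lemma emeasure_hausdorff:
  assumes pos: "emeasure (hausdorff_measure d) (T :: 'a::metric_space set) \<noteq> 0" and A: "A \<in> sets borel"
  shows "emeasure (hausdorff_measure d) (A :: 'a set) = hausdorff_outer d A"
  using assms unfolding hausdorff_measure_def
  by (auto simp: emeasure_measure_of_conv sets.sigma_sets_eq[of borel, simplified] split: if_splits)

text \<open>The homothety with factor \<open>t < 1\<close> about a relative interior point maps \<open>T\<close> into its
  relative interior, which therefore has at least \<open>t\<^sup>d\<close> times the measure of
  \<open>T\<close>; let \<open>t\<close> tend to 1. Finiteness permits the subtraction.\<close>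

lemma hausdorff_rel_boundary_null:
  fixes T :: "'a::euclidean_space set"
  assumes d: "1 \<le> d" and T: "convex T" "compact T" 
    and fin: "emeasure (hausdorff_measure d) T \<noteq> \<infinity>" 
  shows "emeasure (hausdorff_measure d) (T - rel_interior T) = 0"
proof (cases "emeasure (hausdorff_measure d) T = 0")
  case True
  then show ?thesis
    using emeasure_mono[of "T - rel_interior T" T "hausdorff_measure d"] T(2) by (auto intro: borel_compact)
next
  case False
  let ?H = "hausdorff_measure d :: 'a measure"
  have em: "emeasure ?H A = hausdorff_outer d A" if "A \<in> sets borel" for A
    using emeasure_hausdorff[OF False that] .
  have bT: "T \<in> sets borel" using T by (simp add: borel_compact)
  have bR: "rel_interior T \<in> sets borel"
    using T by (metis Diff_Diff_Int Int_absorb1 closed_rel_boundary borel_closed compact_imp_closed 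
      closure_closed rel_interior_subset bT sets.Diff)
  from False have "T \<noteq> {}" by auto
  then obtain z where z: "z \<in> rel_interior T" using T rel_interior_eq_empty by blast
  have le: "ennreal (t ^ d) * emeasure ?H T \<le> emeasure ?H (rel_interior T)" if t: "0 < t" "t < 1" for t
  proof -
    define \<phi> where "\<phi> x = z + t *\<^sub>R (x - z)" for x
    have "{x \<in> T. \<phi> x \<in> rel_interior T} = T"
    proof -
      have "\<phi> x \<in> rel_interior T" if "x \<in> T" for x
      proof -
        have "x - (1 - t) *\<^sub>R (x - z) \<in> rel_interior T"
          using rel_interior_convex_shrink[OF T(1) z that, of "1 - t"] t by simp
        then show ?thesis by (simp add: \<phi>_def algebra_simps)
      qed
      then show ?thesis by auto
    qed
    then have "hausdorff_outer d T \<le> ennreal ((1/t) ^ d) * hausdorff_outer d (rel_interior T)"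
      using hausdorff_outer_expanding[OF d, of "1/t" T \<phi> "rel_interior T"] t
      by (auto simp: \<phi>_def dist_norm simp flip: scaleR_diff_right)
    then have "ennreal (t^d) * emeasure ?H T \<le> ennreal (t^d) * (ennreal ((1/t) ^ d) * emeasure ?H (rel_interior T))"
      by (intro mult_left_mono) (auto simp: em bT bR)
    also have "\<dots> = emeasure ?H (rel_interior T)"
      using t by (simp add: mult.assoc[symmetric] ennreal_mult'[symmetric] power_mult_distrib[symmetric])
    finally show ?thesis .
  qed
  have "emeasure ?H (rel_interior T) \<le> emeasure ?H T"
    by (intro emeasure_mono rel_interior_subset) (simp add: bT)
  then have finR: "emeasure ?H (rel_interior T) \<noteq> \<infinity>" 
    using fin by (metis infinity_ennreal_def neq_top_trans)
  define a b where "a = measure ?H T" and "b = measure ?H (rel_interior T)"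
  have ab: "emeasure ?H T = ennreal a" "emeasure ?H (rel_interior T) = ennreal b"
    using fin finR unfolding a_def b_def by (auto simp: emeasure_eq_ennreal_measure)
  have "t ^ d * a \<le> b" if "0 < t" "t < 1" for t
    using le[OF that] that unfolding ab by (simp add: ennreal_mult'[symmetric] b_def)
  then have "eventually (\<lambda>t. t ^ d * a \<le> b) (at_left 1)"
    using eventually_at_left_real[of 0 1] by (auto elim!: eventually_mono)
  moreover have "((\<lambda>t. t ^ d * a) \<longlongrightarrow> 1 ^ d * a) (at_left 1)" by (intro tendsto_intros)
  ultimately have "1 ^ d * a \<le> b" by (intro tendsto_upperbound[of _ _ "at_left 1"]) auto
  then have "emeasure ?H T \<le> emeasure ?H (rel_interior T)" by (simp add: ab ennreal_leI)
  moreover have "emeasure ?H (T - rel_interior T) = emeasure ?H T - emeasure ?H (rel_interior T)"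
    using finR bT bR rel_interior_subset[of T] by (intro emeasure_Diff) auto
  ultimately show ?thesis using fin by (simp add: diff_eq_0_ennreal top.not_eq_extremum)
qed

section \<open>Upper gradients\<close>

text \<open>Upper gradients replace weak gradients: they make sense for lifted finite element functions without
  differentiating the lift, and it is enough to test curves defined on intervals starting at 0.\<close>

definition upper_gradient :: "'a::euclidean_space set \<Rightarrow> ('a \<Rightarrow> real) \<Rightarrow> ('a \<Rightarrow> real) \<Rightarrow> bool" where
  "upper_gradient S w G \<longleftrightarrow>
     (\<forall>(\<gamma> :: real \<Rightarrow> 'a) \<tau> L. 0 \<le> \<tau> \<and> L-lipschitz_on {0..\<tau>} \<gamma> \<and> \<gamma> ` {0..\<tau>} \<subseteq> S \<longrightarrow>
        ennreal \<bar>w (\<gamma> \<tau>) - w (\<gamma> 0)\<bar> \<le> ennreal L * (\<integral>\<^sup>+t\<in>{0..\<tau>}. ennreal (G (\<gamma> t)) \<partial>lborel))"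

text \<open>Enlarge each \<open>C i\<close> to an open set of almost the same length. Near any point only those pieces
  occur that contain it, so there the increment of \<open>f\<close> is dominated by that of \<open>m\<close>;
  both sides add up along adjacent intervals, and Bolzano bisection makes the local estimate global.\<close>

lemma piecewise_lipschitz_oscillation:
  fixes f :: "real \<Rightarrow> real"
  assumes ab: "a \<le> b" and fin: "finite I" and closed: "\<And>i. i \<in> I \<Longrightarrow> closed (C i)"
    and bdd: "\<And>i. i \<in> I \<Longrightarrow> C i \<subseteq> {a..b}"
    and cover: "{a..b} \<subseteq> (\<Union>i\<in>I. C i)" and c0: "\<And>i. i \<in> I \<Longrightarrow> 0 \<le> c i"
    and lip: "\<And>i s t. i \<in> I \<Longrightarrow> s \<in> C i \<Longrightarrow> t \<in> C i \<Longrightarrow> \<bar>f s - f t\<bar> \<le> c i * \<bar>s - t\<bar>"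
  shows "\<bar>f b - f a\<bar> \<le> (\<Sum>i\<in>I. c i * measure lborel (C i))"
proof (rule field_le_epsilon)
  fix e :: real assume e: "0 < e"
  define \<epsilon> where "\<epsilon> = e / (1 + (\<Sum>i\<in>I. c i))"
  have pos: "0 < 1 + (\<Sum>i\<in>I. c i)" using c0 by (smt (verit) sum_nonneg)
  then have \<epsilon>: "0 < \<epsilon>" using e by (simp add: \<epsilon>_def)
  have finC: "emeasure lborel (C i) \<noteq> \<infinity>" if "i \<in> I" for i
    using emeasure_mono[of "C i" "{a..b}" lborel] bdd[OF that] ab
    by (metis atLeastAtMost_borel emeasure_lborel_Icc infinity_ennreal_def neq_top_trans ennreal_neq_top sets_lborel)
  have "\<exists>U. open U \<and> C i \<subseteq> U \<and> emeasure lborel (U - C i) < ennreal \<epsilon>" if "i \<in> I" for i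
    using outer_regular_lborel[OF _ \<epsilon>, of "C i"] closed[OF that] by (metis borel_closed)
  then obtain U where U: "\<And>i. i \<in> I \<Longrightarrow> open (U i)" "\<And>i. i \<in> I \<Longrightarrow> C i \<subseteq> U i"
    "\<And>i. i \<in> I \<Longrightarrow> emeasure lborel (U i - C i) < ennreal \<epsilon>" by metis
  have Ub: "U i \<in> sets lborel" if "i \<in> I" for i using U(1)[OF that] by simp
  have Cb: "C i \<in> sets lborel" if "i \<in> I" for i using closed[OF that] by simp
  have mb: "U i \<inter> {s<..t} \<in> fmeasurable lborel" if "i \<in> I" for i s t
  proof -
    have "{s<..t} \<in> fmeasurable lborel"
      by (cases "s \<le> t") (auto intro!: fmeasurableI)
    then show ?thesis using fmeasurable_Int_fmeasurable Ub[OF that] by (metis Int_commute)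
  qed
  define m where "m s t = (\<Sum>i\<in>I. c i * measure lborel (U i \<inter> {s<..t}))" for s t
  have m_add: "m s r = m s t + m t r" if "s \<le> t" "t \<le> r" for s t r
  proof -
    have "measure lborel (U i \<inter> {s<..r}) = measure lborel (U i \<inter> {s<..t}) + measure lborel (U i \<inter> {t<..r})"
      if i: "i \<in> I" for i
    proof -
      have "U i \<inter> {s<..r} = (U i \<inter> {s<..t}) \<union> (U i \<inter> {t<..r})" using \<open>s \<le> t\<close> \<open>t \<le> r\<close> by auto
      then show ?thesis
        using mb[OF i] fmeasurableD2[OF mb[OF i]] fmeasurableD[OF mb[OF i]]
        by (simp add: measure_Union disjoint_iff)
    qed
    then show ?thesis by (simp add: m_def sum.distrib distrib_left)
  qed
  define P where "P s t \<longleftrightarrow> (a \<le> s \<longrightarrow> t \<le> b \<longrightarrow> \<bar>f t - f s\<bar> \<le> m s t)" for s t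
  have "P a b"
    using ab
  proof (induction rule: Bolzano)
    case (trans s t r)
    then show ?case using m_add[of s t r] unfolding P_def by linarith
  next
    case (local x)
    have xI: "x \<in> {a..b}" using local by auto
    have "\<forall>\<^sub>F t in nhds x. \<forall>i\<in>I. (x \<in> C i \<longrightarrow> t \<in> U i) \<and> (x \<notin> C i \<longrightarrow> t \<in> - C i)"
    proof (intro eventually_ball_finite fin ballI eventually_conj)
      fix i assume i: "i \<in> I"
      show "\<forall>\<^sub>F t in nhds x. x \<in> C i \<longrightarrow> t \<in> U i"
        using U(1,2)[OF i] eventually_nhds_in_open[of "U i" x] by (cases "x \<in> C i") auto
      show "\<forall>\<^sub>F t in nhds x. x \<notin> C i \<longrightarrow> t \<in> - C i"
        using closed[OF i] eventually_nhds_in_open[of "- C i" x] by (cases "x \<in> C i") auto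
    qed
    then obtain d where d: "d > 0" and
      dd: "\<And>t i. dist t x < d \<Longrightarrow> i \<in> I \<Longrightarrow> (x \<in> C i \<longrightarrow> t \<in> U i) \<and> (x \<notin> C i \<longrightarrow> t \<notin> C i)"
      by (auto simp: eventually_nhds_metric)
    have key: "\<bar>f t - f x\<bar> \<le> m (min t x) (max t x)" if t: "dist t x < d" "t \<in> {a..b}" for t
    proof -
      from cover t obtain i where i: "i \<in> I" "t \<in> C i" by auto
      then have x: "x \<in> C i" using dd[OF t(1)] by blast
      have sub: "{min t x<..max t x} \<subseteq> U i"
      proof
        fix r assume "r \<in> {min t x<..max t x}"
        then have "dist r x < d" using t(1) by (auto simp: dist_real_def min_def max_def split: if_splits)
        then show "r \<in> U i" using dd i x by blast
      qed
      have "\<bar>f t - f x\<bar> \<le> c i * \<bar>t - x\<bar>" using lip[OF i x] .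
      also have "\<bar>t - x\<bar> = measure lborel (U i \<inter> {min t x<..max t x})"
        using sub by (simp add: Int_absorb1 min_def max_def)
      also have "c i * \<dots> \<le> m (min t x) (max t x)"
        unfolding m_def using c0 by (intro member_le_sum fin i) auto
      finally show ?thesis .
    qed
    show ?case
    proof (intro exI conjI allI impI)
      fix s t assume st: "s \<le> x \<and> x \<le> t \<and> t - s < d"
      have "\<bar>f t - f s\<bar> \<le> m s t" if "a \<le> s" "t \<le> b"
        using key[of t] key[of s] m_add[of s x t] st that local
        by (auto simp: dist_real_def min_def max_def split: if_splits)
      then show "P s t" by (simp add: P_def)
    qed (rule d)
  qed
  then have "\<bar>f b - f a\<bar> \<le> m a b" by (simp add: P_def)
  also have "\<dots> \<le> (\<Sum>i\<in>I. c i * (measure lborel (C i) + \<epsilon>))"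
    unfolding m_def
  proof (intro sum_mono mult_left_mono c0)
    fix i assume i: "i \<in> I"
    have "emeasure lborel (U i) = emeasure lborel (C i) + emeasure lborel (U i - C i)"
      using U(2)[OF i] Ub[OF i] Cb[OF i] by (subst plus_emeasure) (auto simp: Un_absorb1)
    also have "\<dots> \<le> ennreal (measure lborel (C i)) + ennreal \<epsilon>"
      using U(3)[OF i] finC[OF i] by (intro add_mono) (auto simp: emeasure_eq_ennreal_measure less_imp_le)
    finally have *: "emeasure lborel (U i) \<le> ennreal (measure lborel (C i) + \<epsilon>)" using \<epsilon> by (simp add: ennreal_plus)
    have "emeasure lborel (U i \<inter> {a<..b}) \<le> emeasure lborel (U i)" using Ub[OF i] by (intro emeasure_mono) auto
    with * have "emeasure lborel (U i \<inter> {a<..b}) \<le> ennreal (measure lborel (C i) + \<epsilon>)" by order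
    then show "measure lborel (U i \<inter> {a<..b}) \<le> measure lborel (C i) + \<epsilon>"
      using \<epsilon> by (simp add: measure_def enn2real_leI)
  qed
  also have "\<dots> = (\<Sum>i\<in>I. c i * measure lborel (C i)) + \<epsilon> * (\<Sum>i\<in>I. c i)"
    by (simp add: distrib_left sum.distrib sum_distrib_left mult.commute)
  also have "\<epsilon> * (\<Sum>i\<in>I. c i) \<le> e"
    using e pos by (simp add: \<epsilon>_def field_simps)
  finally show "\<bar>f b - f a\<bar> \<le> (\<Sum>i\<in>I. c i * measure lborel (C i)) + e" by simp
qed

text \<open>The pieces may overlap: a path may run inside a common face, and then all the adjacent slopes are counted.
  Such overlaps are harmless when they are null sets of the surface.\<close>

lemma upper_gradient_piecewise_lipschitz:
  fixes K :: "'i \<Rightarrow> 'a::euclidean_space set"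
  assumes fin: "finite I" and closed: "\<And>i. i \<in> I \<Longrightarrow> closed (K i)"
    and cover: "S \<subseteq> (\<Union>i\<in>I. K i)" and c0: "\<And>i. i \<in> I \<Longrightarrow> 0 \<le> c i"
    and lip: "\<And>i x y. i \<in> I \<Longrightarrow> x \<in> K i \<Longrightarrow> y \<in> K i \<Longrightarrow> \<bar>w x - w y\<bar> \<le> c i * dist x y"
  shows "upper_gradient S w (\<lambda>x. \<Sum>i\<in>I. c i * indicator (K i) x)"
  unfolding upper_gradient_def
proof (intro allI impI, elim conjE)
  fix \<gamma> :: "real \<Rightarrow> 'a" and \<tau> L :: real
  assume \<tau>: "0 \<le> \<tau>" and L: "L-lipschitz_on {0..\<tau>} \<gamma>" and \<gamma>: "\<gamma> ` {0..\<tau>} \<subseteq> S"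
  define C where "C i = {t \<in> {0..\<tau>}. \<gamma> t \<in> K i}" for i
  have L0: "0 \<le> L" using L by (rule lipschitz_on_nonneg)
  have cC: "closed (C i)" if "i \<in> I" for i
    using continuous_closed_preimage[OF lipschitz_on_continuous_on[OF L] closed_atLeastAtMost closed[OF that]]
    by (simp add: C_def vimage_def Int_def conj_commute)
  have fC: "emeasure lborel (C i) = ennreal (measure lborel (C i))" if "i \<in> I" for i
  proof (rule emeasure_eq_ennreal_measure)
    have "emeasure lborel (C i) \<le> emeasure lborel {0..\<tau>}" by (intro emeasure_mono) (auto simp: C_def)
    then show "emeasure lborel (C i) \<noteq> top" using \<tau> by (auto simp: top_unique)
  qed
  have "\<bar>w (\<gamma> \<tau>) - w (\<gamma> 0)\<bar> \<le> (\<Sum>i\<in>I. (L * c i) * measure lborel (C i))"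
  proof (rule piecewise_lipschitz_oscillation[where f = "\<lambda>t. w (\<gamma> t)" and C = C, OF \<tau> fin cC])
    show "{0..\<tau>} \<subseteq> (\<Union>i\<in>I. C i)" using cover \<gamma> by (fastforce simp: C_def)
    fix i s t assume i: "i \<in> I" and st: "s \<in> C i" "t \<in> C i"
    have "\<bar>w (\<gamma> s) - w (\<gamma> t)\<bar> \<le> c i * dist (\<gamma> s) (\<gamma> t)" using lip[OF i] st by (auto simp: C_def)
    also have "\<dots> \<le> c i * (L * dist s t)"
      using st by (intro mult_left_mono c0 i lipschitz_onD[OF L]) (auto simp: C_def)
    finally show "\<bar>w (\<gamma> s) - w (\<gamma> t)\<bar> \<le> (L * c i) * \<bar>s - t\<bar>" by (simp add: dist_real_def mult_ac)
  qed (auto simp: C_def c0 L0)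
  also have "\<dots> = L * (\<Sum>i\<in>I. c i * measure lborel (C i))" by (simp add: sum_distrib_left mult_ac)
  finally have "ennreal \<bar>w (\<gamma> \<tau>) - w (\<gamma> 0)\<bar> \<le> ennreal L * ennreal (\<Sum>i\<in>I. c i * measure lborel (C i))"
    using L0 by (simp add: ennreal_mult'[symmetric] ennreal_leI)
  also have "ennreal (\<Sum>i\<in>I. c i * measure lborel (C i)) = (\<Sum>i\<in>I. ennreal (c i) * emeasure lborel (C i))"
    using c0 fC by (subst sum_ennreal[symmetric]) (auto simp: ennreal_mult intro!: sum.cong)
  also have "\<dots> = (\<integral>\<^sup>+t. (\<Sum>i\<in>I. ennreal (c i) * indicator (C i) t) \<partial>lborel)"
    using cC by (subst nn_integral_sum) (auto simp: nn_integral_cmult_indicator intro!: sum.cong)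
  also have "\<dots> = (\<integral>\<^sup>+t\<in>{0..\<tau>}. ennreal (\<Sum>i\<in>I. c i * indicator (K i) (\<gamma> t)) \<partial>lborel)"
    using c0 
    by (intro nn_integral_cong, subst sum_ennreal[symmetric])
      (auto simp: C_def ennreal_mult ennreal_indicator sum_distrib_right split: split_indicator intro!: sum.cong)
  finally show "ennreal \<bar>w (\<gamma> \<tau>) - w (\<gamma> 0)\<bar> \<le>
      ennreal L * (\<integral>\<^sup>+t\<in>{0..\<tau>}. ennreal (\<Sum>i\<in>I. c i * indicator (K i) (\<gamma> t)) \<partial>lborel)" .
qed

text \<open>Integrate the tangent line inequality
  \<open>g\<^sup>p \<ge> p s\<^bsup>p-1\<^esup> g - (p-1) s\<^sup>p\<close> at \<open>s = a/R\<close>. Only a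
  lower bound \<open>a\<close> for the mean enters, so the integral may be infinite.\<close>

lemma power_mean_nn_integral:
  fixes G :: "real \<Rightarrow> real"
  assumes p: "1 < p" and R: "0 < R" and a: "0 \<le> a" and G0: "\<And>t. 0 \<le> G t"
    and meas: "G \<in> borel_measurable borel"
    and le: "ennreal a \<le> (\<integral>\<^sup>+t\<in>{0..R}. ennreal (G t) \<partial>lborel)"
  shows "ennreal (a powr p) \<le> ennreal (R powr (p - 1)) * (\<integral>\<^sup>+t\<in>{0..R}. ennreal (G t powr p) \<partial>lborel)"
proof -
  define s where "s = a / R"
  have s0: "0 \<le> s" using a R by (simp add: s_def)
  let ?I = "\<integral>\<^sup>+t\<in>{0..R}. ennreal (G t powr p) \<partial>lborel"
  have pw: "p * s powr (p - 1) * g \<le> (p - 1) * s powr p + g powr p" if "0 \<le> g" for g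
  proof -
    have q: "1 / p + 1 / (p / (p - 1)) = 1" "1 < p / (p - 1)" using p by (auto simp: field_simps)
    have "g * s powr (p - 1) \<le> g powr p / p + (s powr (p - 1)) powr (p / (p - 1)) / (p / (p - 1))"
      using Youngs_inequality[OF p q(2) q(1) that, of "s powr (p - 1)"] by simp
    also have "(s powr (p - 1)) powr (p / (p - 1)) = s powr p" using p by (simp add: powr_powr)
    finally show ?thesis using p by (simp add: field_simps)
  qed
  have "ennreal (p * s powr (p - 1)) * ennreal a \<le>
      ennreal (p * s powr (p - 1)) * (\<integral>\<^sup>+t\<in>{0..R}. ennreal (G t) \<partial>lborel)"
    by (intro mult_left_mono le) auto
  also have "\<dots> = (\<integral>\<^sup>+t\<in>{0..R}. ennreal (p * s powr (p - 1) * G t) \<partial>lborel)"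
    using p meas by (subst nn_integral_cmult[symmetric]) (auto simp: ennreal_mult' mult.assoc intro!: nn_integral_cong)
  also have "\<dots> \<le> (\<integral>\<^sup>+t. ennreal ((p - 1) * s powr p) * indicator {0..R} t + ennreal (G t powr p) * indicator {0..R} t \<partial>lborel)"
    using pw[OF G0] p by (intro nn_integral_mono) (auto simp: ennreal_plus[symmetric] split: split_indicator simp del: ennreal_plus intro!: ennreal_leI)
  also have "\<dots> = ennreal ((p - 1) * s powr p) * ennreal R + ?I"
    using R meas by (subst nn_integral_add) (auto simp: nn_integral_cmult_indicator)
  finally have "ennreal (p * s powr (p - 1) * a) \<le> ennreal ((p - 1) * s powr p * R) + ?I"
    using p a R by (simp add: ennreal_mult'[symmetric] ennreal_mult''[symmetric])
  moreover have "p * s powr (p - 1) * a = (p - 1) * s powr p * R + R * s powr p"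
  proof -
    have "a = s * R" using R by (simp add: s_def)
    moreover have "s powr (p - 1) * s = s powr p"
      using s0 p by (cases "s = 0") (auto simp: powr_mult_base mult.commute)
    ultimately have "p * s powr (p - 1) * a = p * s powr p * R" by (metis mult.assoc)
    then show ?thesis by (simp add: algebra_simps)
  qed
  ultimately have "ennreal ((p - 1) * s powr p * R) + ennreal (R * s powr p) \<le> ennreal ((p - 1) * s powr p * R) + ?I"
    using p R by (simp add: ennreal_plus)
  then have *: "ennreal (R * s powr p) \<le> ?I"
    using ennreal_add_left_cancel_le[of "ennreal ((p - 1) * s powr p * R)"] by simp
  have "a powr p = R powr (p - 1) * (R * s powr p)"
  proof -
    have "a powr p = (R * s) powr p" using R by (simp add: s_def)
    also have "\<dots> = R powr p * s powr p" using R s0 by (simp add: powr_mult)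
    also have "R powr p = R powr (p - 1) * R" using R by (simp add: powr_diff)
    finally show ?thesis by simp
  qed
  then have "ennreal (a powr p) = ennreal (R powr (p - 1)) * ennreal (R * s powr p)"
    using R by (simp add: ennreal_mult')
  also have "\<dots> \<le> ennreal (R powr (p - 1)) * ?I" by (intro mult_left_mono *) auto
  finally show ?thesis .
qed

section \<open>Transport along families of expanding maps\<close>

text \<open>Change of variables as an inequality: the image of Hausdorff measure under \<open>\<phi>\<close> is at most
  \<open>L\<^sup>d\<close> times Hausdorff measure, because preimages are small
  (\<open>hausdorff_outer_expanding\<close>).\<close>

lemma nn_integral_expanding:
  fixes \<phi> :: "'a::euclidean_space \<Rightarrow> 'a" and T0 :: "'a set"
  assumes d: "1 \<le> d" and pos: "emeasure (hausdorff_measure d) T0 \<noteq> 0" and L: "0 < L"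
    and X: "X \<in> sets borel" and Y: "Y \<in> sets borel" and sub: "\<phi> ` X \<subseteq> Y"
    and meas: "\<phi> \<in> borel_measurable (restrict_space borel X)"
    and exp: "\<And>y y'. y \<in> X \<Longrightarrow> y' \<in> X \<Longrightarrow> dist y y' \<le> L * dist (\<phi> y) (\<phi> y')"
    and g: "g \<in> borel_measurable borel"
  shows "(\<integral>\<^sup>+y\<in>X. g (\<phi> y) \<partial>hausdorff_measure d) \<le> ennreal (L ^ d) * (\<integral>\<^sup>+y\<in>Y. g y \<partial>hausdorff_measure d)"
proof -
  let ?H = "hausdorff_measure d :: 'a measure"
  let ?M = "restrict_space ?H X"
  let ?N = "scale_measure (ennreal (L ^ d)) (density ?H (indicator Y))"
  have meas': "\<phi> \<in> ?M \<rightarrow>\<^sub>M borel"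
    using meas by (simp add: measurable_cong_sets[OF sets_restrict_space_cong[OF sets_hausdorff] refl])
  have le: "emeasure (distr ?M borel \<phi>) A \<le> emeasure ?N A" if A: "A \<in> sets borel" for A
  proof -
    have pre: "\<phi> -` A \<inter> X \<in> sets borel"
      using measurable_sets[OF meas A] X by (simp add: space_restrict_space sets_restrict_space_iff)
    have "emeasure (distr ?M borel \<phi>) A = emeasure ?H (\<phi> -` A \<inter> X)"
      using A meas' X by (simp add: emeasure_distr space_restrict_space emeasure_restrict_space)
    also have "\<dots> = hausdorff_outer d {y \<in> X. \<phi> y \<in> A \<inter> Y}"
      using emeasure_hausdorff[OF pos pre] sub by (auto intro!: arg_cong[where f = "hausdorff_outer d"])
    also have "\<dots> \<le> ennreal (L ^ d) * hausdorff_outer d (A \<inter> Y)"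
      by (rule hausdorff_outer_expanding[OF d L exp])
    also have "\<dots> = emeasure ?N A"
    proof -
      have "emeasure (density ?H (indicator Y)) A = emeasure ?H (A \<inter> Y)"
        using A Y by (simp add: emeasure_density indicator_inter_arith[symmetric] Int_commute)
      then show ?thesis using emeasure_hausdorff[OF pos, of "A \<inter> Y"] A Y by simp
    qed
    finally show ?thesis .
  qed
  have "(\<integral>\<^sup>+y\<in>X. g (\<phi> y) \<partial>?H) = (\<integral>\<^sup>+y. g (\<phi> y) \<partial>?M)"
    using X by (simp add: nn_integral_restrict_space)
  also have "\<dots> = (\<integral>\<^sup>+y. g y \<partial>distr ?M borel \<phi>)"
    using meas' g by (simp add: nn_integral_distr)
  also have "\<dots> \<le> (\<integral>\<^sup>+y. g y \<partial>?N)"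
    using le by (intro nn_integral_mono_measure) (auto simp: le_measure)
  also have "\<dots> = ennreal (L ^ d) * (\<integral>\<^sup>+y\<in>Y. g y \<partial>?H)"
    using g Y by (subst nn_integral_scale_measure) (auto simp: nn_integral_density mult.commute)
  finally show ?thesis .
qed

text \<open>Every point \<open>y\<close> travels inside \<open>S\<close> along \<open>t \<mapsto> \<phi> t y\<close> until
  its own stopping time \<open>\<tau> y\<close>. The upper gradient bounds the increment of \<open>w\<close> by
  an integral over time, Jensen moves the power inside, and after exchanging the integrals each time slice is a
  change of variables under an expanding map. Stopping times let a point halt at the boundary of
  \<open>S\<close>.\<close>

lemma transport_inequality:
  fixes \<phi> :: "real \<Rightarrow> 'a::euclidean_space \<Rightarrow> 'a" and T0 :: "'a set"
  assumes d: "1 \<le> d" and pos: "emeasure (hausdorff_measure d) T0 \<noteq> 0"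
    and p: "1 < p" and L: "0 < L" and R: "0 < R"
    and S: "S \<in> sets borel" "emeasure (hausdorff_measure d) S \<noteq> \<infinity>"
    and X: "X \<in> sets borel" "X \<subseteq> S"
    and \<tau>: "continuous_on X \<tau>" "\<And>y. y \<in> X \<Longrightarrow> 0 \<le> \<tau> y \<and> \<tau> y \<le> R"
    and cont: "continuous_on ({0..R} \<times> X) (\<lambda>(t, y). \<phi> t y)"
    and in_S: "\<And>t y. y \<in> X \<Longrightarrow> 0 \<le> t \<Longrightarrow> t \<le> \<tau> y \<Longrightarrow> \<phi> t y \<in> S"
    and start: "\<And>y. y \<in> X \<Longrightarrow> \<phi> 0 y = y"
    and lip: "\<And>y. y \<in> X \<Longrightarrow> L-lipschitz_on {0..R} (\<lambda>t. \<phi> t y)"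
    and exp: "\<And>t y y'. y \<in> X \<Longrightarrow> y' \<in> X \<Longrightarrow> 0 \<le> t \<Longrightarrow> t \<le> R \<Longrightarrow> dist y y' \<le> L * dist (\<phi> t y) (\<phi> t y')"
    and ug: "upper_gradient S w G" and G: "G \<in> borel_measurable borel" "\<And>x. 0 \<le> G x"
  shows "(\<integral>\<^sup>+y\<in>X. ennreal (\<bar>w (\<phi> (\<tau> y) y) - w y\<bar> powr p) \<partial>hausdorff_measure d)
     \<le> ennreal (R powr p * L powr p * L ^ d) * (\<integral>\<^sup>+y\<in>S. ennreal (G y powr p) \<partial>hausdorff_measure d)"
proof -
  let ?H = "hausdorff_measure d :: 'a measure"
  define D where "D = {(t, y). y \<in> X \<and> 0 \<le> t \<and> t \<le> \<tau> y}"
  define N where "N = density ?H (indicator X)"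
  define J where "J = (\<integral>\<^sup>+y\<in>S. ennreal (G y powr p) \<partial>?H)"
  have [simp, measurable_cong]: "sets N = sets borel" by (simp add: N_def)
  have finN: "finite_measure N"
  proof
    have "emeasure N (space N) = emeasure ?H X"
      using X by (simp add: N_def emeasure_density)
    also have "\<dots> \<le> emeasure ?H S" using X S by (intro emeasure_mono) auto
    finally show "emeasure N (space N) \<noteq> \<infinity>" using S(2) by (metis infinity_ennreal_def neq_top_trans)
  qed
  interpret N: finite_measure N by (rule finN)
  interpret pair_sigma_finite lborel N ..
  have Gm: "(\<lambda>y. ennreal (G y powr p)) \<in> borel_measurable borel" using G(1) by measurable
  have \<tau>m: "(\<lambda>y. \<tau> y * indicator X y) \<in> borel_measurable borel"
    using borel_measurable_continuous_on_restrict[OF \<tau>(1)] X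
    by (subst (asm) borel_measurable_restrict_space_iff) (auto simp: mult.commute)
  have D: "D \<in> sets (borel :: (real \<times> 'a) measure)"
  proof -
    have "D = {z \<in> space (borel \<Otimes>\<^sub>M borel). snd z \<in> X \<and> 0 \<le> fst z \<and> fst z \<le> \<tau> (snd z) * indicator X (snd z)}"
      by (auto simp: D_def space_pair_measure)
    also have "\<dots> \<in> sets (borel \<Otimes>\<^sub>M borel)" using \<tau>m X(1) by measurable
    finally show ?thesis unfolding borel_prod[symmetric] .
  qed
  have Dsub: "D \<subseteq> {0..R} \<times> X" using \<tau>(2) by (force simp: D_def)
  have \<phi>D: "(\<lambda>(t, y). \<phi> t y) \<in> borel_measurable (restrict_space borel D)"
    by (intro borel_measurable_continuous_on_restrict continuous_on_subset[OF cont Dsub])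
  define F where "F z = G (case z of (t, y) \<Rightarrow> \<phi> t y) * indicator D z" for z
  have Fm: "F \<in> borel_measurable borel"
  proof -
    have "(\<lambda>z. G (case z of (t, y) \<Rightarrow> \<phi> t y)) \<in> borel_measurable (restrict_space borel D)"
      using measurable_compose[OF \<phi>D G(1)] .
    then show ?thesis using D unfolding F_def
      by (subst (asm) borel_measurable_restrict_space_iff) (auto simp: mult.commute)
  qed
  have F0: "0 \<le> F z" for z using G(2) by (simp add: F_def)
  have Fm2: "F \<in> borel_measurable (borel \<Otimes>\<^sub>M borel)" using Fm unfolding borel_prod .
  have Fm3: "(\<lambda>t. F (t, y)) \<in> borel_measurable borel" for y using Fm2 by measurable
  have pw: "ennreal (\<bar>w (\<phi> (\<tau> y) y) - w y\<bar> powr p) \<le>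
      ennreal (L powr p * R powr (p - 1)) * (\<integral>\<^sup>+t\<in>{0..R}. ennreal (F (t, y) powr p) \<partial>lborel)" if y: "y \<in> X" for y
  proof -
    have \<tau>y: "0 \<le> \<tau> y" "\<tau> y \<le> R" using \<tau>(2)[OF y] by auto
    define a where "a = \<bar>w (\<phi> (\<tau> y) y) - w y\<bar> / L"
    have "ennreal \<bar>w (\<phi> (\<tau> y) y) - w (\<phi> 0 y)\<bar> \<le> ennreal L * (\<integral>\<^sup>+t\<in>{0..\<tau> y}. ennreal (G (\<phi> t y)) \<partial>lborel)"
      using ug \<tau>y in_S[OF y] lipschitz_on_subset[OF lip[OF y], of "{0..\<tau> y}"] unfolding upper_gradient_def
      by (intro ug[unfolded upper_gradient_def, rule_format]) auto
    also have "(\<integral>\<^sup>+t\<in>{0..\<tau> y}. ennreal (G (\<phi> t y)) \<partial>lborel) = (\<integral>\<^sup>+t\<in>{0..R}. ennreal (F (t, y)) \<partial>lborel)"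
      using \<tau>y y by (intro nn_integral_cong) (auto simp: F_def D_def split: split_indicator)
    finally have "ennreal L * ennreal a \<le> ennreal L * (\<integral>\<^sup>+t\<in>{0..R}. ennreal (F (t, y)) \<partial>lborel)"
      using L y by (simp add: a_def start ennreal_mult'[symmetric])
    then have "ennreal a \<le> (\<integral>\<^sup>+t\<in>{0..R}. ennreal (F (t, y)) \<partial>lborel)"
      using L by (subst (asm) ennreal_mult_le_mult_iff) auto
    then have "ennreal (a powr p) \<le> ennreal (R powr (p - 1)) * (\<integral>\<^sup>+t\<in>{0..R}. ennreal (F (t, y) powr p) \<partial>lborel)"
      using p R L F0 Fm3 by (intro power_mean_nn_integral) (auto simp: a_def)
    then have "ennreal (L powr p) * ennreal (a powr p) \<le> ennreal (L powr p) * (ennreal (R powr (p - 1)) * (\<integral>\<^sup>+t\<in>{0..R}. ennreal (F (t, y) powr p) \<partial>lborel))"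
      by (rule mult_left_mono) simp
    moreover have "L powr p * a powr p = \<bar>w (\<phi> (\<tau> y) y) - w y\<bar> powr p"
      using L by (simp add: a_def powr_mult[symmetric])
    ultimately show ?thesis by (simp add: ennreal_mult' mult.assoc[symmetric] flip: ennreal_mult')
  qed
  have slice: "(\<integral>\<^sup>+y. ennreal (F (t, y) powr p) \<partial>N) \<le> ennreal (L ^ d) * J" if t: "0 \<le> t" "t \<le> R" for t
  proof -
    define Xt where "Xt = {y \<in> X. t \<le> \<tau> y}"
    have Xt: "Xt \<in> sets borel"
    proof -
      have "Xt = {y \<in> space borel. y \<in> X \<and> t \<le> \<tau> y * indicator X y}" by (auto simp: Xt_def)
      also have "\<dots> \<in> sets borel" using \<tau>m X(1) by measurable
      finally show ?thesis .
    qed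
    have "continuous_on Xt (\<lambda>y. (\<lambda>(t, y). \<phi> t y) (t, y))"
      using t by (intro continuous_on_compose2[OF cont]) (auto intro!: continuous_intros simp: Xt_def)
    then have \<phi>t: "\<phi> t \<in> borel_measurable (restrict_space borel Xt)"
      by (intro borel_measurable_continuous_on_restrict) simp
    have "(\<integral>\<^sup>+y. ennreal (F (t, y) powr p) \<partial>N) = (\<integral>\<^sup>+y\<in>X. ennreal (F (t, y) powr p) \<partial>?H)"
      unfolding N_def using X(1) Fm2 by (subst nn_integral_density) (auto simp: mult.commute)
    also have "\<dots> = (\<integral>\<^sup>+y\<in>Xt. ennreal (G (\<phi> t y) powr p) \<partial>?H)"
      using t p by (intro nn_integral_cong) (auto simp: F_def D_def Xt_def split: split_indicator)
    also have "\<dots> \<le> ennreal (L ^ d) * J"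
      unfolding J_def
      using t in_S exp Gm by (intro nn_integral_expanding[OF d pos L Xt S(1) _ \<phi>t, where g = "\<lambda>y. ennreal (G y powr p)"])
        (auto simp: Xt_def)
    finally show ?thesis .
  qed
  have "(\<integral>\<^sup>+y\<in>X. ennreal (\<bar>w (\<phi> (\<tau> y) y) - w y\<bar> powr p) \<partial>?H)
     \<le> (\<integral>\<^sup>+y\<in>X. ennreal (L powr p * R powr (p - 1)) * (\<integral>\<^sup>+t\<in>{0..R}. ennreal (F (t, y) powr p) \<partial>lborel) \<partial>?H)"
    using pw by (intro nn_integral_mono) (auto split: split_indicator)
  also have "\<dots> = (\<integral>\<^sup>+y. ennreal (L powr p * R powr (p - 1)) * (\<integral>\<^sup>+t\<in>{0..R}. ennreal (F (t, y) powr p) \<partial>lborel) \<partial>N)"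
    unfolding N_def using X(1) Fm2 by (subst nn_integral_density) (auto simp: mult.commute)
  also have "\<dots> = ennreal (L powr p * R powr (p - 1)) * (\<integral>\<^sup>+y. (\<integral>\<^sup>+t. ennreal (F (t, y) powr p) * indicator {0..R} t \<partial>lborel) \<partial>N)"
    using Fm2 by (subst nn_integral_cmult) auto
  also have "(\<integral>\<^sup>+y. (\<integral>\<^sup>+t. ennreal (F (t, y) powr p) * indicator {0..R} t \<partial>lborel) \<partial>N)
      = (\<integral>\<^sup>+t. (\<integral>\<^sup>+y. ennreal (F (t, y) powr p) * indicator {0..R} t \<partial>N) \<partial>lborel)"
  proof (rule Fubini')
    have "(\<lambda>z. ennreal (F z powr p) * indicator {0..R} (fst z)) \<in> borel_measurable (borel \<Otimes>\<^sub>M borel)"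
      using Fm2 by measurable
    moreover have "sets (lborel \<Otimes>\<^sub>M N) = sets (borel \<Otimes>\<^sub>M borel)" by (intro sets_pair_measure_cong) auto
    ultimately show "case_prod (\<lambda>t y. ennreal (F (t, y) powr p) * indicator {0..R} t) \<in> borel_measurable (lborel \<Otimes>\<^sub>M N)"
      using measurable_cong_sets by (simp add: case_prod_unfold)
  qed
  also have "\<dots> \<le> (\<integral>\<^sup>+t. ennreal (L ^ d) * J * indicator {0..R} t \<partial>lborel)"
    using slice by (intro nn_integral_mono) (auto split: split_indicator)
  also have "\<dots> = ennreal (L ^ d) * J * ennreal R"
    using R by (subst nn_integral_cmult_indicator) auto
  finally have "(\<integral>\<^sup>+y\<in>X. ennreal (\<bar>w (\<phi> (\<tau> y) y) - w y\<bar> powr p) \<partial>?H)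
    \<le> ennreal (L powr p * R powr (p - 1)) * (ennreal (L ^ d) * J * ennreal R)"
    by (simp add: mult_left_mono)
  also have "\<dots> = ennreal (L powr p * R powr (p - 1) * L ^ d * R) * J"
    using L R by (simp add: ennreal_mult' mult_ac)
  also have "L powr p * R powr (p - 1) * L ^ d * R = R powr p * L powr p * L ^ d"
    using R by (simp add: powr_diff)
  finally show ?thesis unfolding J_def .
qed

section \<open>Local diffeomorphisms are bi-Lipschitz\<close>

text \<open>On a compact ball the finitely many partial derivatives are bounded, and so is the operator norm.\<close>

lemma Ck1_locally_lipschitz:
  fixes f :: "'a::euclidean_space \<Rightarrow> 'b::euclidean_space"
  assumes U: "open U" and C1: "Ck_on (Suc 0) U f" and x: "x \<in> U"
  obtains r L where "0 < r" "0 < L" "cball x r \<subseteq> U"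
    "\<And>y z. y \<in> cball x r \<Longrightarrow> z \<in> cball x r \<Longrightarrow> norm (f y - f z) \<le> L * norm (y - z)"
proof -
  obtain r where r: "0 < r" "cball x r \<subseteq> U" using U x open_contains_cball by blast
  define D where "D y = frechet_derivative f (at y)" for y
  have der: "(f has_derivative D y) (at y)" if "y \<in> U" for y
    using C1 that frechet_derivative_works unfolding D_def by auto
  have cont: "continuous_on U (\<lambda>y. D y v)" for v using C1 by (simp add: D_def)
  have "continuous_on (cball x r) (\<lambda>y. \<Sum>b\<in>Basis. norm (D y b))"
    using r(2) by (intro continuous_intros continuous_on_subset[OF cont])
  then have "bounded ((\<lambda>y. \<Sum>b\<in>Basis. norm (D y b)) ` cball x r)"
    by (intro compact_imp_bounded compact_continuous_image) auto
  then obtain L0 where L0: "\<And>y. y \<in> cball x r \<Longrightarrow> norm (\<Sum>b\<in>Basis. norm (D y b)) \<le> L0"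
    unfolding bounded_iff by blast
  define L where "L = max L0 1"
  show thesis
  proof (rule that[OF r(1) _ r(2)])
    show "0 < L" by (simp add: L_def)
    fix y z assume yz: "y \<in> cball x r" "z \<in> cball x r"
    show "norm (f y - f z) \<le> L * norm (y - z)"
    proof (rule differentiable_bound[OF convex_cball _ _ yz])
      fix u assume u: "u \<in> cball x r"
      with r have uU: "u \<in> U" by auto
      show "(f has_derivative D u) (at u within cball x r)" using der[OF uU] by (rule has_derivative_at_withinI)
      have lin: "linear (D u)" using der[OF uU] by (rule has_derivative_linear)
      show "onorm (D u) \<le> L"
      proof (rule onorm_le)
        fix v
        have "D u v = D u (\<Sum>b\<in>Basis. (v \<bullet> b) *\<^sub>R b)" by (simp add: euclidean_representation)
        also have "\<dots> = (\<Sum>b\<in>Basis. (v \<bullet> b) *\<^sub>R D u b)" by (simp add: linear_sum[OF lin] linear_scale[OF lin])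
        finally have "norm (D u v) \<le> (\<Sum>b\<in>Basis. \<bar>v \<bullet> b\<bar> * norm (D u b))"
          using norm_sum[of "\<lambda>b. (v \<bullet> b) *\<^sub>R D u b" Basis] by simp
        also have "\<dots> \<le> (\<Sum>b\<in>Basis. norm v * norm (D u b))"
          by (intro sum_mono mult_right_mono Basis_le_norm) auto
        also have "\<dots> = norm v * (\<Sum>b\<in>Basis. norm (D u b))" by (simp add: sum_distrib_left)
        also have "\<dots> \<le> norm v * L" using L0[OF u] by (intro mult_left_mono) (auto simp: L_def)
        finally show "norm (D u v) \<le> L * norm v" by (simp add: mult.commute)
      qed
    qed
  qed
qed

lemma local_diffeo_inverse:
  assumes "local_diffeo x U \<Phi> \<Psi>" "q \<in> \<Phi> ` U" shows "\<Psi> q \<in> U" "\<Phi> (\<Psi> q) = q"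
  using assms by (auto simp: local_diffeo_def)

lemma local_diffeo_bilipschitz:
  assumes ld: "local_diffeo (x :: 'a::euclidean_space) U \<Phi> \<Psi>"
  obtains r R L where "0 < r" "0 < R" "1 \<le> L" "ball x r \<subseteq> U" "ball (\<Phi> x) R \<subseteq> \<Phi> ` U"
    "\<And>y z. y \<in> ball x r \<Longrightarrow> z \<in> ball x r \<Longrightarrow> dist (\<Phi> y) (\<Phi> z) \<le> L * dist y z"
    "\<And>y z. y \<in> ball (\<Phi> x) R \<Longrightarrow> z \<in> ball (\<Phi> x) R \<Longrightarrow> dist (\<Psi> y) (\<Psi> z) \<le> L * dist y z"
    "\<Psi> ` ball (\<Phi> x) R \<subseteq> ball x r"
proof -
  have U: "open U" "Ck_on (Suc 0) U \<Phi>" "x \<in> U" "open (\<Phi> ` U)" "Ck_on (Suc 0) (\<Phi> ` U) \<Psi>" "\<Phi> x \<in> \<Phi> ` U"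
    using ld unfolding local_diffeo_def smooth_on_def by blast+
  have \<Psi>x: "\<Psi> (\<Phi> x) = x" using ld by (simp add: local_diffeo_def)
  obtain r L where r: "0 < r" "0 < L" "cball x r \<subseteq> U"
    "\<And>y z. y \<in> cball x r \<Longrightarrow> z \<in> cball x r \<Longrightarrow> norm (\<Phi> y - \<Phi> z) \<le> L * norm (y - z)"
    using Ck1_locally_lipschitz[OF U(1-3)] by blast
  obtain r' L' where r': "0 < r'" "0 < L'" "cball (\<Phi> x) r' \<subseteq> \<Phi> ` U"
    "\<And>y z. y \<in> cball (\<Phi> x) r' \<Longrightarrow> z \<in> cball (\<Phi> x) r' \<Longrightarrow> norm (\<Psi> y - \<Psi> z) \<le> L' * norm (y - z)"
    using Ck1_locally_lipschitz[OF U(4-6)] by blast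
  define R where "R = min r' (r / L')"
  define M where "M = max 1 (max L L')"
  have M: "L * a \<le> M * a" "L' * a \<le> M * a" if "0 \<le> a" for a
    using that by (auto simp: M_def intro!: mult_right_mono)
  show thesis
  proof (rule that[of r R M])
    show "0 < R" "0 < r" "1 \<le> M" using r r' by (auto simp: R_def M_def)
    show "ball x r \<subseteq> U" using r(3) by auto
    have sub: "ball (\<Phi> x) R \<subseteq> cball (\<Phi> x) r'" by (auto simp: R_def)
    then show "ball (\<Phi> x) R \<subseteq> \<Phi> ` U" using r'(3) by blast
    show "dist (\<Phi> y) (\<Phi> z) \<le> M * dist y z" if "y \<in> ball x r" "z \<in> ball x r" for y z
      using r(4)[of y z] that M(1)[of "dist y z"] by (simp add: dist_norm)
    show "dist (\<Psi> y) (\<Psi> z) \<le> M * dist y z" if "y \<in> ball (\<Phi> x) R" "z \<in> ball (\<Phi> x) R" for y z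
      using r'(4)[of y z] that sub M(2)[of "dist y z"] by (fastforce simp: dist_norm)
    show "\<Psi> ` ball (\<Phi> x) R \<subseteq> ball x r"
    proof safe
      fix q assume q: "q \<in> ball (\<Phi> x) R"
      have "norm (\<Psi> (\<Phi> x) - \<Psi> q) \<le> L' * norm (\<Phi> x - q)" using r'(1) sub q by (intro r'(4)) auto
      also have "\<dots> < L' * (r / L')" using q r'(2) by (intro mult_strict_left_mono) (auto simp: R_def dist_norm)
      finally show "\<Psi> q \<in> ball x r" using r'(2) by (simp add: \<Psi>x dist_norm)
    qed
  qed
qed

text \<open>In the chart the motion is a translation, so it preserves distances there; reading it on the surface costs one
  factor \<open>L\<close> for each use of the chart or its inverse.\<close>

lemma chart_translation_flow:
  fixes v :: "'a::euclidean_space"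
  assumes ld: "local_diffeo a U \<Phi> \<Psi>" and L: "1 \<le> L" and dom: "ball a r \<subseteq> U" "ball (\<Phi> a) R \<subseteq> \<Phi> ` U"
    and lip\<Phi>: "\<And>y z. y \<in> ball a r \<Longrightarrow> z \<in> ball a r \<Longrightarrow> dist (\<Phi> y) (\<Phi> z) \<le> L * dist y z"
    and lip\<Psi>: "\<And>y z. y \<in> ball (\<Phi> a) R \<Longrightarrow> z \<in> ball (\<Phi> a) R \<Longrightarrow> dist (\<Psi> y) (\<Psi> z) \<le> L * dist y z"
    and \<Psi>b: "\<Psi> ` ball (\<Phi> a) R \<subseteq> ball a r"
    and X: "X \<subseteq> ball a r" and b: "0 \<le> b"
    and inball: "\<And>y t. y \<in> X \<Longrightarrow> 0 \<le> t \<Longrightarrow> t \<le> b \<Longrightarrow> \<Phi> y + t *\<^sub>R v \<in> ball (\<Phi> a) R"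
  shows "continuous_on ({0..b} \<times> X) (\<lambda>(t, y). \<Psi> (\<Phi> y + t *\<^sub>R v))"
    and "y \<in> X \<Longrightarrow> (L * norm v)-lipschitz_on {0..b} (\<lambda>t. \<Psi> (\<Phi> y + t *\<^sub>R v))"
    and "y \<in> X \<Longrightarrow> y' \<in> X \<Longrightarrow> 0 \<le> t \<Longrightarrow> t \<le> b \<Longrightarrow>
      dist y y' \<le> L\<^sup>2 * dist (\<Psi> (\<Phi> y + t *\<^sub>R v)) (\<Psi> (\<Phi> y' + t *\<^sub>R v))"
proof -
  have "L-lipschitz_on X \<Phi>" using subsetD[OF X] lip\<Phi> L by (intro lipschitz_onI) auto
  then have \<Phi>c: "continuous_on X \<Phi>" by (rule lipschitz_on_continuous_on)
  have "L-lipschitz_on (ball (\<Phi> a) R) \<Psi>" using lip\<Psi> L by (intro lipschitz_onI) auto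
  then have \<Psi>c: "continuous_on (ball (\<Phi> a) R) \<Psi>" by (rule lipschitz_on_continuous_on)
  have "continuous_on ({0..b} \<times> X) (\<lambda>z. \<Psi> (\<Phi> (snd z) + fst z *\<^sub>R v))"
    using inball by (intro continuous_on_compose2[OF \<Psi>c] continuous_intros continuous_on_compose2[OF \<Phi>c]) auto
  then show "continuous_on ({0..b} \<times> X) (\<lambda>(t, y). \<Psi> (\<Phi> y + t *\<^sub>R v))" by (simp add: case_prod_unfold)
  show "(L * norm v)-lipschitz_on {0..b} (\<lambda>t. \<Psi> (\<Phi> y + t *\<^sub>R v))" if y: "y \<in> X"
  proof (rule lipschitz_onI)
    fix t t' :: real assume "t \<in> {0..b}" "t' \<in> {0..b}"
    then have "dist (\<Psi> (\<Phi> y + t *\<^sub>R v)) (\<Psi> (\<Phi> y + t' *\<^sub>R v)) \<le> L * dist (\<Phi> y + t *\<^sub>R v) (\<Phi> y + t' *\<^sub>R v)"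
      using inball[OF y] by (intro lip\<Psi>) auto
    also have "dist (\<Phi> y + t *\<^sub>R v) (\<Phi> y + t' *\<^sub>R v) = norm v * dist t t'"
      by (simp add: dist_norm scaleR_left_diff_distrib[symmetric] mult.commute)
    finally show "dist (\<Psi> (\<Phi> y + t *\<^sub>R v)) (\<Psi> (\<Phi> y + t' *\<^sub>R v)) \<le> L * norm v * dist t t'" by (simp add: mult.assoc)
  qed (use L in simp)
  show "dist y y' \<le> L\<^sup>2 * dist (\<Psi> (\<Phi> y + t *\<^sub>R v)) (\<Psi> (\<Phi> y' + t *\<^sub>R v))"
    if y: "y \<in> X" "y' \<in> X" and t: "0 \<le> t" "t \<le> b"
  proof -
    have start: "\<Phi> y \<in> ball (\<Phi> a) R" "\<Phi> y' \<in> ball (\<Phi> a) R" using inball[of _ 0] y b by auto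
    have "y \<in> U" "y' \<in> U" using y X dom(1) by blast+
    then have "dist y y' = dist (\<Psi> (\<Phi> y)) (\<Psi> (\<Phi> y'))" using ld by (simp add: local_diffeo_def)
    also have "\<dots> \<le> L * dist (\<Phi> y) (\<Phi> y')" using start by (rule lip\<Psi>)
    also have "dist (\<Phi> y) (\<Phi> y') = dist (\<Phi> y + t *\<^sub>R v) (\<Phi> y' + t *\<^sub>R v)" by (simp add: dist_norm)
    also have "\<dots> = dist (\<Phi> (\<Psi> (\<Phi> y + t *\<^sub>R v))) (\<Phi> (\<Psi> (\<Phi> y' + t *\<^sub>R v)))"
      using inball[OF y(1) t] inball[OF y(2) t] dom(2) local_diffeo_inverse(2)[OF ld] by (metis subsetD)
    also have "\<dots> \<le> L * dist (\<Psi> (\<Phi> y + t *\<^sub>R v)) (\<Psi> (\<Phi> y' + t *\<^sub>R v))"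
      using \<Psi>b inball[OF y(1) t] inball[OF y(2) t] by (intro lip\<Phi>) (auto simp del: mem_ball)
    finally show ?thesis using L by (simp add: power2_eq_square mult_left_mono)
  qed
qed

section \<open>Poincare inequality on a connected hypersurface with boundary\<close>

text \<open>The pairs for which the Poincare inequality is proved. They do not refer to a mesh, so that one constant
  serves all meshes.\<close>

definition boundary_zero_pair :: "'a::euclidean_space set \<Rightarrow> ('a \<Rightarrow> real) \<Rightarrow> ('a \<Rightarrow> real) \<Rightarrow> bool" where
  "boundary_zero_pair S w G \<longleftrightarrow> continuous_on S w \<and> (\<forall>x\<in>surface_boundary S. w x = 0) \<and>
     G \<in> borel_measurable borel \<and> (\<forall>x. 0 \<le> G x) \<and> upper_gradient S w G"

locale hausdorff_surface =
  fixes d :: nat and S T0 :: "'a::euclidean_space set" and p :: real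
  assumes d: "1 \<le> d" and p: "1 < p" and compact_S: "compact S"
    and finite_S: "emeasure (hausdorff_measure d) S \<noteq> \<infinity>"
    and nonzero: "emeasure (hausdorff_measure d) T0 \<noteq> 0"
begin

abbreviation "H \<equiv> hausdorff_measure d :: 'a measure"

text \<open>The left side is local, the right side is global. With this choice the property travels along
  \<open>S\<close>, and finitely many neighbourhoods can be added up.\<close>

definition poincare_at :: "'a \<Rightarrow> bool" where
  "poincare_at y \<longleftrightarrow> (\<exists>r>0. \<exists>C. \<forall>w G. boundary_zero_pair S w G \<longrightarrow>
      (\<integral>\<^sup>+z\<in>S \<inter> ball y r. ennreal (\<bar>w z\<bar> powr p) \<partial>H) \<le> ennreal C * (\<integral>\<^sup>+z\<in>S. ennreal (G z powr p) \<partial>H))"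

lemma borel_S: "S \<in> sets borel" using compact_S by (simp add: borel_compact)

lemma boundary_zero_pair_measurable:
  assumes "boundary_zero_pair S w G" "A \<in> sets borel" "A \<subseteq> S"
  shows "(\<lambda>z. ennreal (\<bar>w z\<bar> powr p) * indicator A z) \<in> borel_measurable borel"
proof -
  have "w \<in> borel_measurable (restrict_space borel A)"
    using assms by (intro borel_measurable_continuous_on_restrict) (auto simp: boundary_zero_pair_def intro: continuous_on_subset)
  then have "(\<lambda>z. ennreal (\<bar>w z\<bar> powr p)) \<in> borel_measurable (restrict_space borel A)" by measurable
  then show ?thesis using assms(2) by (subst (asm) borel_measurable_restrict_space_iff_ennreal) auto
qed

text \<open>In a chart onto a half-hyperplane, push points in the direction \<open>-e'\<close> until they reach the edge,
  where \<open>w\<close> vanishes. The stopping time is the distance to the edge in the chart.\<close>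

lemma poincare_at_boundary_chart:
  assumes "a \<in> S" and bc: "boundary_chart_at S a"
  shows "\<exists>s>0. \<forall>y\<in>S \<inter> ball a s. poincare_at y"
proof -
  from bc obtain U \<Phi> \<Psi> e e' where ee: "e \<in> Basis" "e' \<in> Basis" "e \<noteq> e'" and ld: "local_diffeo a U \<Phi> \<Psi>"
    and a0: "\<Phi> a \<bullet> e' = 0" and flat: "\<Phi> ` (S \<inter> U) = {y \<in> \<Phi> ` U. y \<bullet> e = 0 \<and> y \<bullet> e' \<ge> 0}"
    unfolding boundary_chart_at_def by blast
  obtain r R L where rR: "0 < r" "0 < R" "1 \<le> L" "ball a r \<subseteq> U" "ball (\<Phi> a) R \<subseteq> \<Phi> ` U"
    and lip\<Phi>: "\<And>y z. y \<in> ball a r \<Longrightarrow> z \<in> ball a r \<Longrightarrow> dist (\<Phi> y) (\<Phi> z) \<le> L * dist y z"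
    and lip\<Psi>: "\<And>y z. y \<in> ball (\<Phi> a) R \<Longrightarrow> z \<in> ball (\<Phi> a) R \<Longrightarrow> dist (\<Psi> y) (\<Psi> z) \<le> L * dist y z"
    and \<Psi>b: "\<Psi> ` ball (\<Phi> a) R \<subseteq> ball a r"
    using local_diffeo_bilipschitz[OF ld] by metis
  \<comment> \<open>a quarter of \<open>R\<close> for the start, half of it for the motion: the moving points stay in the ball of radius \<open>R\<close>\<close>
  define s where "s = min r (R / (4 * L))"
  have s: "0 < s" "s \<le> r" "L * s \<le> R / 4" using rR by (auto simp: s_def min_def field_simps)
  define X where "X = S \<inter> ball a s"
  define \<tau> where "\<tau> y = \<Phi> y \<bullet> e'" for y
  define \<phi> where "\<phi> t y = \<Psi> (\<Phi> y + t *\<^sub>R (- e'))" for t y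
  have e1: "norm e' = 1" "e' \<bullet> e = 0" "e' \<bullet> e' = 1" using ee by (auto simp: inner_not_same_Basis norm_Basis)
  have Xr: "y \<in> ball a r" "y \<in> S \<inter> U" if "y \<in> X" for y using that s rR(4) by (auto simp: X_def)
  have \<Phi>near: "dist (\<Phi> a) (\<Phi> y) \<le> R / 4" if "y \<in> X" for y
  proof -
    have "dist (\<Phi> a) (\<Phi> y) \<le> L * dist a y" using rR Xr[OF that] by (intro lip\<Phi>) auto
    also have "\<dots> \<le> L * s" using that rR by (intro mult_left_mono) (auto simp: X_def)
    finally show ?thesis using s by simp
  qed
  have inball: "\<Phi> y + t *\<^sub>R (- e') \<in> ball (\<Phi> a) R" if "y \<in> X" "0 \<le> t" "t \<le> R / 2" for y t
  proof -
    have "dist (\<Phi> a) (\<Phi> y + t *\<^sub>R (- e')) \<le> dist (\<Phi> a) (\<Phi> y) + norm (t *\<^sub>R e')"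
      using norm_triangle_ineq[of "\<Phi> a - \<Phi> y" "t *\<^sub>R e'"] by (simp add: dist_norm algebra_simps)
    also have "\<dots> \<le> R / 4 + R / 2" using \<Phi>near[OF that(1)] that e1 by simp
    finally show ?thesis using rR by simp
  qed
  have \<tau>: "0 \<le> \<tau> y \<and> \<tau> y \<le> R / 2" if "y \<in> X" for y
  proof -
    have "\<Phi> y \<in> \<Phi> ` (S \<inter> U)" using Xr[OF that] by blast
    then have "0 \<le> \<tau> y" unfolding flat by (simp add: \<tau>_def)
    moreover have "\<tau> y = (\<Phi> y - \<Phi> a) \<bullet> e'" by (simp add: \<tau>_def inner_diff_left a0)
    moreover have "(\<Phi> y - \<Phi> a) \<bullet> e' \<le> norm (\<Phi> y - \<Phi> a)" using Basis_le_norm[OF ee(2), of "\<Phi> y - \<Phi> a"] by simp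
    ultimately show ?thesis using \<Phi>near[OF that] rR by (simp add: dist_norm norm_minus_commute)
  qed
  have \<Phi>c: "continuous_on X \<Phi>"
  proof (rule lipschitz_on_continuous_on[of L])
    show "L-lipschitz_on X \<Phi>" using Xr lip\<Phi> rR by (intro lipschitz_onI) auto
  qed
  note flow = chart_translation_flow[OF ld rR(3-5) lip\<Phi> lip\<Psi> \<Psi>b, of X "R / 2" "- e'", folded \<phi>_def]
  have in_S: "\<phi> t y \<in> S \<inter> U" "\<Phi> (\<phi> t y) = \<Phi> y + t *\<^sub>R (- e')" if y: "y \<in> X" and t: "0 \<le> t" "t \<le> \<tau> y" for t y
  proof -
    have q: "\<Phi> y + t *\<^sub>R (- e') \<in> \<Phi> ` U" using inball[OF y t(1)] t \<tau>[OF y] rR(5) by auto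
    have "\<Phi> y \<in> \<Phi> ` (S \<inter> U)" using Xr[OF y] by blast
    then have "\<Phi> y \<bullet> e = 0" unfolding flat by simp
    then have "\<Phi> y + t *\<^sub>R (- e') \<in> \<Phi> ` (S \<inter> U)"
      unfolding flat using q t e1 by (simp add: inner_diff_left \<tau>_def)
    then show "\<phi> t y \<in> S \<inter> U" using ld by (auto simp: \<phi>_def local_diffeo_def)
    show "\<Phi> (\<phi> t y) = \<Phi> y + t *\<^sub>R (- e')" unfolding \<phi>_def using local_diffeo_inverse(2)[OF ld q] .
  qed
  have at_end: "w (\<phi> (\<tau> y) y) = 0" if "y \<in> X" "boundary_zero_pair S w G" for y w G
  proof -
    have i: "\<phi> (\<tau> y) y \<in> S \<inter> U" "\<Phi> (\<phi> (\<tau> y) y) \<bullet> e' = 0"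
      using in_S[OF that(1), of "\<tau> y"] \<tau>[OF that(1)] e1 by (auto simp: \<tau>_def inner_diff_left)
    \<comment> \<open>the same chart, read at the end point, shows that it lies on the boundary\<close>
    have "local_diffeo (\<phi> (\<tau> y) y) U \<Phi> \<Psi>" using ld i by (simp add: local_diffeo_def)
    then have "boundary_chart_at S (\<phi> (\<tau> y) y)"
      unfolding boundary_chart_at_def using ee i(2) flat by blast
    then show ?thesis using that(2) i by (auto simp: boundary_zero_pair_def surface_boundary_def)
  qed
  have XS: "X \<in> sets borel" "X \<subseteq> S" using borel_S by (auto simp: X_def)
  define C where "C = (R / 2) powr p * (L^2) powr p * (L^2) ^ d"
  have main: "(\<integral>\<^sup>+z\<in>X. ennreal (\<bar>w z\<bar> powr p) \<partial>H) \<le> ennreal C * (\<integral>\<^sup>+z\<in>S. ennreal (G z powr p) \<partial>H)"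
    if bz: "boundary_zero_pair S w G" for w G
  proof -
    have "(\<integral>\<^sup>+z\<in>X. ennreal (\<bar>w z\<bar> powr p) \<partial>H) = (\<integral>\<^sup>+z\<in>X. ennreal (\<bar>w (\<phi> (\<tau> z) z) - w z\<bar> powr p) \<partial>H)"
      using at_end[OF _ bz] by (intro nn_integral_cong) (auto split: split_indicator)
    also have "\<dots> \<le> ennreal C * (\<integral>\<^sup>+z\<in>S. ennreal (G z powr p) \<partial>H)"
      unfolding C_def
    proof (rule transport_inequality[OF d nonzero p _ _ borel_S finite_S XS])
      show "0 < L\<^sup>2" "0 < R / 2" using rR by auto
      show "continuous_on X \<tau>" unfolding \<tau>_def by (intro continuous_intros \<Phi>c)
      show "0 \<le> \<tau> y \<and> \<tau> y \<le> R / 2" if "y \<in> X" for y using \<tau>[OF that] .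
      show "continuous_on ({0..R / 2} \<times> X) (\<lambda>(t, y). \<phi> t y)" using Xr(1) inball rR by (intro flow(1)) auto
      show "\<phi> t y \<in> S" if "y \<in> X" "0 \<le> t" "t \<le> \<tau> y" for t y using in_S[OF that] by blast
      show "\<phi> 0 y = y" if "y \<in> X" for y using Xr[OF that] ld by (auto simp: \<phi>_def local_diffeo_def)
      show "(L\<^sup>2)-lipschitz_on {0..R / 2} (\<lambda>t. \<phi> t y)" if y: "y \<in> X" for y
      proof (rule lipschitz_on_le)
        show "(L * norm (- e'))-lipschitz_on {0..R / 2} (\<lambda>t. \<phi> t y)"
          using Xr(1) inball rR y by (intro flow(2)) auto
        show "L * norm (- e') \<le> L\<^sup>2" using rR e1 by (simp add: power2_eq_square)
      qed
      show "dist y y' \<le> L\<^sup>2 * dist (\<phi> t y) (\<phi> t y')" if "y \<in> X" "y' \<in> X" "0 \<le> t" "t \<le> R / 2" for t y y'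
        using Xr(1) inball rR that by (intro flow(3)) auto
      show "upper_gradient S w G" "G \<in> borel_measurable borel" "0 \<le> G x" for x
        using bz by (auto simp: boundary_zero_pair_def)
    qed
    finally show ?thesis .
  qed
  have "poincare_at y" if y: "y \<in> S \<inter> ball a s" for y
    unfolding poincare_at_def
  proof (rule exI[of _ "s - dist a y"], rule conjI, goal_cases)
    case 1
    show "0 < s - dist a y" using y by simp
  next
    case 2
    show ?case
    proof (intro exI[of _ C] allI impI)
      fix w G assume bz: "boundary_zero_pair S w G"
      have "(\<integral>\<^sup>+z\<in>S \<inter> ball y (s - dist a y). ennreal (\<bar>w z\<bar> powr p) \<partial>H) \<le> (\<integral>\<^sup>+z\<in>X. ennreal (\<bar>w z\<bar> powr p) \<partial>H)"
      proof (intro nn_integral_mono)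
        fix z
        have "z \<in> S \<inter> ball y (s - dist a y) \<Longrightarrow> z \<in> X" using dist_triangle[of a z y] by (auto simp: X_def)
        then show "ennreal (\<bar>w z\<bar> powr p) * indicator (S \<inter> ball y (s - dist a y)) z \<le> ennreal (\<bar>w z\<bar> powr p) * indicator X z"
          by (auto split: split_indicator)
      qed
      with main[OF bz] show "(\<integral>\<^sup>+z\<in>S \<inter> ball y (s - dist a y). ennreal (\<bar>w z\<bar> powr p) \<partial>H) \<le> ennreal C * (\<integral>\<^sup>+z\<in>S. ennreal (G z powr p) \<partial>H)"
        by order
    qed
  qed
  with s(1) show ?thesis by blast
qed


text \<open>In a chart onto a hyperplane the translation by \<open>\<Phi> x - \<Phi> y\<close> moves a neighbourhood of
  \<open>y\<close> into the given neighbourhood of \<open>x\<close>; the integral there is controlled, and the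
  change of \<open>w\<close> during the motion is controlled by the upper gradient.\<close>

lemma poincare_at_interior_chart:
  assumes "a \<in> S" and ic: "interior_chart_at S a"
  shows "\<exists>s>0. \<forall>x\<in>S \<inter> ball a s. \<forall>y\<in>S \<inter> ball a s. poincare_at x \<longrightarrow> poincare_at y"
proof -
  from ic obtain U \<Phi> \<Psi> e where ee: "e \<in> Basis" and ld: "local_diffeo a U \<Phi> \<Psi>"
    and flat: "\<Phi> ` (S \<inter> U) = {y \<in> \<Phi> ` U. y \<bullet> e = 0}"
    unfolding interior_chart_at_def by blast
  obtain r R L where rR: "0 < r" "0 < R" "1 \<le> L" "ball a r \<subseteq> U" "ball (\<Phi> a) R \<subseteq> \<Phi> ` U"
    and lip\<Phi>: "\<And>y z. y \<in> ball a r \<Longrightarrow> z \<in> ball a r \<Longrightarrow> dist (\<Phi> y) (\<Phi> z) \<le> L * dist y z"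
    and lip\<Psi>: "\<And>y z. y \<in> ball (\<Phi> a) R \<Longrightarrow> z \<in> ball (\<Phi> a) R \<Longrightarrow> dist (\<Psi> y) (\<Psi> z) \<le> L * dist y z"
    and \<Psi>b: "\<Psi> ` ball (\<Phi> a) R \<subseteq> ball a r"
    using local_diffeo_bilipschitz[OF ld] by metis
  define s where "s = min r (R / (4 * L))"
  have s: "0 < s" "s \<le> r" "L * s \<le> R / 4" using rR by (auto simp: s_def min_def field_simps)
  have Xr: "z \<in> ball a r" "z \<in> S \<inter> U" "\<Psi> (\<Phi> z) = z" if "z \<in> S \<inter> ball a s" for z
    using that s rR(4) ld by (auto simp: local_diffeo_def subset_iff)
  have \<Phi>near: "dist (\<Phi> a) (\<Phi> y) \<le> R / 4" if "y \<in> S \<inter> ball a s" for y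
  proof -
    have "dist (\<Phi> a) (\<Phi> y) \<le> L * dist a y" using rR Xr[OF that] by (intro lip\<Phi>) auto
    also have "\<dots> \<le> L * s" using that rR by (intro mult_left_mono) auto
    finally show ?thesis using s by simp
  qed
  have \<Phi>e: "\<Phi> z \<bullet> e = 0" if "z \<in> S \<inter> ball a s" for z
  proof -
    have "\<Phi> z \<in> \<Phi> ` (S \<inter> U)" using Xr[OF that] by blast
    then show ?thesis unfolding flat by simp
  qed
  have "poincare_at y" if x: "x \<in> S \<inter> ball a s" and y: "y \<in> S \<inter> ball a s" and "poincare_at x" for x y
  proof -
    from \<open>poincare_at x\<close> obtain \<rho> C0 where \<rho>: "0 < \<rho>" and C0: "\<And>w G. boundary_zero_pair S w G \<Longrightarrow>
      (\<integral>\<^sup>+z\<in>S \<inter> ball x \<rho>. ennreal (\<bar>w z\<bar> powr p) \<partial>H) \<le> ennreal C0 * (\<integral>\<^sup>+z\<in>S. ennreal (G z powr p) \<partial>H)"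
      unfolding poincare_at_def by blast
    define v where "v = \<Phi> x - \<Phi> y"
    have v: "norm v \<le> R / 2" "v \<bullet> e = 0"
      using \<Phi>near[OF x] \<Phi>near[OF y] \<Phi>e[OF x] \<Phi>e[OF y] dist_triangle2[of "\<Phi> x" "\<Phi> y" "\<Phi> a"]
      by (auto simp: v_def inner_diff_left dist_norm norm_minus_commute)
    define s' where "s' = min (s - dist a y) (\<rho> / L\<^sup>2)"
    have s': "0 < s'" using y \<rho> rR by (simp add: s'_def)
    define X where "X = S \<inter> ball y s'"
    have XS: "X \<in> sets borel" "X \<subseteq> S" using borel_S by (auto simp: X_def)
    have Xs: "z \<in> S \<inter> ball a s" if "z \<in> X" for z
      using that dist_triangle[of a z y] by (auto simp: X_def s'_def)
    define \<phi> where "\<phi> t z = \<Psi> (\<Phi> z + t *\<^sub>R v)" for t z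
    have inball: "\<Phi> z + t *\<^sub>R v \<in> ball (\<Phi> a) R" if "z \<in> S \<inter> ball a s" "0 \<le> t" "t \<le> 1" for z t
    proof -
      have "dist (\<Phi> a) (\<Phi> z + t *\<^sub>R v) \<le> dist (\<Phi> a) (\<Phi> z) + norm (t *\<^sub>R v)"
        using norm_triangle_ineq4[of "\<Phi> a - \<Phi> z" "t *\<^sub>R v"] by (simp add: dist_norm algebra_simps)
      also have "\<dots> \<le> R / 4 + 1 * (R / 2)"
        unfolding norm_scaleR using \<Phi>near[OF that(1)] that v by (intro add_mono mult_mono) auto
      finally show ?thesis using rR by simp
    qed
    have in_S: "\<phi> t z \<in> S \<inter> U" if z: "z \<in> X" and t: "0 \<le> t" "t \<le> 1" for t z
    proof -
      have "\<Phi> z + t *\<^sub>R v \<in> \<Phi> ` U" using inball[OF Xs[OF z] t] rR(5) by blast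
      then have "\<Phi> z + t *\<^sub>R v \<in> \<Phi> ` (S \<inter> U)"
        unfolding flat using \<Phi>e[OF Xs[OF z]] v(2) by (simp add: inner_add_left)
      then show ?thesis using ld by (auto simp: \<phi>_def local_diffeo_def)
    qed
    note flow = chart_translation_flow[OF ld rR(3-5) lip\<Phi> lip\<Psi> \<Psi>b, of X 1 v, folded \<phi>_def]
    have Xb: "X \<subseteq> ball a r" using Xs Xr(1) by blast
    have exp: "dist z z' \<le> L\<^sup>2 * dist (\<phi> t z) (\<phi> t z')" if "z \<in> X" "z' \<in> X" "0 \<le> t" "t \<le> 1" for t z z'
      using Xb inball Xs that by (intro flow(3)) auto
    have to_x: "\<phi> 1 z \<in> S \<inter> ball x \<rho>" if z: "z \<in> X" for z
    proof -
      have "dist x (\<phi> 1 z) = dist (\<Psi> (\<Phi> y + 1 *\<^sub>R v)) (\<Psi> (\<Phi> z + 1 *\<^sub>R v))"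
        using Xr(3)[OF x] by (simp add: \<phi>_def v_def)
      also have "\<dots> \<le> L * dist (\<Phi> y + 1 *\<^sub>R v) (\<Phi> z + 1 *\<^sub>R v)"
        using inball[OF y, of 1] inball[OF Xs[OF z], of 1] by (intro lip\<Psi>) auto
      also have "\<dots> = L * dist (\<Phi> y) (\<Phi> z)" by (simp add: dist_norm)
      also have "\<dots> \<le> L * (L * dist y z)" using rR Xr(1)[OF y] Xr(1)[OF Xs[OF z]] by (intro mult_left_mono lip\<Phi>) auto
      also have "\<dots> < L * (L * (\<rho> / L\<^sup>2))"
        using z rR by (intro mult_strict_left_mono) (auto simp: X_def s'_def)
      also have "\<dots> = \<rho>" using rR by (simp add: power2_eq_square)
      finally show ?thesis using in_S[OF z, of 1] by simp
    qed
    define M where "M = L\<^sup>2 * max 1 (norm v)"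
    have M: "0 < M" "L\<^sup>2 \<le> M" "L * norm v \<le> M"
    proof -
      show "0 < M" using rR by (simp add: M_def)
      show "L\<^sup>2 \<le> M" using rR unfolding M_def by (simp add: mult_le_cancel_left1)
      have "L \<le> L\<^sup>2" using rR by (simp add: power2_eq_square)
      then show "L * norm v \<le> M" unfolding M_def using rR by (intro mult_mono) auto
    qed
    have cont: "continuous_on ({0..1} \<times> X) (\<lambda>(t, y). \<phi> t y)"
      using Xb inball Xs by (intro flow(1)) auto
    have \<phi>1: "\<phi> 1 \<in> borel_measurable (restrict_space borel X)"
    proof -
      have "continuous_on X (\<lambda>y. (\<lambda>(t, y). \<phi> t y) (1, y))"
        by (intro continuous_on_compose2[OF cont]) (auto intro!: continuous_intros)
      then show ?thesis by (intro borel_measurable_continuous_on_restrict) simp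
    qed
    define C1 where "C1 = 1 powr p * M powr p * M ^ d"
    define C where "C = 2 powr p * ((L\<^sup>2) ^ d * max 0 C0 + C1)"
    have "(\<integral>\<^sup>+z\<in>X. ennreal (\<bar>w z\<bar> powr p) \<partial>H) \<le> ennreal C * (\<integral>\<^sup>+z\<in>S. ennreal (G z powr p) \<partial>H)"
      if bz: "boundary_zero_pair S w G" for w G
    proof -
      let ?J = "\<integral>\<^sup>+z\<in>S. ennreal (G z powr p) \<partial>H"
      let ?B = "S \<inter> ball x \<rho>"
      have Bm: "(\<lambda>z. ennreal (\<bar>w z\<bar> powr p) * indicator ?B z) \<in> borel_measurable borel"
        using borel_S by (intro boundary_zero_pair_measurable[OF bz]) auto
      have wm: "(\<lambda>z. ennreal (\<bar>w (\<phi> 1 z)\<bar> powr p) * indicator X z) \<in> borel_measurable borel"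
      proof -
        have "(\<lambda>z. ennreal (\<bar>w (\<phi> 1 z)\<bar> powr p) * indicator ?B (\<phi> 1 z)) \<in> borel_measurable (restrict_space borel X)"
          using measurable_compose[OF \<phi>1 Bm] .
        then have "(\<lambda>z. ennreal (\<bar>w (\<phi> 1 z)\<bar> powr p) * indicator ?B (\<phi> 1 z) * indicator X z) \<in> borel_measurable borel"
          using XS by (subst (asm) borel_measurable_restrict_space_iff_ennreal) auto
        also have "(\<lambda>z. ennreal (\<bar>w (\<phi> 1 z)\<bar> powr p) * indicator ?B (\<phi> 1 z) * indicator X z)
            = (\<lambda>z. ennreal (\<bar>w (\<phi> 1 z)\<bar> powr p) * indicator X z)"
          using to_x by (auto simp: fun_eq_iff split: split_indicator)
        finally show ?thesis .
      qed
      have le1: "(\<integral>\<^sup>+z\<in>X. ennreal (\<bar>w (\<phi> 1 z)\<bar> powr p) \<partial>H) \<le> ennreal ((L\<^sup>2) ^ d * max 0 C0) * ?J"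
      proof -
        have "(\<integral>\<^sup>+z\<in>X. ennreal (\<bar>w (\<phi> 1 z)\<bar> powr p) \<partial>H)
           = (\<integral>\<^sup>+z\<in>X. ennreal (\<bar>w (\<phi> 1 z)\<bar> powr p) * indicator ?B (\<phi> 1 z) \<partial>H)"
          using to_x by (intro nn_integral_cong) (auto split: split_indicator)
        also have "\<dots> \<le> ennreal ((L\<^sup>2) ^ d) * (\<integral>\<^sup>+z\<in>?B. ennreal (\<bar>w z\<bar> powr p) * indicator ?B z \<partial>H)"
          using rR exp[where t = 1] to_x borel_S XS Bm \<phi>1
          by (intro nn_integral_expanding[OF d nonzero, where g = "\<lambda>z. ennreal (\<bar>w z\<bar> powr p) * indicator ?B z"]) auto
        also have "(\<integral>\<^sup>+z\<in>?B. ennreal (\<bar>w z\<bar> powr p) * indicator ?B z \<partial>H) = (\<integral>\<^sup>+z\<in>?B. ennreal (\<bar>w z\<bar> powr p) \<partial>H)"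
          by (intro nn_integral_cong) (auto split: split_indicator)
        also have "\<dots> \<le> ennreal C0 * ?J" by (rule C0[OF bz])
        also have "\<dots> \<le> ennreal (max 0 C0) * ?J" by (intro mult_right_mono ennreal_leI) auto
        finally show ?thesis by (simp add: mult_left_mono ennreal_mult mult.assoc)
      qed
      have le2: "(\<integral>\<^sup>+z\<in>X. ennreal (\<bar>w (\<phi> 1 z) - w z\<bar> powr p) \<partial>H) \<le> ennreal C1 * ?J"
        unfolding C1_def
      proof (rule transport_inequality[where \<tau> = "\<lambda>_. 1", OF d nonzero p M(1) _ borel_S finite_S XS _ _ cont])
        show "\<phi> t y \<in> S" if "y \<in> X" "0 \<le> t" "t \<le> 1" for t y using in_S[OF that] by blast
        show "\<phi> 0 y = y" if "y \<in> X" for y using Xr[OF Xs[OF that]] by (simp add: \<phi>_def)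
        show "M-lipschitz_on {0..1} (\<lambda>t. \<phi> t z)" if z: "z \<in> X" for z
        proof (rule lipschitz_on_le[OF _ M(3)])
          show "(L * norm v)-lipschitz_on {0..1} (\<lambda>t. \<phi> t z)" using Xb inball Xs z by (intro flow(2)) auto
        qed
        show "dist z z' \<le> M * dist (\<phi> t z) (\<phi> t z')" if z: "z \<in> X" "z' \<in> X" and t: "0 \<le> t" "t \<le> 1" for t z z'
          using exp[OF that] M(2) by (meson mult_right_mono order_trans zero_le_dist)
        show "upper_gradient S w G" "G \<in> borel_measurable borel" "0 \<le> G x" for x
          using bz by (auto simp: boundary_zero_pair_def)
      qed auto
      have pt: "ennreal (\<bar>w z\<bar> powr p) \<le> ennreal (2 powr p) * ennreal (\<bar>w (\<phi> 1 z)\<bar> powr p) + ennreal (2 powr p) * ennreal (\<bar>w (\<phi> 1 z) - w z\<bar> powr p)" for z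
      proof -
        define m where "m = max \<bar>w (\<phi> 1 z)\<bar> \<bar>w (\<phi> 1 z) - w z\<bar>"
        have "\<bar>w (\<phi> 1 z)\<bar> \<le> m" "\<bar>w (\<phi> 1 z) - w z\<bar> \<le> m" by (simp_all add: m_def)
        then have "\<bar>w z\<bar> \<le> 2 * m" by linarith
        then have "\<bar>w z\<bar> powr p \<le> (2 * m) powr p" using p by (intro powr_mono2) auto
        also have "\<dots> = 2 powr p * m powr p" by (simp add: powr_mult m_def)
        also have "m powr p \<le> \<bar>w (\<phi> 1 z)\<bar> powr p + \<bar>w (\<phi> 1 z) - w z\<bar> powr p" by (simp add: m_def max_def)
        finally show ?thesis
          by (simp add: ennreal_mult[symmetric] ennreal_plus[symmetric] distrib_left[symmetric] ennreal_leI del: ennreal_plus)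
      qed
      have "(\<integral>\<^sup>+z\<in>X. ennreal (\<bar>w z\<bar> powr p) \<partial>H) \<le>
        (\<integral>\<^sup>+z. ennreal (2 powr p) * (ennreal (\<bar>w (\<phi> 1 z)\<bar> powr p) * indicator X z) + ennreal (2 powr p) * (ennreal (\<bar>w (\<phi> 1 z) - w z\<bar> powr p) * indicator X z) \<partial>H)"
        using pt by (intro nn_integral_mono) (auto split: split_indicator)
      also have "\<dots> = ennreal (2 powr p) * (\<integral>\<^sup>+z\<in>X. ennreal (\<bar>w (\<phi> 1 z)\<bar> powr p) \<partial>H) + ennreal (2 powr p) * (\<integral>\<^sup>+z\<in>X. ennreal (\<bar>w (\<phi> 1 z) - w z\<bar> powr p) \<partial>H)"
      proof -
        have "(\<lambda>z. w (\<phi> 1 z)) \<in> borel_measurable (restrict_space borel X)"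
        proof -
          have "continuous_on X (\<lambda>y. (\<lambda>(t, y). \<phi> t y) (1, y))"
            by (intro continuous_on_compose2[OF cont]) (auto intro!: continuous_intros)
          then have "continuous_on X (\<lambda>z. w (\<phi> 1 z))"
            using bz to_x by (intro continuous_on_compose2[of S w _ "\<phi> 1"]) (auto simp: boundary_zero_pair_def)
          then show ?thesis by (rule borel_measurable_continuous_on_restrict)
        qed
        moreover have "w \<in> borel_measurable (restrict_space borel X)"
          using bz XS by (intro borel_measurable_continuous_on_restrict) (auto simp: boundary_zero_pair_def intro: continuous_on_subset)
        ultimately have "(\<lambda>z. ennreal (\<bar>w (\<phi> 1 z) - w z\<bar> powr p)) \<in> borel_measurable (restrict_space borel X)" 
          by (intro measurable_compose[OF _ measurable_ennreal] powr_real_measurable borel_measurable_abs borel_measurable_diff) auto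
        then have "(\<lambda>z. ennreal (\<bar>w (\<phi> 1 z) - w z\<bar> powr p) * indicator X z) \<in> borel_measurable borel"
          using XS by (subst (asm) borel_measurable_restrict_space_iff_ennreal) auto
        then show ?thesis
          using wm by (subst nn_integral_add) (auto simp: nn_integral_cmult)
      qed
      also have "\<dots> \<le> ennreal (2 powr p) * (ennreal ((L\<^sup>2) ^ d * max 0 C0) * ?J) + ennreal (2 powr p) * (ennreal C1 * ?J)"
        using le1 le2 by (intro add_mono mult_left_mono) auto
      also have "\<dots> = ennreal C * ?J"
      proof -
        have "0 \<le> C1" "0 \<le> (L\<^sup>2) ^ d * max 0 C0" using M by (auto simp: C1_def)
        then show ?thesis unfolding C_def
          by (simp add: ennreal_mult ennreal_plus distrib_left distrib_right mult.assoc)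
      qed
      finally show ?thesis .
    qed
    then show ?thesis
      unfolding poincare_at_def X_def using s' by blast
  qed
  with s(1) show ?thesis by blast
qed

text \<open>The set of points with a local inequality contains the boundary charts and is invariant within each interior
  chart, hence is all of the connected surface; compactness sums up the local inequalities.\<close>

theorem poincare_inequality:
  assumes conn: "connected S" and smooth: "smooth_hypersurface S" and bd: "surface_boundary S \<noteq> {}"
  obtains C where "0 < C" "\<And>w G. boundary_zero_pair S w G \<Longrightarrow>
     (\<integral>\<^sup>+z\<in>S. ennreal (\<bar>w z\<bar> powr p) \<partial>H) \<le> ennreal C * (\<integral>\<^sup>+z\<in>S. ennreal (G z powr p) \<partial>H)"
proof -
  obtain a where a: "a \<in> S" "boundary_chart_at S a" using bd by (auto simp: surface_boundary_def)
  have "poincare_at y" if y: "y \<in> S" for y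
  proof (rule connected_induction_simple[OF conn a(1) y])
    show "poincare_at a" using poincare_at_boundary_chart[OF a] a(1) by auto
    fix x assume x: "x \<in> S"
    have "\<exists>s>0. \<forall>z\<in>S \<inter> ball x s. \<forall>y\<in>S \<inter> ball x s. poincare_at z \<longrightarrow> poincare_at y"
      using smooth x poincare_at_boundary_chart[OF x] poincare_at_interior_chart[OF x] unfolding smooth_hypersurface_def by blast
    then obtain s where "0 < s" "\<forall>z\<in>S \<inter> ball x s. \<forall>y\<in>S \<inter> ball x s. poincare_at z \<longrightarrow> poincare_at y" by blast
    then show "\<exists>T. openin (top_of_set S) T \<and> x \<in> T \<and> (\<forall>x\<in>T. \<forall>y\<in>T. poincare_at x \<longrightarrow> poincare_at y)"
      using x by (intro exI[of _ "S \<inter> ball x s"]) auto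
  qed
  define Q where "Q y r C \<longleftrightarrow> 0 < r \<and> (\<forall>w G. boundary_zero_pair S w G \<longrightarrow>
      (\<integral>\<^sup>+z\<in>S \<inter> ball y r. ennreal (\<bar>w z\<bar> powr p) \<partial>H) \<le> ennreal C * (\<integral>\<^sup>+z\<in>S. ennreal (G z powr p) \<partial>H))" for y r C
  have "\<exists>r C. Q y r C" if "y \<in> S" for y
    using \<open>\<And>y. y \<in> S \<Longrightarrow> poincare_at y\<close>[OF that] unfolding poincare_at_def Q_def by blast
  then obtain r C0 where Q: "\<And>y. y \<in> S \<Longrightarrow> Q y (r y) (C0 y)" by metis
  then have r: "\<And>y. y \<in> S \<Longrightarrow> 0 < r y" by (simp add: Q_def)
  have C0: "(\<integral>\<^sup>+z\<in>S \<inter> ball y (r y). ennreal (\<bar>w z\<bar> powr p) \<partial>H) \<le> ennreal (C0 y) * (\<integral>\<^sup>+z\<in>S. ennreal (G z powr p) \<partial>H)"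
    if "y \<in> S" "boundary_zero_pair S w G" for y w G
    using Q[OF that(1)] that(2) by (simp add: Q_def)
  obtain D where D: "D \<subseteq> S" "finite D" "S \<subseteq> (\<Union>y\<in>D. ball y (r y))"
    by (rule compactE_image[OF compact_S, of S "\<lambda>y. ball y (r y)"]) (use r in auto)
  define C where "C = 1 + (\<Sum>y\<in>D. max 0 (C0 y))"
  show thesis
  proof (rule that)
    show "0 < C" unfolding C_def by (simp add: add_pos_nonneg sum_nonneg)
    fix w G assume bz: "boundary_zero_pair S w G"
    let ?J = "\<integral>\<^sup>+z\<in>S. ennreal (G z powr p) \<partial>H"
    have "(\<integral>\<^sup>+z\<in>S. ennreal (\<bar>w z\<bar> powr p) \<partial>H) \<le> (\<integral>\<^sup>+z. (\<Sum>y\<in>D. ennreal (\<bar>w z\<bar> powr p) * indicator (S \<inter> ball y (r y)) z) \<partial>H)"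
    proof (intro nn_integral_mono)
      fix z
      show "ennreal (\<bar>w z\<bar> powr p) * indicator S z \<le> (\<Sum>y\<in>D. ennreal (\<bar>w z\<bar> powr p) * indicator (S \<inter> ball y (r y)) z)"
      proof (cases "z \<in> S")
        case True
        then obtain y where y: "y \<in> D" "z \<in> ball y (r y)" using D by blast
        show ?thesis
          using member_le_sum[OF y(1), of "\<lambda>y. ennreal (\<bar>w z\<bar> powr p) * indicator (S \<inter> ball y (r y)) z"] D(2) y(2) True by simp
      qed simp
    qed
    also have "\<dots> = (\<Sum>y\<in>D. \<integral>\<^sup>+z\<in>S \<inter> ball y (r y). ennreal (\<bar>w z\<bar> powr p) \<partial>H)"
      using borel_S boundary_zero_pair_measurable[OF bz] by (intro nn_integral_sum) auto
    also have "\<dots> \<le> (\<Sum>y\<in>D. ennreal (max 0 (C0 y)) * ?J)"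
    proof (intro sum_mono)
      fix y assume "y \<in> D"
      then have "(\<integral>\<^sup>+z\<in>S \<inter> ball y (r y). ennreal (\<bar>w z\<bar> powr p) \<partial>H) \<le> ennreal (C0 y) * ?J" using C0 bz D by blast
      also have "\<dots> \<le> ennreal (max 0 (C0 y)) * ?J" by (intro mult_right_mono ennreal_leI) auto
      finally show "(\<integral>\<^sup>+z\<in>S \<inter> ball y (r y). ennreal (\<bar>w z\<bar> powr p) \<partial>H) \<le> ennreal (max 0 (C0 y)) * ?J" .
    qed
    also have "\<dots> = ennreal (\<Sum>y\<in>D. max 0 (C0 y)) * ?J"
      by (simp add: sum_ennreal[symmetric] sum_distrib_right del: sum_ennreal)
    also have "\<dots> \<le> ennreal C * ?J" unfolding C_def by (intro mult_right_mono ennreal_leI) auto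
    finally show "(\<integral>\<^sup>+z\<in>S. ennreal (\<bar>w z\<bar> powr p) \<partial>H) \<le> ennreal C * ?J" .
  qed
qed

end

section \<open>Regularity of the unit normal field\<close>

text \<open>The preimage under the chart of a short straight ray is a curve in \<open>S\<close> with initial velocity a
  multiple of \<open>v\<close>. Restricting to \<open>t \<ge> 0\<close> covers rays pointing into a half-space.\<close>

lemma local_diffeo_curve_tangent:
  fixes P :: "'a::euclidean_space"
  assumes ld: "local_diffeo x U \<Phi> \<Psi>" and P: "P \<in> S \<inter> U"
    and D: "(\<Phi> has_derivative D) (at P)"
    and ray: "\<And>t. 0 \<le> t \<Longrightarrow> \<Phi> P + t *\<^sub>R D v \<in> \<Phi> ` U \<Longrightarrow> \<Phi> P + t *\<^sub>R D v \<in> \<Phi> ` (S \<inter> U)"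
  shows "v \<in> tangent_space S P"
proof -
  have U: "open U" "open (\<Phi> ` U)" "Ck_on (Suc 0) (\<Phi> ` U) \<Psi>" and inv: "\<And>y. y \<in> U \<Longrightarrow> \<Psi> (\<Phi> y) = y"
    using ld unfolding local_diffeo_def smooth_on_def by blast+
  have PU: "\<Phi> P \<in> \<Phi> ` U" "P \<in> U" using P by auto
  then obtain E where E: "(\<Psi> has_derivative E) (at (\<Phi> P))"
    using U(3) frechet_derivative_works[of \<Psi> "at (\<Phi> P)"] by auto
  have "((\<lambda>y. \<Psi> (\<Phi> y)) has_derivative (\<lambda>u. E (D u))) (at P)"
    using has_derivative_compose[OF D E] .
  moreover have "((\<lambda>y. \<Psi> (\<Phi> y)) has_derivative (\<lambda>u. u)) (at P)"
    by (rule has_derivative_transform_within_open[OF has_derivative_ident U(1) PU(2)]) (simp add: inv)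
  ultimately have ED: "E (D v) = v" using has_derivative_unique by metis
  obtain \<rho> where \<rho>: "0 < \<rho>" "ball (\<Phi> P) \<rho> \<subseteq> \<Phi> ` U" using U(2) PU(1) open_contains_ball by blast
  define a where "a = norm (D v) + 1"
  have a: "0 < a" by (simp add: a_def add_nonneg_pos)
  define s where "s = \<rho> / (2 * a)"
  have s: "0 < s" using \<rho> a by (simp add: s_def)
  have sD: "s * norm (D v) < \<rho>"
  proof -
    have "s * norm (D v) \<le> s * a" using s by (intro mult_left_mono) (auto simp: a_def)
    also have "\<dots> = \<rho> / 2" using a by (simp add: s_def)
    finally show ?thesis using \<rho> by simp
  qed
  define \<gamma> where "\<gamma> t = \<Psi> (\<Phi> P + t *\<^sub>R (s *\<^sub>R D v))" for t :: real
  have "\<gamma> t \<in> S" if "t \<in> {0..1}" for t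
  proof -
    have "norm (t *\<^sub>R (s *\<^sub>R D v)) \<le> 1 * (s * norm (D v))"
      unfolding norm_scaleR using that s by (intro mult_mono) auto
    then have "\<Phi> P + (t * s) *\<^sub>R D v \<in> \<Phi> ` U" using sD \<rho>(2) by (auto simp: dist_norm)
    then have "\<Phi> P + (t * s) *\<^sub>R D v \<in> \<Phi> ` (S \<inter> U)" using ray[of "t * s"] that s by auto
    then show ?thesis using inv by (auto simp: \<gamma>_def)
  qed
  moreover have "\<gamma> 0 = P" using inv PU by (simp add: \<gamma>_def)
  moreover have "(\<gamma> has_vector_derivative (s *\<^sub>R v)) (at 0 within {0..1})"
  proof -
    have lin: "linear E" using E by (rule has_derivative_linear)
    have "((\<lambda>t. \<Phi> P + t *\<^sub>R (s *\<^sub>R D v)) has_derivative (\<lambda>t. t *\<^sub>R (s *\<^sub>R D v))) (at 0 within {0..1})"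
      by (auto intro!: derivative_eq_intros)
    moreover have "(\<Psi> has_derivative E) (at (\<Phi> P + 0 *\<^sub>R (s *\<^sub>R D v)))" using E by simp
    ultimately have "((\<lambda>t. \<Psi> (\<Phi> P + t *\<^sub>R (s *\<^sub>R D v))) has_derivative (\<lambda>t. E (t *\<^sub>R (s *\<^sub>R D v)))) (at 0 within {0..1})"
      by (rule has_derivative_compose)
    then show ?thesis
      by (simp add: \<gamma>_def[abs_def] has_vector_derivative_def linear_scale[OF lin] ED)
  qed
  ultimately have "s *\<^sub>R v \<in> tangent_space S P" unfolding tangent_space_def by (intro span_base) blast
  then have "(1 / s) *\<^sub>R (s *\<^sub>R v) \<in> tangent_space S P" unfolding tangent_space_def by (rule span_scale)
  then show ?thesis using s by simp
qed

text \<open>Interior and boundary charts in one form: a coordinate that vanishes on \<open>S\<close>, and whose derivative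
  has its kernel in the tangent space. At a boundary point a tangent vector may point outwards; then its
  negative points inwards and the tangent space is closed under negation.\<close>

lemma smooth_hypersurface_defining_function:
  fixes S :: "'a::euclidean_space set"
  assumes "smooth_hypersurface S" "x \<in> S"
  obtains U \<Phi> \<Psi> e where "local_diffeo x U \<Phi> \<Psi>" "e \<in> Basis" "\<And>y. y \<in> S \<inter> U \<Longrightarrow> \<Phi> y \<bullet> e = 0"
    "\<And>P D v. P \<in> S \<inter> U \<Longrightarrow> (\<Phi> has_derivative D) (at P) \<Longrightarrow> D v \<bullet> e = 0 \<Longrightarrow> v \<in> tangent_space S P"
proof -
  consider "interior_chart_at S x" | "boundary_chart_at S x"
    using assms unfolding smooth_hypersurface_def by blast
  then show thesis
  proof cases
    case 1
    then obtain U \<Phi> \<Psi> e where e: "e \<in> Basis" and ld: "local_diffeo x U \<Phi> \<Psi>"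
      and flat: "\<Phi> ` (S \<inter> U) = {y \<in> \<Phi> ` U. y \<bullet> e = 0}" unfolding interior_chart_at_def by blast
    have z: "\<Phi> y \<bullet> e = 0" if "y \<in> S \<inter> U" for y
    proof -
      have "\<Phi> y \<in> \<Phi> ` (S \<inter> U)" using that by blast
      then show ?thesis unfolding flat by simp
    qed
    show thesis
    proof (rule that[OF ld e z])
      fix P D v assume P: "P \<in> S \<inter> U" and D: "(\<Phi> has_derivative D) (at P)" "D v \<bullet> e = 0"
      show "v \<in> tangent_space S P"
        by (rule local_diffeo_curve_tangent[OF ld P D(1)]) (simp add: flat inner_add_left z[OF P] D(2))
    qed
  next
    case 2
    then obtain U \<Phi> \<Psi> e e' where e: "e \<in> Basis" and ld: "local_diffeo x U \<Phi> \<Psi>"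
      and flat: "\<Phi> ` (S \<inter> U) = {y \<in> \<Phi> ` U. y \<bullet> e = 0 \<and> y \<bullet> e' \<ge> 0}" unfolding boundary_chart_at_def by blast
    have z: "\<Phi> y \<bullet> e = 0" "0 \<le> \<Phi> y \<bullet> e'" if "y \<in> S \<inter> U" for y
    proof -
      have "\<Phi> y \<in> \<Phi> ` (S \<inter> U)" using that by blast
      then show "\<Phi> y \<bullet> e = 0" "0 \<le> \<Phi> y \<bullet> e'" unfolding flat by auto
    qed
    show thesis
    proof (rule that[OF ld e z(1)])
      fix P D v assume P: "P \<in> S \<inter> U" and D: "(\<Phi> has_derivative D) (at P)" "D v \<bullet> e = 0"
      have inward: "u \<in> tangent_space S P" if "D u \<bullet> e = 0" "0 \<le> D u \<bullet> e'" for u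
        by (rule local_diffeo_curve_tangent[OF ld P D(1)]) (simp add: flat inner_add_left z[OF P] that)
      show "v \<in> tangent_space S P"
      proof (cases "0 \<le> D v \<bullet> e'")
        case True then show ?thesis using inward D(2) by blast
      next
        case False
        have "D (- v) = - D v" using has_derivative_linear[OF D(1)] by (rule linear_neg)
        then have "- v \<in> tangent_space S P" using inward[of "- v"] D(2) False by simp
        then show ?thesis unfolding tangent_space_def using span_neg by fastforce
      qed
    qed
  qed
qed

lemma norm_diff_normalized:
  fixes a b :: "'a::real_normed_vector"
  assumes "a \<noteq> 0" "b \<noteq> 0"
  shows "norm (a /\<^sub>R norm a - b /\<^sub>R norm b) \<le> 2 * norm (a - b) / norm b"
proof -
  have "a /\<^sub>R norm a - b /\<^sub>R norm b = (a - b) /\<^sub>R norm b + (inverse (norm a) - inverse (norm b)) *\<^sub>R a"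
    by (simp add: algebra_simps)
  then have "norm (a /\<^sub>R norm a - b /\<^sub>R norm b) \<le> norm ((a - b) /\<^sub>R norm b) + norm ((inverse (norm a) - inverse (norm b)) *\<^sub>R a)"
    by (metis norm_triangle_ineq)
  also have "norm ((inverse (norm a) - inverse (norm b)) *\<^sub>R a) = \<bar>norm b - norm a\<bar> / norm b"
    using assms by (simp add: abs_mult[symmetric] field_simps abs_divide[symmetric])
  also have "\<dots> \<le> norm (a - b) / norm b"
    by (intro divide_right_mono) (auto simp: norm_triangle_ineq3 abs_minus_commute norm_minus_commute)
  also have "norm ((a - b) /\<^sub>R norm b) = norm (a - b) / norm b" by (simp add: divide_inverse mult.commute)
  finally show ?thesis by simp
qed

text \<open>Up to a sign \<open>\<nu>\<close> is the normalized gradient \<open>N\<close> of the defining coordinate,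
  which is Lipschitz and bounded away from zero near \<open>x\<close>; continuity of \<open>\<nu>\<close> keeps
  the sign constant. The second estimate is the Taylor formula for the coordinate, which vanishes at both
  points.\<close>

lemma unit_normal_locally_regular:
  fixes S :: "'a::euclidean_space set"
  assumes sm: "smooth_hypersurface S" and nu: "unit_normal_field S \<nu>" and x: "x \<in> S"
  shows "\<exists>r>0. \<exists>K. \<forall>P\<in>S \<inter> ball x r. \<forall>y\<in>S \<inter> ball x r.
    norm (\<nu> P - \<nu> y) \<le> K * norm (P - y) \<and> \<bar>\<nu> P \<bullet> (y - P)\<bar> \<le> K * (norm (y - P))\<^sup>2"
proof -
  obtain U \<Phi> \<Psi> e where ld: "local_diffeo x U \<Phi> \<Psi>" and e: "e \<in> Basis" and z: "\<And>y. y \<in> S \<inter> U \<Longrightarrow> \<Phi> y \<bullet> e = 0"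
    and tan: "\<And>P D v. P \<in> S \<inter> U \<Longrightarrow> (\<Phi> has_derivative D) (at P) \<Longrightarrow> D v \<bullet> e = 0 \<Longrightarrow> v \<in> tangent_space S P"
    using smooth_hypersurface_defining_function[OF sm x] by metis
  have U: "open U" "x \<in> U" "Ck_on (Suc (Suc 0)) U \<Phi>" "open (\<Phi> ` U)" "Ck_on (Suc 0) (\<Phi> ` U) \<Psi>"
    and inv: "\<And>y. y \<in> U \<Longrightarrow> \<Psi> (\<Phi> y) = y"
    using ld unfolding local_diffeo_def smooth_on_def by blast+
  define D where "D y = frechet_derivative \<Phi> (at y)" for y
  have der: "(\<Phi> has_derivative D y) (at y)" if "y \<in> U" for y
    using U(3) that frechet_derivative_works unfolding D_def by auto
  define N where "N y = (\<Sum>b\<in>Basis. (D y b \<bullet> e) *\<^sub>R b)" for y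
  have ND: "N y \<bullet> v = D y v \<bullet> e" if "y \<in> U" for y v
  proof -
    have lin: "linear (D y)" using der[OF that] by (rule has_derivative_linear)
    have "D y v = D y (\<Sum>b\<in>Basis. (v \<bullet> b) *\<^sub>R b)" by (simp add: euclidean_representation)
    also have "\<dots> = (\<Sum>b\<in>Basis. (v \<bullet> b) *\<^sub>R D y b)" by (simp add: linear_sum[OF lin] linear_scale[OF lin])
    finally show ?thesis by (simp add: N_def inner_sum_left inner_sum_right inner_commute mult.commute)
  qed
  have N0: "N y \<noteq> 0" if yU: "y \<in> U" for y
  proof -
    obtain E where E: "(\<Psi> has_derivative E) (at (\<Phi> y))"
      using U(5) yU frechet_derivative_works[of \<Psi> "at (\<Phi> y)"] by auto
    have "(\<Phi> has_derivative D y) (at (\<Psi> (\<Phi> y)))" using der[OF that] inv[OF that] by simp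
    from has_derivative_compose[OF E this]
    have "((\<lambda>q. \<Phi> (\<Psi> q)) has_derivative (\<lambda>u. D y (E u))) (at (\<Phi> y))" .
    moreover have "((\<lambda>q. \<Phi> (\<Psi> q)) has_derivative (\<lambda>u. u)) (at (\<Phi> y))"
      by (rule has_derivative_transform_within_open[OF has_derivative_ident U(4)]) (use that inv in auto)
    ultimately have "D y (E e) = e" using has_derivative_unique by metis
    then have "N y \<bullet> E e = 1" using ND[OF that, of "E e"] e by (simp add: inner_same_Basis)
    then show ?thesis by auto
  qed
  have \<nu>N: "\<nu> y = ((\<nu> y \<bullet> N y) / (N y \<bullet> N y)) *\<^sub>R N y" if y: "y \<in> S \<inter> U" for y
  proof -
    define v where "v = \<nu> y - ((\<nu> y \<bullet> N y) / (N y \<bullet> N y)) *\<^sub>R N y"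
    have "N y \<bullet> v = 0" using N0[of y] y by (simp add: v_def inner_diff_right inner_commute)
    moreover from this have "v \<in> tangent_space S y" using tan[OF y der] ND y by auto
    then have "v \<bullet> \<nu> y = 0" using nu y unfolding unit_normal_field_def by blast
    ultimately have "v \<bullet> v = 0" by (simp add: v_def inner_diff_right inner_commute)
    then show ?thesis by (simp add: v_def)
  qed
  have absN: "\<bar>\<nu> y \<bullet> N y\<bar> = norm (N y)" if y: "y \<in> S \<inter> U" for y
  proof -
    have "1 = norm (\<nu> y)" using nu y unfolding unit_normal_field_def by auto
    also have "\<dots> = \<bar>\<nu> y \<bullet> N y\<bar> / norm (N y)"
      by (subst \<nu>N[OF y]) (simp add: dot_square_norm power2_eq_square)
    finally show ?thesis using N0[of y] y by (simp add: field_simps)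
  qed
  have "\<exists>r L. 0 < r \<and> 0 < L \<and> cball x r \<subseteq> U \<and> (\<forall>y\<in>cball x r. \<forall>z\<in>cball x r. norm (D y b - D z b) \<le> L * norm (y - z))" for b
  proof -
    have "Ck_on (Suc 0) U (\<lambda>y. D y b)" using U(3) by (simp add: D_def)
    from Ck1_locally_lipschitz[OF U(1) this U(2)] show ?thesis by metis
  qed
  then obtain rb Lb where rb: "\<And>b. 0 < rb b" and Lb: "\<And>b. 0 < Lb b" and cb: "\<And>b. cball x (rb b) \<subseteq> U"
    and lipb: "\<And>b y z. y \<in> cball x (rb b) \<Longrightarrow> z \<in> cball x (rb b) \<Longrightarrow> norm (D y b - D z b) \<le> Lb b * norm (y - z)"
    by metis
  define r1 where "r1 = Min (rb ` Basis)"
  have r1: "0 < r1" "\<And>b. b \<in> Basis \<Longrightarrow> r1 \<le> rb b" unfolding r1_def using rb by (auto simp: Min_gr_iff)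
  have cU: "cball x r1 \<subseteq> U" using cb[of e] r1(2)[OF e] by auto
  define L where "L = (\<Sum>b\<in>Basis. Lb b)"
  have L0: "0 \<le> L" unfolding L_def using Lb by (intro sum_nonneg less_imp_le)
  have lipN: "norm (N y - N z) \<le> L * norm (y - z)" if "y \<in> cball x r1" "z \<in> cball x r1" for y z
  proof -
    have "N y - N z = (\<Sum>b\<in>Basis. ((D y b - D z b) \<bullet> e) *\<^sub>R b)"
      by (simp add: N_def sum_subtractf[symmetric] scaleR_left_diff_distrib[symmetric] inner_diff_left)
    also have "norm \<dots> \<le> (\<Sum>b\<in>Basis. norm (((D y b - D z b) \<bullet> e) *\<^sub>R (b::'a)))" by (rule norm_sum)
    also have "\<dots> \<le> (\<Sum>b\<in>Basis. Lb b * norm (y - z))"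
    proof (intro sum_mono)
      fix b :: 'a assume b: "b \<in> Basis"
      have "norm (((D y b - D z b) \<bullet> e) *\<^sub>R b) \<le> norm (D y b - D z b)" using b e by (simp add: Basis_le_norm)
      also have "\<dots> \<le> Lb b * norm (y - z)" using that r1(2)[OF b] by (intro lipb) auto
      finally show "norm (((D y b - D z b) \<bullet> e) *\<^sub>R b) \<le> Lb b * norm (y - z)" .
    qed
    finally show ?thesis by (simp add: L_def sum_distrib_right)
  qed
  have contN: "continuous_on (cball x r1) N"
    by (rule lipschitz_on_continuous_on[of L]) (use lipN L0 in \<open>auto intro!: lipschitz_onI simp: dist_norm\<close>)
  have "continuous_on (S \<inter> cball x r1) (\<lambda>y. \<nu> y \<bullet> N y)"
    using nu unfolding unit_normal_field_def
    by (intro continuous_intros continuous_on_subset[OF contN]) (auto intro: continuous_on_subset)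
  then obtain r2 where r2: "0 < r2" "\<And>y. y \<in> S \<inter> cball x r1 \<Longrightarrow> dist y x < r2 \<Longrightarrow> dist (\<nu> y \<bullet> N y) (\<nu> x \<bullet> N x) < norm (N x)"
    unfolding continuous_on_iff using x r1(1) N0[OF U(2)] by (metis IntI centre_in_cball less_imp_le zero_less_norm_iff)
  define m where "m = norm (N x) / 2"
  have m: "0 < m" using N0[OF U(2)] by (simp add: m_def)
  define r where "r = min r1 (min r2 (m / (L + 1)))"
  have r: "0 < r" using r1 r2 m L0 by (simp add: r_def)
  have near: "y \<in> cball x r1" "y \<in> S \<inter> U" "dist y x < r2" if "y \<in> S \<inter> ball x r" for y
    using that cU by (auto simp: r_def dist_commute subset_iff)
  have low: "m \<le> norm (N y)" if "y \<in> S \<inter> ball x r" for y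
  proof -
    have "norm (N x - N y) \<le> L * norm (x - y)" using near(1)[OF that] r1 by (intro lipN) auto
    also have "\<dots> \<le> (L + 1) * (m / (L + 1))" using that L0 by (intro mult_mono) (auto simp: r_def dist_norm)
    also have "\<dots> = m" using L0 by simp
    finally show ?thesis using norm_triangle_ineq2[of "N x" "N y"] by (simp add: m_def)
  qed
  define s where "s = sgn (\<nu> x \<bullet> N x)"
  have sgn1: "\<bar>s\<bar> = 1" using absN[of x] x U N0[OF U(2)] by (auto simp: s_def sgn_if)
  have \<nu>eq: "\<nu> y = s *\<^sub>R (N y /\<^sub>R norm (N y))" if y: "y \<in> S \<inter> ball x r" for y
  proof -
    have "\<bar>\<nu> y \<bullet> N y - \<nu> x \<bullet> N x\<bar> < \<bar>\<nu> x \<bullet> N x\<bar>"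
      using r2(2)[of y] near[OF y] absN[of x] x U by (auto simp: dist_real_def)
    then have "sgn (\<nu> y \<bullet> N y) = s" by (auto simp: s_def sgn_if split: if_splits)
    then have "\<nu> y \<bullet> N y = s * norm (N y)" using absN[OF near(2)[OF y]] by (metis abs_sgn mult.commute abs_mult_sgn)
    then show ?thesis using N0[of y] near(2)[OF y]
      by (subst \<nu>N[OF near(2)[OF y]]) (simp add: dot_square_norm power2_eq_square divide_inverse)
  qed
  show ?thesis
  proof (rule exI[of _ r], rule conjI[OF r], rule exI[of _ "2 * L / m"], intro ballI conjI)
    fix P y assume P: "P \<in> S \<inter> ball x r" and y: "y \<in> S \<inter> ball x r"
    have NP: "N P \<noteq> 0" "N y \<noteq> 0" using N0 near P y by blast+
    have "norm (\<nu> P - \<nu> y) = norm (N P /\<^sub>R norm (N P) - N y /\<^sub>R norm (N y))"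
      unfolding \<nu>eq[OF P] \<nu>eq[OF y] scaleR_right_diff_distrib[symmetric] using sgn1 by simp
    also have "\<dots> \<le> 2 * norm (N P - N y) / norm (N y)" by (rule norm_diff_normalized[OF NP])
    also have "\<dots> \<le> 2 * (L * norm (P - y)) / m"
      using near P y low m L0 by (intro frac_le mult_left_mono lipN) auto
    finally show "norm (\<nu> P - \<nu> y) \<le> 2 * L / m * norm (P - y)" by simp
    have "norm (\<Phi> y \<bullet> e - \<Phi> P \<bullet> e - N P \<bullet> (y - P)) \<le> norm (y - P) * (L * norm (y - P))"
    proof (rule differentiable_bound_linearization[where S = "closed_segment P y" and f = "\<lambda>u. \<Phi> u \<bullet> e" and f' = "\<lambda>u v. N u \<bullet> v"])
      show "P + t *\<^sub>R (y - P) \<in> closed_segment P y" if "t \<in> {0..1}" for t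
        unfolding closed_segment_def using that by (auto simp: algebra_simps intro!: exI[of _ t])
      have seg: "closed_segment P y \<subseteq> cball x r1"
        using near(1)[OF P] near(1)[OF y] by (simp add: closed_segment_subset)
      fix u assume u: "u \<in> closed_segment P y"
      have uU: "u \<in> U" using u seg cU by blast
      show "((\<lambda>u. \<Phi> u \<bullet> e) has_derivative (\<lambda>v. N u \<bullet> v)) (at u within closed_segment P y)"
      proof -
        have "((\<lambda>u. \<Phi> u \<bullet> e) has_derivative (\<lambda>v. D u v \<bullet> e)) (at u)"
          by (intro has_derivative_inner_left der uU)
        then show ?thesis using ND[OF uU] by (simp add: has_derivative_at_withinI)
      qed
      have "norm (N u - N P) \<le> L * norm (u - P)" using u seg near(1)[OF P] by (intro lipN) auto
      also have "\<dots> \<le> L * norm (y - P)"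
        using segment_bound(1)[OF u] L0 by (intro mult_left_mono) auto
      finally have NN: "norm (N u - N P) \<le> L * norm (y - P)" .
      show "onorm ((\<lambda>v. N u \<bullet> v) - (\<lambda>v. N P \<bullet> v)) \<le> L * norm (y - P)"
      proof (rule onorm_le)
        fix v
        have "norm (((\<lambda>v. N u \<bullet> v) - (\<lambda>v. N P \<bullet> v)) v) = \<bar>(N u - N P) \<bullet> v\<bar>" by (simp add: inner_diff_left)
        also have "\<dots> \<le> norm (N u - N P) * norm v" by (rule Cauchy_Schwarz_ineq2)
        also have "\<dots> \<le> L * norm (y - P) * norm v" by (intro mult_right_mono NN) auto
        finally show "norm (((\<lambda>v. N u \<bullet> v) - (\<lambda>v. N P \<bullet> v)) v) \<le> L * norm (y - P) * norm v" .
      qed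
    qed auto
    then have *: "\<bar>N P \<bullet> (y - P)\<bar> \<le> L * (norm (y - P))\<^sup>2"
      using z[OF near(2)[OF P]] z[OF near(2)[OF y]] by (simp add: power2_eq_square mult_ac)
    have "\<bar>\<nu> P \<bullet> (y - P)\<bar> = \<bar>N P \<bullet> (y - P)\<bar> / norm (N P)"
      unfolding \<nu>eq[OF P] using sgn1 by (simp add: abs_mult divide_inverse mult.commute)
    also have "\<dots> \<le> (L * (norm (y - P))\<^sup>2) / m" using * low[OF P] m by (intro frac_le) auto
    also have "\<dots> \<le> 2 * L / m * (norm (y - P))\<^sup>2" using L0 m by (simp add: divide_right_mono)
    finally show "\<bar>\<nu> P \<bullet> (y - P)\<bar> \<le> 2 * L / m * (norm (y - P))\<^sup>2" .
  qed
qed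

text \<open>Lebesgue number argument. Points closer than half of the radii in a finite cover lie in a common
  neighbourhood.\<close>

lemma unit_normal_regular:
  fixes S :: "'a::euclidean_space set"
  assumes "compact S" and sm: "smooth_hypersurface S" and nu: "unit_normal_field S \<nu>"
  obtains \<rho> K where "0 < \<rho>" "0 < K" "\<And>P y. P \<in> S \<Longrightarrow> y \<in> S \<Longrightarrow> norm (P - y) < \<rho> \<Longrightarrow>
    norm (\<nu> P - \<nu> y) \<le> K * norm (P - y) \<and> \<bar>\<nu> P \<bullet> (y - P)\<bar> \<le> K * (norm (y - P))\<^sup>2"
proof -
  define Q where "Q x r K \<longleftrightarrow> (\<forall>P\<in>S \<inter> ball x r. \<forall>y\<in>S \<inter> ball x r.
    norm (\<nu> P - \<nu> y) \<le> K * norm (P - y) \<and> \<bar>\<nu> P \<bullet> (y - P)\<bar> \<le> K * (norm (y - P))\<^sup>2)" for x r K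
  have "\<exists>r K. 0 < r \<and> Q x r K" if "x \<in> S" for x
    using unit_normal_locally_regular[OF sm nu that] unfolding Q_def by blast
  then obtain r K0 where r: "\<And>x. x \<in> S \<Longrightarrow> 0 < r x" and Q: "\<And>x. x \<in> S \<Longrightarrow> Q x (r x) (K0 x)" by metis
  obtain D where D: "D \<subseteq> S" "finite D" "S \<subseteq> (\<Union>x\<in>D. ball x (r x / 2))"
    by (rule compactE_image[OF \<open>compact S\<close>, of S "\<lambda>x. ball x (r x / 2)"]) (use r in auto)
  define \<rho> where "\<rho> = Min (insert 1 ((\<lambda>x. r x / 2) ` D))"
  define K where "K = 1 + (\<Sum>x\<in>D. \<bar>K0 x\<bar>)"
  have \<rho>0: "0 < \<rho>" unfolding \<rho>_def using D r by (auto simp: Min_gr_iff subset_iff)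
  have \<rho>: "\<rho> \<le> r x / 2" if "x \<in> D" for x
    unfolding \<rho>_def using D(2) that by (intro Min_le) auto
  show thesis
  proof (rule that[OF \<rho>0])
    show "0 < K" unfolding K_def by (simp add: add_pos_nonneg sum_nonneg)
    fix P y assume P: "P \<in> S" and y: "y \<in> S" and n: "norm (P - y) < \<rho>"
    obtain x where x: "x \<in> D" "P \<in> ball x (r x / 2)" using D(3) P by blast
    have "dist x y \<le> dist x P + dist P y" by (rule dist_triangle)
    also have "\<dots> < r x / 2 + r x / 2" using x(2) n \<rho>[OF x(1)] by (intro add_strict_mono) (auto simp: dist_norm)
    finally have yb: "y \<in> S \<inter> ball x (r x)" using y by simp
    have Pb: "P \<in> S \<inter> ball x (r x)" using x(2) P zero_le_dist[of x P] by (simp del: zero_le_dist)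
    have "K0 x \<le> K" unfolding K_def using member_le_sum[OF x(1), of "\<lambda>x. \<bar>K0 x\<bar>"] D(2) by simp
    then have "K0 x * norm (P - y) \<le> K * norm (P - y)" "K0 x * (norm (y - P))\<^sup>2 \<le> K * (norm (y - P))\<^sup>2"
      by (auto intro!: mult_right_mono)
    moreover have "norm (\<nu> P - \<nu> y) \<le> K0 x * norm (P - y) \<and> \<bar>\<nu> P \<bullet> (y - P)\<bar> \<le> K0 x * (norm (y - P))\<^sup>2"
      using Q[of x] x(1) D(1) Pb yb unfolding Q_def by blast
    ultimately show "norm (\<nu> P - \<nu> y) \<le> K * norm (P - y) \<and> \<bar>\<nu> P \<bullet> (y - P)\<bar> \<le> K * (norm (y - P))\<^sup>2"
      by linarith
  qed
qed

section \<open>The foot point map on a fine polyhedral surface\<close>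

lemma foot_pointE:
  assumes sd: "signed_distance S \<nu> \<epsilon> \<delta>" and lw: "lift_well_defined S \<nu> \<epsilon> \<delta> \<T>" and x: "x \<in> \<Union>\<T>"
  shows "foot_point S \<nu> \<delta> x \<in> S" "x = foot_point S \<nu> \<delta> x + \<delta> x *\<^sub>R \<nu> (foot_point S \<nu> \<delta> x)" "\<bar>\<delta> x\<bar> < \<epsilon>"
proof -
  have ex: "\<exists>!P. P \<in> S \<and> x = P + \<delta> x *\<^sub>R \<nu> P" using lw x unfolding lift_well_defined_def by blast
  from theI'[OF ex] show "foot_point S \<nu> \<delta> x \<in> S" "x = foot_point S \<nu> \<delta> x + \<delta> x *\<^sub>R \<nu> (foot_point S \<nu> \<delta> x)"
    unfolding foot_point_def by blast+
  have "x \<in> normal_tube S \<nu> \<epsilon>" using lw x unfolding lift_well_defined_def by blast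
  then obtain P s where "P \<in> S" "\<bar>s\<bar> < \<epsilon>" "x = P + s *\<^sub>R \<nu> P" unfolding normal_tube_def by blast
  then show "\<bar>\<delta> x\<bar> < \<epsilon>" using sd unfolding signed_distance_def by metis
qed

text \<open>The derivative of \<open>\<delta>\<close> along the segment is \<open>\<nu> \<bullet> (y - x)\<close>.
  Bounding it only in the direction of the segment matters: the full gradient of \<open>\<delta>\<close> has
  norm 1, but its component along an almost tangent simplex is small.\<close>

lemma signed_distance_segment:
  assumes sd: "signed_distance S \<nu> \<epsilon> \<delta>" and lw: "lift_well_defined S \<nu> \<epsilon> \<delta> \<T>"
    and T: "T \<in> \<T>" "convex T" and xy: "x \<in> T" "y \<in> T"
    and bound: "\<And>z. z \<in> T \<Longrightarrow> \<bar>\<nu> (foot_point S \<nu> \<delta> z) \<bullet> (y - x)\<bar> \<le> b"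
  shows "\<bar>\<delta> y - \<delta> x\<bar> \<le> b"
proof -
  have seg: "x + t *\<^sub>R (y - x) \<in> T" if "t \<in> {0..1}" for t
    using convexD_alt[OF T(2) xy, of t] that by (simp add: algebra_simps)
  have Tt: "T \<subseteq> normal_tube S \<nu> \<epsilon>" using lw T unfolding lift_well_defined_def by blast
  have der: "((\<lambda>t. \<delta> (x + t *\<^sub>R (y - x))) has_derivative (\<lambda>s. \<nu> (foot_point S \<nu> \<delta> (x + t *\<^sub>R (y - x))) \<bullet> (s *\<^sub>R (y - x)))) (at t within {0..1})"
    if t: "t \<in> {0..1}" for t
  proof -
    let ?z = "x + t *\<^sub>R (y - x)"
    have z: "?z \<in> \<Union>\<T>" using seg[OF t] T by blast
    let ?P = "foot_point S \<nu> \<delta> ?z"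
    note fp = foot_pointE[OF sd lw z]
    have "(\<delta> has_derivative (\<lambda>v. \<nu> ?P \<bullet> v)) (at (?P + \<delta> ?z *\<^sub>R \<nu> ?P) within normal_tube S \<nu> \<epsilon>)"
      using sd fp(1,3) unfolding signed_distance_def by blast
    then have "(\<delta> has_derivative (\<lambda>v. \<nu> ?P \<bullet> v)) (at ?z within normal_tube S \<nu> \<epsilon>)"
      unfolding fp(2)[symmetric] .
    then have "(\<delta> has_derivative (\<lambda>v. \<nu> ?P \<bullet> v)) (at ?z within (\<lambda>t. x + t *\<^sub>R (y - x)) ` {0..1})"
      by (rule has_derivative_subset) (use seg Tt in blast)
    moreover have "((\<lambda>t. x + t *\<^sub>R (y - x)) has_derivative (\<lambda>s. s *\<^sub>R (y - x))) (at t within {0..1})"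
      by (auto intro!: derivative_eq_intros)
    ultimately show ?thesis using has_derivative_in_compose by blast
  qed
  have "norm (\<delta> (x + 1 *\<^sub>R (y - x)) - \<delta> (x + 0 *\<^sub>R (y - x))) \<le> b * norm (1 - 0 :: real)"
  proof (rule differentiable_bound[OF _ der])
    show "onorm (\<lambda>s. \<nu> (foot_point S \<nu> \<delta> (x + t *\<^sub>R (y - x))) \<bullet> (s *\<^sub>R (y - x))) \<le> b" if "t \<in> {0..1}" for t
    proof (rule onorm_le)
      fix s :: real
      show "norm (\<nu> (foot_point S \<nu> \<delta> (x + t *\<^sub>R (y - x))) \<bullet> (s *\<^sub>R (y - x))) \<le> b * norm s"
        using mult_left_mono[OF bound[OF seg[OF that]], of "\<bar>s\<bar>"] by (simp add: abs_mult mult.commute)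
    qed
  qed auto
  then show ?thesis by simp
qed

text \<open>Write
  \<open>x - y = (P x - P y) + \<delta> x (\<nu>(P x) - \<nu>(P y)) + (\<delta> x - \<delta> y) \<nu>(P y)\<close>.
  The second term is at most \<open>\<bar>P x - P y\<bar>/4\<close> because
  \<open>\<bar>\<delta>\<bar> \<le> h\<close> and \<open>\<nu>\<close> is Lipschitz; the third is at most
  \<open>\<bar>x - y\<bar>/4\<close> because \<open>T\<close> is almost orthogonal to \<open>\<nu>\<close>. For
  the latter, all of \<open>T\<close> lies within \<open>4 K h\<^sup>2\<close> of the tangent plane at
  \<open>P x\<close>, as its vertices do, and \<open>T\<close> contains segments of length at least
  \<open>c h/2\<close> in all its directions.\<close>

lemma foot_point_bilipschitz:
  fixes S :: "'a::euclidean_space set"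
  assumes comp: "compact S" and sm: "smooth_hypersurface S" and nu: "unit_normal_field S \<nu>"
    and sd: "signed_distance S \<nu> \<epsilon> \<delta>" and c: "0 < c"
  obtains h1 where "0 < h1" "\<And>d h \<T> B n nb T x y. admissible_triangulation d S c h \<T> B n nb \<Longrightarrow> 0 < h \<Longrightarrow> h < h1 \<Longrightarrow>
     lift_well_defined S \<nu> \<epsilon> \<delta> \<T> \<Longrightarrow> T \<in> \<T> \<Longrightarrow> x \<in> T \<Longrightarrow> y \<in> T \<Longrightarrow>
     dist x y \<le> 2 * dist (foot_point S \<nu> \<delta> x) (foot_point S \<nu> \<delta> y) \<and>
     dist (foot_point S \<nu> \<delta> x) (foot_point S \<nu> \<delta> y) \<le> 2 * dist x y"
proof -
  obtain \<rho> K where \<rho>: "0 < \<rho>" and K: "0 < K" and reg: "\<And>P y. P \<in> S \<Longrightarrow> y \<in> S \<Longrightarrow> norm (P - y) < \<rho> \<Longrightarrow>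
    norm (\<nu> P - \<nu> y) \<le> K * norm (P - y) \<and> \<bar>\<nu> P \<bullet> (y - P)\<bar> \<le> K * (norm (y - P))\<^sup>2"
    using unit_normal_regular[OF comp sm nu] by blast
  \<comment> \<open>the three bounds serve the reach of the estimates for \<open>\<nu>\<close>, the second and the third term of the decomposition\<close>
  define h1 where "h1 = min (\<rho> / 4) (min (1 / (4 * K)) (c / (64 * K)))"
  have h1: "0 < h1" using \<rho> K c by (simp add: h1_def)
  show thesis
  proof (rule that[OF h1])
    fix d h \<T> B n nb T x y
    assume ad: "admissible_triangulation d S c h \<T> B n nb" and h: "0 < h" "h < h1"
      and lw: "lift_well_defined S \<nu> \<epsilon> \<delta> \<T>" and T: "T \<in> \<T>" and xy: "x \<in> T" "y \<in> T"
    have hb: "4 * h < \<rho>" "h * K \<le> 1 / 4" "64 * K * h \<le> c"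
      using h(2) K by (auto simp: h1_def field_simps)
    have fin: "finite \<T>" and simp: "int d simplex T" using ad T unfolding admissible_triangulation_def triangulation_def by blast+
    have cT: "compact T" "convex T" using simp by (auto simp: compact_simplex convex_simplex)
    define P where "P = foot_point S \<nu> \<delta>"
    have fp: "P z \<in> S" "z = P z + \<delta> z *\<^sub>R \<nu> (P z)" if "z \<in> T" for z
      using foot_pointE[OF sd lw, of z] that T unfolding P_def by blast+
    have nu1: "norm (\<nu> p) = 1" if "p \<in> S" for p using nu that unfolding unit_normal_field_def by blast
    have diam: "dist z z' \<le> h" if "z \<in> T" "z' \<in> T" for z z'
    proof -
      have "dist z z' \<le> diameter T" using that cT by (intro diameter_bounded_bound compact_imp_bounded)
      also have "\<dots> \<le> h" using ad T fin unfolding admissible_triangulation_def by auto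
      finally show ?thesis .
    qed
    define V where "V = {v. v extreme_point_of T}"
    have TV: "T = convex hull V" unfolding V_def using Krein_Milman_Minkowski[OF cT] .
    have VS: "v \<in> S" "v \<in> T" if "v \<in> V" for v
    proof -
      have "v \<in> B ` {1..nb}" using ad T that unfolding admissible_triangulation_def V_def by blast
      then show "v \<in> S" using ad unfolding admissible_triangulation_def by blast
      show "v \<in> T" using that by (simp add: V_def extreme_point_of_def)
    qed
    obtain v0 where v0: "v0 \<in> V" using TV xy(1) by fastforce
    have \<delta>0: "\<delta> v = 0" if "v \<in> V" for v using VS(1)[OF that] sd unfolding signed_distance_def by blast
    have \<delta>h: "\<bar>\<delta> z\<bar> \<le> h" if z: "z \<in> T" for z
    proof -
      have "\<bar>\<delta> z - \<delta> v0\<bar> \<le> h"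
      proof (rule signed_distance_segment[OF sd lw T cT(2) VS(2)[OF v0] z])
        fix z' assume z': "z' \<in> T"
        have "\<bar>\<nu> (P z') \<bullet> (z - v0)\<bar> \<le> norm (\<nu> (P z')) * norm (z - v0)" by (rule Cauchy_Schwarz_ineq2)
        also have "\<dots> \<le> h" using nu1[OF fp(1)[OF z']] diam[OF z VS(2)[OF v0]] by (simp add: dist_norm)
        finally show "\<bar>\<nu> (foot_point S \<nu> \<delta> z') \<bullet> (z - v0)\<bar> \<le> h" by (simp add: P_def)
      qed
      then show ?thesis using \<delta>0[OF v0] by simp
    qed
    have Pz: "norm (P z - z) \<le> h" if z: "z \<in> T" for z
    proof -
      have "P z - z = - (\<delta> z *\<^sub>R \<nu> (P z))" using fp(2)[OF z] by (metis add_diff_cancel_left' minus_diff_eq)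
      then show ?thesis using nu1[OF fp(1)[OF z]] \<delta>h[OF z] by simp
    qed
    \<comment> \<open>a slab around the tangent plane is convex, so it suffices that it contains the vertices\<close>
    have plane: "\<bar>\<nu> (P z) \<bullet> (q - P z)\<bar> \<le> 4 * K * h\<^sup>2" if z: "z \<in> T" and q: "q \<in> T" for z q
    proof -
      let ?A = "{q. \<nu> (P z) \<bullet> q \<le> \<nu> (P z) \<bullet> P z + 4 * K * h\<^sup>2} \<inter> {q. \<nu> (P z) \<bullet> q \<ge> \<nu> (P z) \<bullet> P z - 4 * K * h\<^sup>2}"
      have "V \<subseteq> ?A"
      proof
        fix v assume v: "v \<in> V"
        have "norm (v - P z) \<le> norm (v - z) + norm (P z - z)"
          using norm_triangle_ineq4[of "v - z" "P z - z"] by simp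
        also have "\<dots> \<le> 2 * h" using diam[OF VS(2)[OF v] z] Pz[OF z] by (simp add: dist_norm)
        finally have n: "norm (v - P z) \<le> 2 * h" .
        then have "\<bar>\<nu> (P z) \<bullet> (v - P z)\<bar> \<le> K * (norm (v - P z))\<^sup>2"
          using reg[OF fp(1)[OF z] VS(1)[OF v]] hb h by (simp add: norm_minus_commute)
        also have "\<dots> \<le> K * (2 * h)\<^sup>2" using n K by (intro mult_left_mono power_mono) auto
        finally show "v \<in> ?A" by (simp add: inner_diff_right abs_le_iff power_mult_distrib)
      qed
      then have "convex hull V \<subseteq> ?A"
        by (intro hull_minimal convex_Int convex_halfspace_le convex_halfspace_ge)
      then have "q \<in> ?A" using q TV by blast
      then show ?thesis by (simp add: inner_diff_right abs_le_iff)
    qed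
    have "c * h \<le> inradius T" using ad T unfolding admissible_triangulation_def by blast
    then have "c * h / 2 < inradius T" using c h(1) by (smt (verit) field_sum_of_halves mult_pos_pos)
    moreover have "{r. 0 \<le> r \<and> (\<exists>x\<in>T. cball x r \<inter> affine hull T \<subseteq> T)} \<noteq> {}"
    proof -
      have "0 \<in> {r. 0 \<le> r \<and> (\<exists>x\<in>T. cball x r \<inter> affine hull T \<subseteq> T)}" using xy(1) by auto
      then show ?thesis by blast
    qed
    ultimately have "\<exists>r\<in>{r. 0 \<le> r \<and> (\<exists>x\<in>T. cball x r \<inter> affine hull T \<subseteq> T)}. c * h / 2 < r"
      unfolding inradius_def by (metis (no_types, lifting) less_cSupD)
    then obtain r z0 where r: "c * h / 2 < r" and z0: "z0 \<in> T" "cball z0 r \<inter> affine hull T \<subseteq> T"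
      by blast
    have r0: "0 < r" using r c h(1) by (smt (verit) field_sum_of_halves mult_pos_pos)
    have tang: "\<bar>\<nu> (P z) \<bullet> (q' - q)\<bar> \<le> norm (q' - q) / 4" if z: "z \<in> T" and q: "q \<in> T" "q' \<in> T" for z q q'
    proof (cases "q = q'")
      case False
      define t where "t = r / norm (q' - q)"
      have t: "0 < t" using r0 False by (simp add: t_def)
      have "z0 + t *\<^sub>R (q' - q) \<in> affine hull T"
        using mem_affine_3_minus[of "affine hull T" z0 q' q t] z0 q by (auto simp: affine_affine_hull hull_inc)
      moreover have "z0 + t *\<^sub>R (q' - q) \<in> cball z0 r" using r0 False by (simp add: dist_norm t_def)
      ultimately have in_T: "z0 + t *\<^sub>R (q' - q) \<in> T" using z0(2) by blast
      have "\<bar>\<nu> (P z) \<bullet> (t *\<^sub>R (q' - q))\<bar> \<le> 8 * K * h\<^sup>2"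
        using plane[OF z in_T] plane[OF z z0(1)] by (simp add: inner_diff_right inner_add_right abs_le_iff)
      then have "t * \<bar>\<nu> (P z) \<bullet> (q' - q)\<bar> \<le> 8 * K * h\<^sup>2" using t by (simp add: abs_mult)
      also have "\<dots> \<le> c * h / 8" using mult_right_mono[OF hb(3), of h] h(1) by (simp add: power2_eq_square)
      also have "\<dots> \<le> r / 4" using r by simp
      also have "\<dots> = t * (norm (q' - q) / 4)" using False by (simp add: t_def)
      finally show ?thesis using t by simp
    qed simp
    have \<delta>d: "\<bar>\<delta> y - \<delta> x\<bar> \<le> norm (y - x) / 4"
      by (rule signed_distance_segment[OF sd lw T cT(2) xy]) (use tang[OF _ xy] in \<open>simp add: P_def\<close>)
    have near: "norm (P x - P y) < \<rho>"
    proof -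
      have "norm (P x - P y) \<le> norm (P x - x) + norm (x - y) + norm (P y - y)"
        by (smt (verit) norm_triangle_ineq norm_triangle_ineq4 diff_add_cancel add_diff_eq diff_diff_eq2)
      then show ?thesis using Pz[OF xy(1)] Pz[OF xy(2)] diam[OF xy] hb h by (simp add: dist_norm)
    qed
    have \<nu>d: "norm (\<delta> x *\<^sub>R (\<nu> (P x) - \<nu> (P y))) \<le> norm (P x - P y) / 4"
    proof -
      have "norm (\<delta> x *\<^sub>R (\<nu> (P x) - \<nu> (P y))) \<le> h * (K * norm (P x - P y))"
        unfolding norm_scaleR real_norm_def
        using \<delta>h[OF xy(1)] reg[OF fp(1)[OF xy(1)] fp(1)[OF xy(2)] near] h by (intro mult_mono) auto
      also have "\<dots> \<le> norm (P x - P y) / 4" using mult_right_mono[OF hb(2), of "norm (P x - P y)"] by simp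
      finally show ?thesis .
    qed
    have \<delta>n: "norm ((\<delta> x - \<delta> y) *\<^sub>R \<nu> (P y)) \<le> norm (x - y) / 4"
      using \<delta>d nu1[OF fp(1)[OF xy(2)]] by (simp add: abs_minus_commute norm_minus_commute)
    have eq: "x - y = (P x - P y) + \<delta> x *\<^sub>R (\<nu> (P x) - \<nu> (P y)) + (\<delta> x - \<delta> y) *\<^sub>R \<nu> (P y)"
      by (subst fp(2)[OF xy(1)], subst fp(2)[OF xy(2)]) (simp add: algebra_simps)
    have "norm (x - y) \<le> norm (P x - P y) + norm (\<delta> x *\<^sub>R (\<nu> (P x) - \<nu> (P y))) + norm ((\<delta> x - \<delta> y) *\<^sub>R \<nu> (P y))"
      by (subst eq) (meson norm_triangle_ineq norm_add_rule_thm order_trans norm_triangle_mono order_refl)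
    then have 1: "norm (x - y) \<le> 2 * norm (P x - P y)" using \<nu>d \<delta>n norm_ge_zero[of "P x - P y"] by linarith
    have eq2: "P x - P y = (x - y) - (\<delta> x *\<^sub>R (\<nu> (P x) - \<nu> (P y)) + (\<delta> x - \<delta> y) *\<^sub>R \<nu> (P y))"
      using eq by (simp add: algebra_simps)
    have "norm (P x - P y) \<le> norm (x - y) + (norm (\<delta> x *\<^sub>R (\<nu> (P x) - \<nu> (P y))) + norm ((\<delta> x - \<delta> y) *\<^sub>R \<nu> (P y)))"
      by (subst eq2) (meson norm_triangle_ineq norm_triangle_ineq4 order_trans add_left_mono)
    then have 2: "norm (P x - P y) \<le> 2 * norm (x - y)" using \<nu>d \<delta>n norm_ge_zero[of "x - y"] by linarith
    show "dist x y \<le> 2 * dist (foot_point S \<nu> \<delta> x) (foot_point S \<nu> \<delta> y) \<and>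
     dist (foot_point S \<nu> \<delta> x) (foot_point S \<nu> \<delta> y) \<le> 2 * dist x y"
      using 1 2 by (simp add: dist_norm P_def)
  qed
qed

section \<open>Piecewise linear functions on a simplicial mesh\<close>

text \<open>Translate one point to the origin and extend a linear functional from the linearly independent differences.\<close>

lemma affine_independent_interpolation:
  fixes V :: "'a::euclidean_space set" and val :: "'a \<Rightarrow> real"
  assumes ind: "\<not> affine_dependent V"
  shows "\<exists>a c. \<forall>v\<in>V. a \<bullet> v + c = val v"
proof (cases "V = {}")
  case False
  then obtain v0 where v0: "v0 \<in> V" by blast
  have "independent ((\<lambda>x. - v0 + x) ` (V - {v0}))"
    using ind affine_dependent_iff_dependent2[OF v0] by simp
  from linear_independent_extend[OF this, of "\<lambda>w. val (v0 + w) - val v0"]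
  obtain g :: "'a \<Rightarrow> real" where g: "linear g" "\<And>v. v \<in> V - {v0} \<Longrightarrow> g (- v0 + v) = val v - val v0"
    by force
  have adj: "adjoint g 1 \<bullet> x = g x" for x
    using adjoint_works[OF g(1), of x 1] by (simp add: inner_commute)
  have "adjoint g 1 \<bullet> v + (val v0 - g v0) = val v" if "v \<in> V" for v
  proof (cases "v = v0")
    case False
    then have "g (- v0 + v) = val v - val v0" using g(2) that by blast
    moreover have "g (- v0 + v) = g v - g v0" using linear_diff[OF g(1), of v v0] by (simp add: add.commute)
    ultimately show ?thesis by (simp add: adj)
  qed (simp add: adj)
  then show ?thesis by blast
qed auto

lemma affine_ge_on_hull:
  fixes a :: "'a::euclidean_space"
  assumes "\<And>v. v \<in> V \<Longrightarrow> m \<le> a \<bullet> v + c" "x \<in> convex hull V"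
  shows "m \<le> a \<bullet> x + c"
proof -
  have "convex hull V \<subseteq> {x. a \<bullet> x \<ge> m - c}"
    using assms(1) by (intro hull_minimal convex_halfspace_ge) (auto simp: algebra_simps)
  with assms(2) show ?thesis by auto
qed

lemma affine_eq_on_hull:
  fixes a a' :: "'a::euclidean_space"
  assumes "\<And>v. v \<in> V \<Longrightarrow> a \<bullet> v + c = a' \<bullet> v + c'" "x \<in> convex hull V"
  shows "a \<bullet> x + c = a' \<bullet> x + c'"
proof -
  have e: "(a - a') \<bullet> v + (c - c') = 0" if "v \<in> V" for v
    using assms(1)[OF that] by (simp add: inner_diff_left)
  have "0 \<le> (a - a') \<bullet> x + (c - c')" by (rule affine_ge_on_hull[OF _ assms(2)]) (simp add: e)
  moreover have "0 \<le> (a' - a) \<bullet> x + (c' - c)"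
    by (rule affine_ge_on_hull[OF _ assms(2)]) (use e in \<open>force simp: inner_diff_left\<close>)
  ultimately show ?thesis by (simp add: inner_diff_left)
qed

text \<open>The combinatorial part of an admissible triangulation, independent of the mesh size and of the smooth surface.\<close>

locale simplicial_mesh =
  fixes d :: nat and \<T> :: "'a::euclidean_space set set" and B :: "nat \<Rightarrow> 'a" and n nb :: nat
  assumes dim: "DIM('a) = d + 1" and d1: "1 \<le> d"
    and tri: "triangulation \<T>" and simp: "\<And>T. T \<in> \<T> \<Longrightarrow> int d simplex T"
    and inj: "inj_on B {1..nb}" and verts: "B ` {1..nb} = {x. \<exists>T\<in>\<T>. x extreme_point_of T}"
    and n_nb: "n < nb"
    and interior: "\<And>i. i \<in> {1..n} \<Longrightarrow> B i \<notin> poly_boundary \<T>"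
begin

lemma finT: "finite \<T>" and faceT: "T \<in> \<T> \<Longrightarrow> T' \<in> \<T> \<Longrightarrow> T \<inter> T' face_of T"
  using tri unfolding triangulation_def by auto

lemma convexT: "T \<in> \<T> \<Longrightarrow> convex T" and compactT: "T \<in> \<T> \<Longrightarrow> compact T" and polytopeT: "T \<in> \<T> \<Longrightarrow> polytope T"
  using simp convex_simplex compact_simplex simplex_imp_polytope by blast+

lemma nonemptyT: "T \<in> \<T> \<Longrightarrow> T \<noteq> {}" using simp[of T] d1 by (auto simp: simplex_empty)

lemma extreme_in: "x extreme_point_of T \<Longrightarrow> x \<in> T" by (simp add: extreme_point_of_def)

text \<open>The vertices are given as extreme points of some simplex of the mesh; two simplices meet in a common face, and
  extreme points of a face are extreme points.\<close>

lemma vertex_extreme: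
  assumes T: "T \<in> \<T>" and i: "i \<in> {1..nb}" "B i \<in> T" shows "B i extreme_point_of T"
proof -
  obtain T' where T': "T' \<in> \<T>" "B i extreme_point_of T'" using verts i by blast
  have "B i extreme_point_of (T' \<inter> T)"
    using extreme_point_of_face[OF faceT[OF T'(1) T]] T'(2) i extreme_in by blast
  then show ?thesis using extreme_point_of_face[OF faceT[OF T T'(1)]] by (simp add: Int_commute)
qed

definition idx :: "'a set \<Rightarrow> nat set" where "idx T = {i \<in> {1..nb}. B i \<in> T}"

lemma idx_finite: "finite (idx T)" and idx_sub: "idx T \<subseteq> {1..nb}" by (auto simp: idx_def)

lemma extreme_eq: "T \<in> \<T> \<Longrightarrow> {x. x extreme_point_of T} = B ` idx T"
  using verts vertex_extreme extreme_in unfolding idx_def by fastforce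

lemma hullT: "T \<in> \<T> \<Longrightarrow> T = convex hull (B ` idx T)"
  using Krein_Milman_Minkowski[OF compactT convexT] extreme_eq by metis

lemma hull_face:
  assumes T: "T \<in> \<T>" and F: "F face_of T" shows "F = convex hull (B ` {i \<in> idx T. B i \<in> F})"
proof -
  have "F = convex hull {x. x extreme_point_of F}"
    using face_of_imp_compact[OF convexT[OF T] compactT[OF T] F] face_of_imp_convex[OF F] by (rule Krein_Milman_Minkowski)
  also have "{x. x extreme_point_of F} = B ` {i \<in> idx T. B i \<in> F}"
    using extreme_point_of_face[OF F] extreme_eq[OF T] by auto
  finally show ?thesis .
qed

lemma independentT: assumes "T \<in> \<T>" shows "\<not> affine_dependent (B ` idx T)"
proof -
  obtain C where C: "\<not> affine_dependent C" "T = convex hull C" using simp[OF assms] unfolding simplex_def by blast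
  then have "{x. x extreme_point_of T} = C" using extreme_point_of_convex_hull_affine_independent by blast
  then show ?thesis using C extreme_eq[OF assms] by simp
qed

lemma local_interpolation:
  assumes "T \<in> \<T>" shows "\<exists>a c. \<forall>i\<in>idx T. a \<bullet> B i + c = (val i :: real)"
proof -
  obtain a c where ac: "\<forall>v\<in>B ` idx T. a \<bullet> v + c = val (the_inv_into {1..nb} B v)"
    using affine_independent_interpolation[OF independentT[OF assms], of "\<lambda>v. val (the_inv_into {1..nb} B v)"] by blast
  have "the_inv_into {1..nb} B (B i) = i" if "i \<in> idx T" for i
    using that inj by (auto simp: idx_def intro!: the_inv_into_f_f)
  with ac show ?thesis by force
qed

lemma piecewise_linear_ge:
  assumes pl: "piecewise_linear \<T> \<phi>" and T: "T \<in> \<T>" and x: "x \<in> T" and m: "\<And>i. i \<in> idx T \<Longrightarrow> m \<le> \<phi> (B i)"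
  shows "m \<le> \<phi> x"
proof -
  obtain a c where ac: "\<And>x. x \<in> T \<Longrightarrow> \<phi> x = a \<bullet> x + c" using pl T unfolding piecewise_linear_def by blast
  have "m \<le> a \<bullet> x + c"
    by (rule affine_ge_on_hull[of "B ` idx T"]) (use m ac x hullT[OF T] in \<open>auto simp: idx_def\<close>)
  then show ?thesis using ac x by simp
qed

lemma piecewise_linear_unique:
  assumes "piecewise_linear \<T> \<phi>" "piecewise_linear \<T> \<psi>" "\<And>i. i \<in> {1..nb} \<Longrightarrow> \<phi> (B i) = \<psi> (B i)"
  shows "\<phi> = \<psi>"
proof
  fix x
  show "\<phi> x = \<psi> x"
  proof (cases "x \<in> \<Union>\<T>")
    case True
    then obtain T where T: "T \<in> \<T>" "x \<in> T" by blast
    obtain a c where ac: "\<And>x. x \<in> T \<Longrightarrow> \<phi> x = a \<bullet> x + c" using assms(1) T unfolding piecewise_linear_def by blast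
    obtain a' c' where ac': "\<And>x. x \<in> T \<Longrightarrow> \<psi> x = a' \<bullet> x + c'" using assms(2) T unfolding piecewise_linear_def by blast
    have "a \<bullet> x + c = a' \<bullet> x + c'"
      by (rule affine_eq_on_hull[of "B ` idx T"])
        (use assms(3) ac[symmetric] ac'[symmetric] T hullT[OF T(1)] in \<open>auto simp: idx_def\<close>)
    then show ?thesis using ac ac' T by simp
  next
    case False then show ?thesis using assms unfolding piecewise_linear_def by simp
  qed
qed

text \<open>Interpolate on each simplex separately. On a common face both interpolants are affine and agree at its
  vertices, hence agree.\<close>

lemma piecewise_linear_exists:
  "\<exists>\<phi>. piecewise_linear \<T> \<phi> \<and> (\<forall>i\<in>{1..nb}. \<phi> (B i) = val i)"
proof -
  obtain a c where ac: "\<And>T i. T \<in> \<T> \<Longrightarrow> i \<in> idx T \<Longrightarrow> a T \<bullet> B i + c T = val i"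
    using local_interpolation[of _ val] by metis
  define \<phi> where "\<phi> x = (if x \<in> \<Union>\<T> then let T = (SOME T. T \<in> \<T> \<and> x \<in> T) in a T \<bullet> x + c T else 0)" for x
  have \<phi>: "\<phi> x = a T \<bullet> x + c T" if T: "T \<in> \<T>" "x \<in> T" for T x
  proof -
    define T' where "T' = (SOME T. T \<in> \<T> \<and> x \<in> T)"
    have T': "T' \<in> \<T>" "x \<in> T'" unfolding T'_def using someI[of "\<lambda>T. T \<in> \<T> \<and> x \<in> T", OF conjI[OF T]] by auto
    have F: "x \<in> convex hull (B ` {i \<in> idx T. B i \<in> T \<inter> T'})"
      using hull_face[OF T(1) faceT[OF T(1) T'(1)]] T T' by blast
    have "a T' \<bullet> x + c T' = a T \<bullet> x + c T"
      by (rule affine_eq_on_hull[OF _ F]) (use ac T T' in \<open>auto simp: idx_def\<close>)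
    then show ?thesis using T by (auto simp: \<phi>_def T'_def Let_def)
  qed
  have "continuous_on (\<Union>T\<in>\<T>. T) \<phi>"
  proof (rule continuous_on_closed_Union[OF finT])
    fix T assume T: "T \<in> \<T>"
    show "closed T" using compactT[OF T] by (rule compact_imp_closed)
    have "continuous_on T (\<lambda>x. a T \<bullet> x + c T)" by (intro continuous_intros)
    then show "continuous_on T \<phi>" using \<phi>[OF T] by (simp cong: continuous_on_cong)
  qed
  moreover have "\<forall>T\<in>\<T>. \<exists>a c. \<forall>x\<in>T. \<phi> x = a \<bullet> x + c" using \<phi> by blast
  ultimately have "piecewise_linear \<T> \<phi>" unfolding piecewise_linear_def by (auto simp: \<phi>_def)
  moreover have "\<phi> (B i) = val i" if i: "i \<in> {1..nb}" for i
  proof -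
    obtain T where T: "T \<in> \<T>" "B i \<in> T" using verts i extreme_in by blast
    then show ?thesis using \<phi>[OF T] ac[OF T(1), of i] i by (simp add: idx_def)
  qed
  ultimately show ?thesis by blast
qed

abbreviation "hat \<equiv> nodal_basis \<T> B nb"

text \<open>Existence and uniqueness of the interpolant turn the definite description into the hat function.\<close>

lemma nodal_basis_pl: "piecewise_linear \<T> (hat j)"
  and nodal_basis_vertex: "i \<in> {1..nb} \<Longrightarrow> hat j (B i) = (if i = j then 1 else 0)"
proof -
  have "\<exists>!\<phi>. piecewise_linear \<T> \<phi> \<and> (\<forall>i\<in>{1..nb}. \<phi> (B i) = (if i = j then 1 else 0))"
    using piecewise_linear_exists[of "\<lambda>i. if i = j then 1 else 0"] piecewise_linear_unique by (smt (verit, best))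
  from theI'[OF this] show "piecewise_linear \<T> (hat j)" "i \<in> {1..nb} \<Longrightarrow> hat j (B i) = (if i = j then 1 else 0)"
    unfolding nodal_basis_def by blast+
qed

definition fe :: "(nat \<Rightarrow> real) \<Rightarrow> 'a \<Rightarrow> real" where "fe a x = (\<Sum>j=1..nb. a j * hat j x)"

lemma fe_pl: "piecewise_linear \<T> (fe a)"
  unfolding piecewise_linear_def
proof (intro conjI ballI allI impI)
  show "continuous_on (\<Union>\<T>) (fe a)"
    using nodal_basis_pl unfolding fe_def[abs_def] piecewise_linear_def by (intro continuous_intros) auto
  show "fe a x = 0" if "x \<notin> \<Union>\<T>" for x
    using nodal_basis_pl that unfolding fe_def piecewise_linear_def by (intro sum.neutral) auto
  fix T assume T: "T \<in> \<T>"
  have "\<exists>b c. \<forall>x\<in>T. hat j x = b \<bullet> x + c" for j using nodal_basis_pl[of j] T unfolding piecewise_linear_def by blast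
  then obtain b c where bc: "\<And>j x. x \<in> T \<Longrightarrow> hat j x = b j \<bullet> x + c j" by metis
  show "\<exists>b c. \<forall>x\<in>T. fe a x = b \<bullet> x + c"
    by (intro exI[of _ "\<Sum>j=1..nb. a j *\<^sub>R b j"] exI[of _ "\<Sum>j=1..nb. a j * c j"] ballI)
      (simp add: fe_def bc inner_sum_left sum.distrib distrib_left)
qed

lemma fe_vertex: "i \<in> {1..nb} \<Longrightarrow> fe a (B i) = a i"
  by (simp add: fe_def nodal_basis_vertex if_distrib[of "\<lambda>x. _ * x"] cong: if_cong)

lemma fe_continuous: "continuous_on (\<Union>\<T>) (fe a)" using fe_pl by (simp add: piecewise_linear_def)

lemma fe_ge: "T \<in> \<T> \<Longrightarrow> x \<in> T \<Longrightarrow> (\<And>i. i \<in> idx T \<Longrightarrow> m \<le> a i) \<Longrightarrow> m \<le> fe a x"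
  using piecewise_linear_ge[OF fe_pl, of T x m a] fe_vertex by (auto simp: idx_def)

lemma fe_uminus: "fe (\<lambda>i. - a i) x = - fe a x" by (simp add: fe_def sum_negf)
lemma fe_diff: "fe (\<lambda>i. a i - b i) x = fe a x - fe b x" by (simp add: fe_def sum_subtractf left_diff_distrib)

lemma fe_le: "T \<in> \<T> \<Longrightarrow> x \<in> T \<Longrightarrow> (\<And>i. i \<in> idx T \<Longrightarrow> a i \<le> m) \<Longrightarrow> fe a x \<le> m"
  using fe_ge[of T x "- m" "\<lambda>i. - a i"] by (simp add: fe_uminus)

lemma fe_const: "x \<in> \<Union>\<T> \<Longrightarrow> fe (\<lambda>_. k) x = k"
  using fe_ge[of _ x k "\<lambda>_. k"] fe_le[of _ x "\<lambda>_. k" k] by fastforce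

lemma fe_space_full: "fe_space \<T> B nb nb = range fe"
  unfolding fe_space_def fe_def[abs_def] by auto

text \<open>A coefficient vector for the interior vertices is extended by zero to the boundary vertices, so that both
  finite element spaces are described by the same kind of coefficients.\<close>

lemma fe_space_interior: "fe_space \<T> B nb n = fe ` {a. \<forall>j\<in>{n+1..nb}. a j = 0}"
proof -
  have eq: "(\<lambda>x. \<Sum>j=1..n. a j * hat j x) = fe a" if "\<forall>j\<in>{n+1..nb}. a j = 0" for a
  proof
    fix x
    have "(\<Sum>j=1..nb. a j * hat j x) = (\<Sum>j=1..n. a j * hat j x)"
      using that n_nb by (intro sum.mono_neutral_right) auto
    then show "(\<Sum>j=1..n. a j * hat j x) = fe a x" by (simp add: fe_def)
  qed
  show ?thesis
  proof (intro equalityI subsetI)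
    fix v assume "v \<in> fe_space \<T> B nb n"
    then obtain a where a: "v = (\<lambda>x. \<Sum>j=1..n. a j * hat j x)" unfolding fe_space_def by blast
    also have "\<dots> = (\<lambda>x. \<Sum>j=1..n. (if j \<le> n then a j else 0) * hat j x)" by (auto intro!: sum.cong)
    also have "\<dots> = fe (\<lambda>j. if j \<le> n then a j else 0)" by (rule eq) auto
    finally show "v \<in> fe ` {a. \<forall>j\<in>{n+1..nb}. a j = 0}" by auto
  next
    fix v assume "v \<in> fe ` {a. \<forall>j\<in>{n+1..nb}. a j = 0}"
    then obtain a where "\<forall>j\<in>{n+1..nb}. a j = 0" "v = fe a" by blast
    then have "v = (\<lambda>x. \<Sum>j=1..n. a j * hat j x)" using eq by simp
    then show "v \<in> fe_space \<T> B nb n" unfolding fe_space_def by blast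
  qed
qed

lemma boundary_interpolant_fe:
  "boundary_interpolant \<T> B n nb g = fe (\<lambda>j. if n + 1 \<le> j then g (B j) else 0)"
proof
  fix x
  have "(\<Sum>j=n+1..nb. g (B j) * hat j x) = (\<Sum>j=1..nb. (if n + 1 \<le> j then g (B j) else 0) * hat j x)"
    by (intro sum.mono_neutral_cong_left) auto
  then show "boundary_interpolant \<T> B n nb g x = fe (\<lambda>j. if n + 1 \<le> j then g (B j) else 0) x"
    by (simp add: boundary_interpolant_def fe_def)
qed

lemma fe_inject: assumes "fe a = fe b" "j \<in> {1..nb}" shows "a j = b j"
  using fe_vertex[OF assms(2), of a] fe_vertex[OF assms(2), of b] assms(1) by simp

subsection \<open>Values on the polyhedral boundary\<close>

lemma poly_boundary_facet:
  assumes "x \<in> poly_boundary \<T>"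
  obtains T F where "T \<in> \<T>" "F face_of T" "x \<in> F" "F \<subseteq> poly_boundary \<T>"
proof -
  from assms obtain F where F': "F \<in> {F. \<exists>!T. T \<in> \<T> \<and> F facet_of T}" and "x \<in> F"
    unfolding poly_boundary_def by (rule UnionE)
  then have F: "x \<in> F" "\<exists>!T. T \<in> \<T> \<and> F facet_of T" by simp_all
  then have "F \<subseteq> poly_boundary \<T>" unfolding poly_boundary_def by (intro Union_upper CollectI)
  moreover obtain T where "T \<in> \<T>" "F facet_of T" using F(2) by (elim ex1E conjE) (rule that)
  ultimately show thesis using F(1) by (intro that[of T F]) (auto simp: facet_of_def)
qed

lemma poly_boundary_sub: "poly_boundary \<T> \<subseteq> \<Union>\<T>"
proof
  fix x assume "x \<in> poly_boundary \<T>"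
  then obtain T F where "T \<in> \<T>" "F face_of T" "x \<in> F" by (rule poly_boundary_facet)
  then show "x \<in> \<Union>\<T>" using face_of_imp_subset by blast
qed

text \<open>A boundary facet is the convex hull of its vertices. These belong to the boundary, so none of them is among
  the first \<open>n\<close>.\<close>

lemma fe_ge_boundary:
  assumes x: "x \<in> poly_boundary \<T>" and m: "\<And>j. j \<in> {n+1..nb} \<Longrightarrow> m \<le> a j"
  shows "m \<le> fe a x"
proof -
  obtain T F where TF: "T \<in> \<T>" "F face_of T" "x \<in> F" "F \<subseteq> poly_boundary \<T>"
    using poly_boundary_facet[OF x] .
  obtain b c where bc: "\<And>x. x \<in> T \<Longrightarrow> fe a x = b \<bullet> x + c" using fe_pl[of a] TF(1) unfolding piecewise_linear_def by blast
  have FT: "F \<subseteq> T" using TF(2) by (rule face_of_imp_subset)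
  have "m \<le> b \<bullet> x + c"
  proof (rule affine_ge_on_hull[of "B ` {i \<in> idx T. B i \<in> F}"])
    fix v assume "v \<in> B ` {i \<in> idx T. B i \<in> F}"
    then obtain i where i: "i \<in> {1..nb}" "v = B i" "v \<in> F" "v \<in> T" by (auto simp: idx_def)
    then have "i \<notin> {1..n}" using interior TF(4) by blast
    then have "m \<le> a i" using m i(1) by auto
    then show "m \<le> b \<bullet> v + c" using fe_vertex[OF i(1), of a] bc[OF i(4)] i(2) by simp
  qed (use hull_face[OF TF(1,2)] TF(3) in blast)
  then show ?thesis using bc[of x] TF(3) FT by auto
qed

lemma fe_eq_boundary:
  assumes x: "x \<in> poly_boundary \<T>" and ab: "\<And>j. j \<in> {n+1..nb} \<Longrightarrow> a j = b j"
  shows "fe a x = fe b x"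
proof -
  have "0 \<le> fe (\<lambda>i. a i - b i) x" "0 \<le> fe (\<lambda>i. b i - a i) x" using ab by (auto intro!: fe_ge_boundary[OF x])
  then show ?thesis by (simp add: fe_diff)
qed

lemma compact_poly_boundary: "compact (poly_boundary \<T>)"
proof -
  have sub: "{F. \<exists>!T. T \<in> \<T> \<and> F facet_of T} \<subseteq> (\<Union>T\<in>\<T>. {F. F facet_of T})"
  proof
    fix F assume "F \<in> {F. \<exists>!T. T \<in> \<T> \<and> F facet_of T}"
    then have "\<exists>!T. T \<in> \<T> \<and> F facet_of T" by simp
    then obtain T where "T \<in> \<T>" "F facet_of T" by (elim ex1E conjE) (rule that)
    then show "F \<in> (\<Union>T\<in>\<T>. {F. F facet_of T})" by blast
  qed
  have "finite (\<Union>T\<in>\<T>. {F. F facet_of T})" using finT polytopeT finite_polytope_facets by blast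
  then have "finite {F. \<exists>!T. T \<in> \<T> \<and> F facet_of T}" by (rule finite_subset[OF sub])
  moreover have "compact F" if "F \<in> {F. \<exists>!T. T \<in> \<T> \<and> F facet_of T}" for F
  proof -
    from that have "\<exists>!T. T \<in> \<T> \<and> F facet_of T" by simp
    then obtain T where "T \<in> \<T>" "F facet_of T" by (elim ex1E conjE) (rule that)
    then show ?thesis using face_of_imp_compact[OF convexT compactT] by (simp add: facet_of_def)
  qed
  ultimately show ?thesis unfolding poly_boundary_def by (intro compact_Union)
qed

lemma compact_surface: "compact (\<Union>\<T>)" using finT compactT by (intro compact_Union)

subsection \<open>Elementwise gradients\<close>

text \<open>A simplex of dimension \<open>d\<close> spans a hyperplane of the ambient space; a functional that is constant
  on the simplex is constant on the hyperplane, so it is a multiple of its normal.\<close>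

lemma constant_direction:
  assumes T: "T \<in> \<T>"
  obtains a where "a \<noteq> 0" "\<forall>x\<in>T. \<forall>y\<in>T. a \<bullet> (x - y) = 0"
    "\<forall>u. (\<forall>x\<in>T. \<forall>y\<in>T. u \<bullet> (x - y) = 0) \<longrightarrow> u = ((u \<bullet> a) / (a \<bullet> a)) *\<^sub>R a"
proof -
  have "aff_dim T = int DIM('a) - 1" using aff_dim_simplex[OF simp[OF T]] dim by simp
  then obtain a b where a: "a \<noteq> 0" "affine hull T = {x. a \<bullet> x = b}" using aff_dim_eq_hyperplane[of T] by auto
  show thesis
  proof (rule that[OF a(1)], goal_cases)
    case 1
    have "a \<bullet> (x - y) = 0" if "x \<in> T" "y \<in> T" for x y
    proof -
      have "x \<in> {x. a \<bullet> x = b}" "y \<in> {x. a \<bullet> x = b}" using that a(2) by (metis hull_inc)+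
      then show ?thesis by (simp add: inner_diff_right)
    qed
    then show ?case by blast
  next
    case 2
    show ?case
    proof (intro allI impI)
      fix u assume u: "\<forall>x\<in>T. \<forall>y\<in>T. u \<bullet> (x - y) = 0"
      obtain x0 where x0: "x0 \<in> T" using nonemptyT[OF T] by blast
      have hull: "affine hull T \<subseteq> {x. u \<bullet> x = u \<bullet> x0}"
      proof (rule hull_minimal)
        show "T \<subseteq> {x. u \<bullet> x = u \<bullet> x0}"
        proof
          fix x assume "x \<in> T"
          then have "u \<bullet> (x - x0) = 0" using u x0 by blast
          then show "x \<in> {x. u \<bullet> x = u \<bullet> x0}" by (simp add: inner_diff_right)
        qed
      qed (rule affine_hyperplane)
      define v where "v = u - ((u \<bullet> a) / (a \<bullet> a)) *\<^sub>R a"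
      have av: "a \<bullet> v = 0" using a(1) by (simp add: v_def inner_diff_right inner_commute)
      have "x0 \<in> {x. a \<bullet> x = b}" using x0 a(2) by (metis hull_inc)
      then have "x0 + v \<in> affine hull T" unfolding a(2) using av by (simp add: inner_add_right)
      then have "u \<bullet> v = 0" using hull by (auto simp: inner_add_right)
      then have "v \<bullet> v = 0" using av by (simp add: v_def inner_diff_left inner_diff_right inner_commute)
      then show "u = ((u \<bullet> a) / (a \<bullet> a)) *\<^sub>R a" by (simp add: v_def)
    qed
  qed
qed

lemma simplex_normal:
  assumes T: "T \<in> \<T>"
  shows "norm (simplex_normal T) = 1" "x \<in> T \<Longrightarrow> y \<in> T \<Longrightarrow> simplex_normal T \<bullet> (x - y) = 0"
    "(\<And>x y. x \<in> T \<Longrightarrow> y \<in> T \<Longrightarrow> u \<bullet> (x - y) = 0) \<Longrightarrow> u = (u \<bullet> simplex_normal T) *\<^sub>R simplex_normal T"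
proof -
  obtain a where a: "a \<noteq> 0" "\<forall>x\<in>T. \<forall>y\<in>T. a \<bullet> (x - y) = 0"
    "\<forall>u. (\<forall>x\<in>T. \<forall>y\<in>T. u \<bullet> (x - y) = 0) \<longrightarrow> u = ((u \<bullet> a) / (a \<bullet> a)) *\<^sub>R a"
    by (rule constant_direction[OF T])
  have "norm (a /\<^sub>R norm a) = 1 \<and> (\<forall>x\<in>T. \<forall>y\<in>T. (a /\<^sub>R norm a) \<bullet> (x - y) = 0)"
    using a(1,2) by (simp del: inner_diff_right)
  then have m: "norm (simplex_normal T) = 1 \<and> (\<forall>x\<in>T. \<forall>y\<in>T. simplex_normal T \<bullet> (x - y) = 0)"
    unfolding simplex_normal_def by (rule someI)
  then show "norm (simplex_normal T) = 1" "x \<in> T \<Longrightarrow> y \<in> T \<Longrightarrow> simplex_normal T \<bullet> (x - y) = 0" by auto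
  assume u: "\<And>x y. x \<in> T \<Longrightarrow> y \<in> T \<Longrightarrow> u \<bullet> (x - y) = 0"
  let ?m = "simplex_normal T"
  define k where "k = (?m \<bullet> a) / (a \<bullet> a)"
  have mk: "?m = k *\<^sub>R a" unfolding k_def using a(3) m by blast
  have "k \<noteq> 0" using m mk by auto
  have "?m \<bullet> ?m = 1" using m by (simp add: dot_square_norm)
  moreover have "u = ((u \<bullet> a) / (a \<bullet> a) / k) *\<^sub>R ?m" using a(3)[rule_format, of u] u \<open>k \<noteq> 0\<close> by (simp add: mk)
  ultimately show "u = (u \<bullet> ?m) *\<^sub>R ?m" by (metis inner_scaleR_left mult.right_neutral)
qed

text \<open>Two affine extensions of a function differ by a functional that is constant on \<open>T\<close>, which the
  projection removes. So the chosen extension does not matter, and the gradient is linear in the function.\<close>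

lemma simplex_gradient_affine:
  assumes T: "T \<in> \<T>" and \<phi>: "\<And>x. x \<in> T \<Longrightarrow> \<phi> x = a \<bullet> x + c"
  shows "simplex_gradient T \<phi> = a - (a \<bullet> simplex_normal T) *\<^sub>R simplex_normal T"
proof -
  let ?m = "simplex_normal T"
  define a' where "a' = (SOME a. \<exists>c. \<forall>x\<in>T. \<phi> x = a \<bullet> x + c)"
  have "\<exists>c. \<forall>x\<in>T. \<phi> x = a \<bullet> x + c" using \<phi> by blast
  then have "\<exists>c. \<forall>x\<in>T. \<phi> x = a' \<bullet> x + c" unfolding a'_def by (rule someI)
  then obtain c' where c': "\<And>x. x \<in> T \<Longrightarrow> \<phi> x = a' \<bullet> x + c'" by blast
  have "(a' - a) \<bullet> (x - y) = 0" if "x \<in> T" "y \<in> T" for x y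
    using \<phi>[OF that(1)] \<phi>[OF that(2)] c'[OF that(1)] c'[OF that(2)] by (simp add: inner_diff_left inner_diff_right)
  then have "a' - a = ((a' - a) \<bullet> ?m) *\<^sub>R ?m" by (rule simplex_normal(3)[OF T])
  then have "a' - a = (a' \<bullet> ?m) *\<^sub>R ?m - (a \<bullet> ?m) *\<^sub>R ?m"
    by (simp only: inner_diff_left scaleR_left_diff_distrib)
  moreover have "(a' - (a' \<bullet> ?m) *\<^sub>R ?m) - (a - (a \<bullet> ?m) *\<^sub>R ?m) = (a' - a) - ((a' \<bullet> ?m) *\<^sub>R ?m - (a \<bullet> ?m) *\<^sub>R ?m)"
    by (simp add: algebra_simps)
  ultimately have "a' - (a' \<bullet> ?m) *\<^sub>R ?m = a - (a \<bullet> ?m) *\<^sub>R ?m" by simp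
  then show ?thesis unfolding simplex_gradient_def a'_def[symmetric] Let_def .
qed

lemma simplex_gradient_works:
  assumes T: "T \<in> \<T>" and pl: "piecewise_linear \<T> \<phi>" and xy: "x \<in> T" "y \<in> T"
  shows "\<phi> x - \<phi> y = simplex_gradient T \<phi> \<bullet> (x - y)"
proof -
  obtain a c where ac: "\<And>x. x \<in> T \<Longrightarrow> \<phi> x = a \<bullet> x + c" using pl T unfolding piecewise_linear_def by blast
  have g: "simplex_gradient T \<phi> = a - (a \<bullet> simplex_normal T) *\<^sub>R simplex_normal T"
    by (rule simplex_gradient_affine[OF T]) (rule ac)
  show ?thesis
    using simplex_normal(2)[OF T xy] ac[OF xy(1)] ac[OF xy(2)] by (simp add: g inner_diff_left inner_diff_right)
qed

abbreviation grad :: "'a set \<Rightarrow> nat \<Rightarrow> 'a" where "grad T j \<equiv> simplex_gradient T (hat j)"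

lemma simplex_gradient_fe:
  assumes T: "T \<in> \<T>" shows "simplex_gradient T (fe a) = (\<Sum>j=1..nb. a j *\<^sub>R grad T j)"
proof -
  have "\<exists>b c. \<forall>x\<in>T. hat j x = b \<bullet> x + c" for j using nodal_basis_pl[of j] T unfolding piecewise_linear_def by blast
  then obtain b c where bc: "\<And>j x. x \<in> T \<Longrightarrow> hat j x = b j \<bullet> x + c j" by metis
  have "fe a x = (\<Sum>j=1..nb. a j *\<^sub>R b j) \<bullet> x + (\<Sum>j=1..nb. a j * c j)" if "x \<in> T" for x
    using that by (simp add: fe_def bc inner_sum_left sum.distrib distrib_left)
  from simplex_gradient_affine[OF T this] show ?thesis
    by (simp add: simplex_gradient_affine[OF T bc] inner_sum_left scaleR_sum_left sum_subtractf scaleR_right_diff_distrib)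
qed

lemma grad_zero: assumes T: "T \<in> \<T>" and j: "j \<in> {1..nb}" "j \<notin> idx T" shows "grad T j = 0"
proof -
  have "hat j x = 0 \<bullet> x + 0" if "x \<in> T" for x
  proof -
    have v: "hat j (B i) = 0" if "i \<in> idx T" for i using that j nodal_basis_vertex[of i j] by (auto simp: idx_def)
    have e: "hat j = fe (hat j \<circ> B)" by (rule piecewise_linear_unique[OF nodal_basis_pl fe_pl]) (simp add: fe_vertex)
    show ?thesis
      using fe_ge[OF T that, of 0 "hat j \<circ> B"] fe_le[OF T that, of "hat j \<circ> B" 0] v by (simp add: e[symmetric])
  qed
  from simplex_gradient_affine[OF T this] show ?thesis by simp
qed

lemma grad_sum: assumes T: "T \<in> \<T>" shows "(\<Sum>j=1..nb. grad T j) = 0"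
proof -
  have "fe (\<lambda>_. 1) x = 0 \<bullet> x + 1" if "x \<in> T" for x using fe_const[of x 1] T that by auto
  from simplex_gradient_affine[OF T this] simplex_gradient_fe[OF T, of "\<lambda>_. 1"] show ?thesis by simp
qed

lemma rel_interior_unique:
  assumes T: "T \<in> \<T>" "x \<in> rel_interior T" and T': "T' \<in> \<T>" "x \<in> T'" shows "T \<subseteq> T'"
proof -
  have "x \<in> T" using T rel_interior_subset by blast
  then have "T \<inter> T' = T" using face_of_disjoint_rel_interior[OF faceT[OF T(1) T'(1)]] T(2) T'(2) by blast
  then show ?thesis by blast
qed

lemma surface_gradient_simplex:
  assumes T: "T \<in> \<T>" "x \<in> rel_interior T" shows "surface_gradient \<T> \<phi> x = simplex_gradient T \<phi>"
proof -
  have "(THE T. T \<in> \<T> \<and> x \<in> rel_interior T) = T"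
  proof (rule the_equality)
    fix T' assume T': "T' \<in> \<T> \<and> x \<in> rel_interior T'"
    have "x \<in> T" "x \<in> T'" using T T' rel_interior_subset by blast+
    then have "T \<subseteq> T'" "T' \<subseteq> T" using rel_interior_unique T T' by blast+
    then show "T' = T" by blast
  qed (use T in blast)
  then show ?thesis using T unfolding surface_gradient_def open_simplices_def by auto
qed

text \<open>A segment from \<open>B j\<close> through a relative interior point can be prolonged inside \<open>T\<close>.
  The hat function is affine on it, equal to 1 at the start and nonnegative at the end, so it is positive in
  between.\<close>

lemma nodal_basis_pos:
  assumes T: "T \<in> \<T>" "x \<in> rel_interior T" and j: "j \<in> idx T" shows "0 < hat j x"
proof -
  have e: "hat j = fe (hat j \<circ> B)" by (rule piecewise_linear_unique[OF nodal_basis_pl fe_pl]) (simp add: fe_vertex)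
  have nonneg: "0 \<le> hat j y" if "y \<in> T" for y
  proof -
    have "0 \<le> fe (hat j \<circ> B) y" by (rule fe_ge[OF T(1) that]) (use nodal_basis_vertex in \<open>auto simp: idx_def\<close>)
    then show ?thesis using e by simp
  qed
  obtain a c where ac: "\<And>x. x \<in> T \<Longrightarrow> hat j x = a \<bullet> x + c" using nodal_basis_pl[of j] T(1) unfolding piecewise_linear_def by blast
  have B: "B j \<in> T" "hat j (B j) = 1" using j nodal_basis_vertex[of j j] by (auto simp: idx_def)
  obtain e where e1: "e > 1" "(1 - e) *\<^sub>R B j + e *\<^sub>R x \<in> T"
    using convex_rel_interior_iff[OF convexT[OF T(1)] nonemptyT[OF T(1)]] T(2) B(1) by blast
  have xT: "x \<in> T" using T rel_interior_subset by blast
  have "0 \<le> hat j ((1 - e) *\<^sub>R B j + e *\<^sub>R x)" using nonneg e1 by blast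
  also have "\<dots> = (1 - e) * hat j (B j) + e * hat j x"
    unfolding ac[OF e1(2)] ac[OF B(1)] ac[OF xT] by (simp add: inner_add_right algebra_simps)
  finally have "0 < e * hat j x" using e1 B by simp
  then show ?thesis using e1 by (simp add: zero_less_mult_iff)
qed

text \<open>By positivity of the hat functions every relative interior point of \<open>T\<close> lies in both supports.\<close>

lemma acute_products:
  assumes acute: "\<forall>i\<in>{1..n}. \<forall>j\<in>{1..nb}. i \<noteq> j \<longrightarrow>
       (\<forall>x \<in> nodal_support \<T> B nb i \<inter> nodal_support \<T> B nb j \<inter> open_simplices \<T>.
          surface_gradient \<T> (hat i) x \<bullet> surface_gradient \<T> (hat j) x \<le> - s)"
    and T: "T \<in> \<T>" and i: "i \<in> idx T" "i \<le> n" and j: "j \<in> idx T" "i \<noteq> j"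
  shows "grad T i \<bullet> grad T j \<le> - s"
proof -
  obtain x where x: "x \<in> rel_interior T"
    using rel_interior_eq_empty[OF convexT[OF T]] nonemptyT[OF T] by blast
  have "x \<in> nodal_support \<T> B nb k" if "k \<in> idx T" for k
  proof -
    have "x \<in> T" using x rel_interior_subset by blast
    then have "x \<in> {x \<in> \<Union>\<T>. hat k x \<noteq> 0}" using nodal_basis_pos[OF T x that] T by auto
    then show ?thesis unfolding nodal_support_def by (rule subsetD[OF closure_subset])
  qed
  then have "x \<in> nodal_support \<T> B nb i \<inter> nodal_support \<T> B nb j \<inter> open_simplices \<T>"
    using i j x T unfolding open_simplices_def by blast
  moreover have "i \<in> {1..n}" "j \<in> {1..nb}" using i j by (auto simp: idx_def)
  ultimately have "surface_gradient \<T> (hat i) x \<bullet> surface_gradient \<T> (hat j) x \<le> - s"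
    using acute j(2) by blast
  then show ?thesis using surface_gradient_simplex[OF T x] by simp
qed

end

section \<open>Comparison of the polyhedral surface with the smooth one\<close>

lemma surface_measure_nn_integral:
  assumes "A \<in> sets borel"
  shows "(\<integral>\<^sup>+x. g x \<partial>surface_measure d A) = (\<integral>\<^sup>+x\<in>A. g x \<partial>hausdorff_measure d)"
  using assms unfolding surface_measure_def by (simp add: nn_integral_completion nn_integral_restrict_space)

lemma surface_measure_AE:
  fixes A :: "'a::euclidean_space set"
  assumes "A \<in> sets borel"
  shows "(AE x in surface_measure d A. Q x) \<longleftrightarrow> (AE x in hausdorff_measure d. x \<in> A \<longrightarrow> Q x)"
  using assms unfolding surface_measure_def by (simp add: AE_completion_iff AE_restrict_space_iff)

lemma space_surface_measure: "space (surface_measure d A) = A"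
  by (simp add: surface_measure_def space_restrict_space)

lemma surface_measure_measurable:
  assumes "f \<in> borel_measurable (restrict_space borel A)" shows "f \<in> borel_measurable (surface_measure d A)"
proof -
  have "f \<in> borel_measurable (restrict_space (hausdorff_measure d) A)"
    using assms measurable_cong_sets[OF sets_restrict_space_cong[OF sets_hausdorff] refl] by blast
  then show ?thesis unfolding surface_measure_def by (rule measurable_completion)
qed

text \<open>A mesh that parametrizes the surface through a map \<open>P\<close> which is bi-Lipschitz on single simplices;
  in the application \<open>P\<close> is the foot point map. The positivity of the measures also makes them
  finite, because infinite measure has the real value 0.\<close>

locale lifted_mesh = simplicial_mesh d \<T> B n nb for d and \<T> :: "'a::euclidean_space set set" and B n nb +
  fixes S :: "'a set" and P :: "'a \<Rightarrow> 'a"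
  assumes bij: "bij_betw P (\<Union>\<T>) S" and P_boundary: "P ` poly_boundary \<T> = surface_boundary S"
    and expand: "\<And>T x y. T \<in> \<T> \<Longrightarrow> x \<in> T \<Longrightarrow> y \<in> T \<Longrightarrow> dist x y \<le> 2 * dist (P x) (P y)"
    and contract: "\<And>T x y. T \<in> \<T> \<Longrightarrow> x \<in> T \<Longrightarrow> y \<in> T \<Longrightarrow> dist (P x) (P y) \<le> 2 * dist x y"
    and measure_pos: "\<And>T. T \<in> \<T> \<Longrightarrow> 0 < measure (hausdorff_measure d) T"
    and nonemptyM: "\<T> \<noteq> {}"
begin

abbreviation "H \<equiv> hausdorff_measure d :: 'a measure"
abbreviation "Sh \<equiv> \<Union>\<T>"

lemma emeasure_T: "T \<in> \<T> \<Longrightarrow> emeasure H T = ennreal (measure H T)"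
  using measure_pos[of T] by (metis emeasure_eq_ennreal_measure measure_def enn2real_top less_irrefl)

lemma nonzero: "\<exists>T0. emeasure H T0 \<noteq> 0"
proof -
  obtain T where T: "T \<in> \<T>" using nonemptyM by blast
  then have "emeasure H T \<noteq> 0" using emeasure_T[OF T] measure_pos[OF T] by simp
  then show ?thesis by blast
qed

lemma emeasure_outer: "A \<in> sets borel \<Longrightarrow> emeasure H A = hausdorff_outer d A"
  using nonzero emeasure_hausdorff by blast

lemma borel_T: "T \<in> \<T> \<Longrightarrow> T \<in> sets borel" using compactT by (simp add: borel_compact)
lemma borel_Sh: "Sh \<in> sets borel" using compact_surface by (simp add: borel_compact)

lemma P_lipschitz: "T \<in> \<T> \<Longrightarrow> 2-lipschitz_on T P" using contract by (intro lipschitz_onI) auto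

lemma P_continuous_T: "T \<in> \<T> \<Longrightarrow> continuous_on T P" using P_lipschitz lipschitz_on_continuous_on by blast

lemma P_continuous: "continuous_on Sh P"
proof -
  have "continuous_on (\<Union>T\<in>\<T>. T) P"
    by (rule continuous_on_closed_Union[OF finT]) (use compactT compact_imp_closed P_continuous_T in auto)
  then show ?thesis by simp
qed

lemma P_inj: "inj_on P Sh" and P_image: "P ` Sh = S" using bij by (auto simp: bij_betw_def)

lemma P_in: "x \<in> Sh \<Longrightarrow> P x \<in> S" using P_image by blast

lemma compact_S: "compact S" using compact_continuous_image[OF P_continuous compact_surface] P_image by simp
lemma borel_S: "S \<in> sets borel" using compact_S by (simp add: borel_compact)

lemma compact_K: "T \<in> \<T> \<Longrightarrow> compact (P ` T)" using P_continuous_T compactT compact_continuous_image by blast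

lemma emeasure_image_le:
  assumes T: "T \<in> \<T>" and A: "A \<subseteq> T" "compact A"
  shows "emeasure H (P ` A) \<le> ennreal (2 ^ d) * emeasure H A"
proof -
  have cP: "compact (P ` A)" using A compact_continuous_image continuous_on_subset[OF P_continuous_T[OF T]] by blast
  have PinjT: "inj_on P A" using P_inj A T by (metis Union_upper inj_on_subset)
  have eq: "{y \<in> P ` A. the_inv_into A P y \<in> A} = P ` A"
    using the_inv_into_f_f[OF PinjT] by auto
  have "hausdorff_outer d {y \<in> P ` A. the_inv_into A P y \<in> A} \<le> ennreal (2 ^ d) * hausdorff_outer d A"
  proof (rule hausdorff_outer_expanding[OF d1])
    fix y y' assume "y \<in> P ` A" "y' \<in> P ` A"
    then show "dist y y' \<le> 2 * dist (the_inv_into A P y) (the_inv_into A P y')"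
      using the_inv_into_f_f[OF PinjT] contract[OF T] A(1) by (auto simp: subset_iff)
  qed simp
  then show ?thesis unfolding eq using emeasure_outer cP A by (simp add: borel_compact)
qed

lemma emeasure_K: "T \<in> \<T> \<Longrightarrow> emeasure H (P ` T) \<le> ennreal (2 ^ d) * emeasure H T"
  using emeasure_image_le compactT by blast

lemma finite_S: "emeasure H S \<noteq> \<infinity>"
proof -
  have "S = (\<Union>T\<in>\<T>. P ` T)" using P_image by blast
  moreover have "(\<lambda>T. P ` T) ` \<T> \<subseteq> sets H" using compact_K borel_compact by auto
  ultimately have "emeasure H S \<le> (\<Sum>T\<in>\<T>. emeasure H (P ` T))"
    using emeasure_subadditive_finite[OF finT, of "\<lambda>T. P ` T" H] by simp
  also have "\<dots> \<le> (\<Sum>T\<in>\<T>. ennreal (2 ^ d) * ennreal (measure H T))"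
    using emeasure_K emeasure_T by (intro sum_mono) auto
  also have "\<dots> < \<infinity>" by (simp add: ennreal_mult_less_top finT flip: sum_distrib_left)
  finally show ?thesis by simp
qed

lemma finite_Sh: "emeasure H Sh \<noteq> \<infinity>"
proof -
  have "emeasure H (\<Union>T\<in>\<T>. T) \<le> (\<Sum>T\<in>\<T>. emeasure H T)"
    using borel_T by (intro emeasure_subadditive_finite finT) auto
  also have "\<dots> = (\<Sum>T\<in>\<T>. ennreal (measure H T))" using emeasure_T by (intro sum.cong) auto
  also have "\<dots> < \<infinity>" by (simp add: finT)
  finally show ?thesis by simp
qed

lemma frontier_null: "T \<in> \<T> \<Longrightarrow> emeasure H (T - rel_interior T) = 0"
  using hausdorff_rel_boundary_null[OF d1 convexT compactT] emeasure_T by simp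

lemma compact_frontier: assumes "T \<in> \<T>" shows "compact (T - rel_interior T)"
proof -
  have "closed T" using compactT[OF assms] by (rule compact_imp_closed)
  then have "T - rel_interior T = rel_frontier T" by (simp add: rel_frontier_def)
  then show ?thesis using compact_rel_frontier_bounded[OF compact_imp_bounded[OF compactT[OF assms]]] by simp
qed

lemma borel_ri: assumes "T \<in> \<T>" shows "rel_interior T \<in> sets borel"
proof -
  have "T - (T - rel_interior T) \<in> sets borel"
    using borel_T[OF assms] borel_compact[OF compact_frontier[OF assms]] by (rule sets.Diff)
  then show ?thesis using rel_interior_subset[of T] by (simp add: Diff_Diff_Int Int_absorb1)
qed

lemma emeasure_ri: "T \<in> \<T> \<Longrightarrow> emeasure H (rel_interior T) = emeasure H T"
proof -
  assume T: "T \<in> \<T>"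
  have "T = rel_interior T \<union> (T - rel_interior T)" using rel_interior_subset by blast
  then have "emeasure H T \<le> emeasure H (rel_interior T) + emeasure H (T - rel_interior T)"
    using emeasure_subadditive[of "rel_interior T" H "T - rel_interior T"] borel_ri[OF T] borel_T[OF T] by simp
  moreover have "emeasure H (rel_interior T) \<le> emeasure H T" using borel_T[OF T] by (intro emeasure_mono rel_interior_subset) auto
  ultimately show ?thesis using frontier_null[OF T] by simp
qed

text \<open>Otherwise \<open>T\<close> would be a proper face of \<open>T'\<close>, but all simplices have the same
  dimension.\<close>

lemma ri_subset_eq:
  assumes T: "T \<in> \<T>" "x \<in> rel_interior T" and T': "T' \<in> \<T>" "x \<in> T'" shows "T = T'"
proof (rule ccontr)
  assume ne: "T \<noteq> T'"
  have sub: "T \<subseteq> T'" by (rule rel_interior_unique[OF T T'])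
  then have "T face_of T'" using faceT[OF T'(1) T(1)] by (simp add: Int_absorb1)
  then have "aff_dim T < aff_dim T'" using ne convexT[OF T'(1)] by (intro face_of_aff_dim_lt) auto
  then show False using aff_dim_simplex[OF simp[OF T(1)]] aff_dim_simplex[OF simp[OF T'(1)]] by simp
qed

lemma ri_sub: "T \<in> \<T> \<Longrightarrow> x \<in> rel_interior T \<Longrightarrow> x \<in> T"
  using rel_interior_subset by blast

lemma ri_unique: "T \<in> \<T> \<Longrightarrow> x \<in> rel_interior T \<Longrightarrow> T' \<in> \<T> \<Longrightarrow> x \<in> rel_interior T' \<Longrightarrow> T = T'"
  by (rule ri_subset_eq) (auto intro: ri_sub)

lemma AE_open_simplex: "AE x in H. x \<in> Sh \<longrightarrow> (\<exists>T\<in>\<T>. x \<in> rel_interior T)"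
proof -
  have "AE x in H. \<forall>T\<in>\<T>. x \<notin> T - rel_interior T"
  proof (rule AE_finite_allI[OF finT])
    fix T assume T: "T \<in> \<T>"
    have "T - rel_interior T \<in> null_sets H"
      using frontier_null[OF T] borel_T[OF T] borel_ri[OF T] by (auto simp: null_sets_def)
    then show "AE x in H. x \<notin> T - rel_interior T" by (rule AE_not_in)
  qed
  then show ?thesis by (elim eventually_mono) blast
qed

text \<open>The images of the faces of lower dimension are null sets, because \<open>P\<close> is Lipschitz on each
  simplex.\<close>

lemma AE_open_image: "AE y in H. y \<in> S \<longrightarrow> (\<exists>T\<in>\<T>. y \<in> P ` rel_interior T)"
proof -
  have "AE y in H. \<forall>T\<in>\<T>. y \<notin> P ` (T - rel_interior T)"
  proof (rule AE_finite_allI[OF finT])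
    fix T assume T: "T \<in> \<T>"
    have "emeasure H (P ` (T - rel_interior T)) \<le> ennreal (2 ^ d) * emeasure H (T - rel_interior T)"
      by (rule emeasure_image_le[OF T _ compact_frontier[OF T]]) blast
    then have "emeasure H (P ` (T - rel_interior T)) = 0" using frontier_null[OF T] by simp
    moreover have "P ` (T - rel_interior T) \<in> sets H"
      using compact_continuous_image[OF continuous_on_subset[OF P_continuous_T[OF T]] compact_frontier[OF T]]
      by (simp add: borel_compact)
    ultimately have "P ` (T - rel_interior T) \<in> null_sets H" by (auto simp: null_sets_def)
    then show "AE y in H. y \<notin> P ` (T - rel_interior T)" by (rule AE_not_in)
  qed
  then show ?thesis
  proof (elim eventually_mono, intro impI)
    fix y assume y: "\<forall>T\<in>\<T>. y \<notin> P ` (T - rel_interior T)" "y \<in> S"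
    then obtain T x where "T \<in> \<T>" "x \<in> T" "y = P x" using P_image by blast
    with y show "\<exists>T\<in>\<T>. y \<in> P ` rel_interior T" by blast
  qed
qed

lemma nn_integral_simplices:
  assumes "\<And>T. T \<in> \<T> \<Longrightarrow> (\<lambda>x. g x * indicator (rel_interior T) x) \<in> borel_measurable borel"
  shows "(\<integral>\<^sup>+x\<in>Sh. g x \<partial>H) = (\<Sum>T\<in>\<T>. \<integral>\<^sup>+x\<in>rel_interior T. g x \<partial>H)"
proof -
  have "(\<integral>\<^sup>+x\<in>Sh. g x \<partial>H) = (\<integral>\<^sup>+x. (\<Sum>T\<in>\<T>. g x * indicator (rel_interior T) x) \<partial>H)"
  proof (rule nn_integral_cong_AE, use AE_open_simplex in \<open>elim eventually_mono\<close>)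
    fix x assume x: "x \<in> Sh \<longrightarrow> (\<exists>T\<in>\<T>. x \<in> rel_interior T)"
    show "g x * indicator Sh x = (\<Sum>T\<in>\<T>. g x * indicator (rel_interior T) x)"
    proof (cases "x \<in> Sh")
      case True
      then obtain T where T: "T \<in> \<T>" "x \<in> rel_interior T" using x by blast
      have "(\<Sum>T'\<in>\<T>. g x * indicator (rel_interior T') x) = (\<Sum>T'\<in>\<T>. if T' = T then g x else 0)"
        using T ri_unique by (intro sum.cong) (auto split: split_indicator)
      then show ?thesis using True T finT by simp
    next
      case False
      then have "\<forall>T\<in>\<T>. x \<notin> rel_interior T" using ri_sub by blast
      then show ?thesis using False by simp
    qed
  qed
  also have "\<dots> = (\<Sum>T\<in>\<T>. \<integral>\<^sup>+x\<in>rel_interior T. g x \<partial>H)"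
    using assms by (intro nn_integral_sum) auto
  finally show ?thesis .
qed

text \<open>Integrands built from elementwise gradients are continuous up to the boundary inside each simplex, but take
  other values on the common faces, where the gradient is set to zero. Covering both cases gives exact
  measurability instead of measurability up to null sets.\<close>

lemma integrable_piecewise_continuous:
  fixes F :: "'a \<Rightarrow> real"
  assumes "\<And>T. T \<in> \<T> \<Longrightarrow> continuous_on T (G T)" "\<And>T x. T \<in> \<T> \<Longrightarrow> x \<in> rel_interior T \<Longrightarrow> F x = G T x"
    and "continuous_on Sh F0" "\<And>x. x \<in> Sh \<Longrightarrow> (\<And>T. T \<in> \<T> \<Longrightarrow> x \<notin> rel_interior T) \<Longrightarrow> F x = F0 x"
  shows "integrable (surface_measure d Sh) F"
proof -
  let ?O = "\<Union>T\<in>\<T>. rel_interior T"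
  have O: "?O \<in> sets borel" using borel_ri finT by auto
  define F' where "F' x = (\<Sum>T\<in>\<T>. indicator (rel_interior T) x * (indicator T x *\<^sub>R G T x)) + indicator (Sh - ?O) x * (indicator Sh x *\<^sub>R F0 x)" for x
  have eq: "F x = F' x" if x: "x \<in> Sh" for x
  proof (cases "x \<in> ?O")
    case True
    then obtain T where T: "T \<in> \<T>" "x \<in> rel_interior T" by blast
    have "(\<Sum>T'\<in>\<T>. indicator (rel_interior T') x * (indicator T' x *\<^sub>R G T' x)) = (\<Sum>T'\<in>\<T>. if T' = T then G T x else 0)"
      using T ri_unique ri_sub by (intro sum.cong) (auto split: split_indicator)
    then show ?thesis using True T finT assms(2)[OF T] by (simp add: F'_def)
  next
    case False
    then have "F x = F0 x" using assms(4)[OF x] by blast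
    then show ?thesis using False x by (auto simp: F'_def intro!: sum.neutral)
  qed
  have mG: "(\<lambda>x. indicator T x *\<^sub>R G T x) \<in> borel_measurable borel" if "T \<in> \<T>" for T
    using borel_measurable_continuous_on_indicator[OF borel_T[OF that] assms(1)[OF that]] by simp
  have mF0: "(\<lambda>x. indicator Sh x *\<^sub>R F0 x) \<in> borel_measurable borel"
    using borel_measurable_continuous_on_indicator[OF borel_Sh assms(3)] by simp
  have mF': "F' \<in> borel_measurable borel"
    unfolding F'_def using borel_ri O borel_Sh mG mF0
    by (intro borel_measurable_add borel_measurable_sum borel_measurable_times borel_measurable_indicator sets.Diff) auto
  have bd: "\<exists>C. \<forall>x. norm (F' x) \<le> C"
  proof -
    have "\<exists>C. \<forall>x\<in>T. \<bar>G T x\<bar> \<le> C" if "T \<in> \<T>" for T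
      using compact_imp_bounded[OF compact_continuous_image[OF assms(1)[OF that] compactT[OF that]]] by (auto simp: bounded_iff)
    then obtain C where C: "\<And>T x. T \<in> \<T> \<Longrightarrow> x \<in> T \<Longrightarrow> \<bar>G T x\<bar> \<le> C T" by metis
    obtain C0 where C0: "\<And>x. x \<in> Sh \<Longrightarrow> \<bar>F0 x\<bar> \<le> C0"
      using compact_imp_bounded[OF compact_continuous_image[OF assms(3) compact_surface]] by (auto simp: bounded_iff)
    have "norm (F' x) \<le> (\<Sum>T\<in>\<T>. \<bar>C T\<bar>) + \<bar>C0\<bar>" for x
    proof -
      have a: "\<bar>indicator (rel_interior T) x * (indicator T x *\<^sub>R G T x)\<bar> \<le> \<bar>C T\<bar>" if "T \<in> \<T>" for T
        using C[OF that, of x] by (auto split: split_indicator)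
      have b: "\<bar>indicator (Sh - ?O) x * (indicator Sh x *\<^sub>R F0 x)\<bar> \<le> \<bar>C0\<bar>"
      proof (cases "x \<in> Sh")
        case True
        have "\<bar>F0 x\<bar> \<le> \<bar>C0\<bar>" using C0[OF True] by linarith
        then show ?thesis by (simp add: indicator_def)
      qed simp
      have "\<bar>\<Sum>T\<in>\<T>. indicator (rel_interior T) x * (indicator T x *\<^sub>R G T x)\<bar> \<le> (\<Sum>T\<in>\<T>. \<bar>C T\<bar>)"
        by (rule order_trans[OF sum_abs sum_mono]) (rule a)
      then show ?thesis unfolding F'_def real_norm_def using b by linarith
    qed
    then show ?thesis by blast
  qed
  then obtain C where C: "\<And>x. norm (F' x) \<le> C" by blast
  have fm: "finite_measure (surface_measure d Sh)"
  proof
    have "emeasure (surface_measure d Sh) (space (surface_measure d Sh)) = emeasure H Sh"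
      using surface_measure_nn_integral[OF borel_Sh, of d "\<lambda>_. 1"] borel_Sh by simp
    then show "emeasure (surface_measure d Sh) (space (surface_measure d Sh)) \<noteq> \<infinity>" using finite_Sh by simp
  qed
  have "integrable (surface_measure d Sh) F'"
    by (rule finite_measure.integrable_const_bound[OF fm, where B = C])
      (use C mF' in \<open>auto intro!: surface_measure_measurable measurable_restrict_space1\<close>)
  moreover have "integrable (surface_measure d Sh) F = integrable (surface_measure d Sh) F'"
  proof (rule Bochner_Integration.integrable_cong)
    fix x assume "x \<in> space (surface_measure d Sh)"
    then show "F x = F' x" using eq by (simp only: space_surface_measure)
  qed simp
  ultimately show ?thesis by simp
qed

text \<open>The relative interiors of the simplices are disjoint and so are their images, hence the changes of variables
  on single simplices add up without a factor counting the simplices.\<close>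

lemma nn_integral_pullback:
  assumes g: "g \<in> borel_measurable borel"
  shows "(\<integral>\<^sup>+x\<in>Sh. g (P x) \<partial>H) \<le> ennreal (2 ^ d) * (\<integral>\<^sup>+y\<in>S. g y \<partial>H)"
proof -
  have Pm: "P \<in> borel_measurable (restrict_space borel (rel_interior T))" if "T \<in> \<T>" for T
    using continuous_on_subset[OF P_continuous_T[OF that] rel_interior_subset] by (rule borel_measurable_continuous_on_restrict)
  have bP: "P ` rel_interior T \<in> sets borel" if T: "T \<in> \<T>" for T
  proof -
    have "P ` rel_interior T = P ` T - P ` (T - rel_interior T)"
    proof -
      have "inj_on P T" using P_inj T by (metis Union_upper inj_on_subset)
      then have "P ` T - P ` (T - rel_interior T) = P ` (T - (T - rel_interior T))"
        by (subst inj_on_image_set_diff[of P T]) auto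
      then show ?thesis using rel_interior_subset[of T] by (simp add: Diff_Diff_Int Int_absorb1)
    qed
    then show ?thesis
      using borel_compact[OF compact_K[OF T]]
        borel_compact[OF compact_continuous_image[OF continuous_on_subset[OF P_continuous_T[OF T]] compact_frontier[OF T]]] by auto
  qed
  obtain T0 where T0: "emeasure H T0 \<noteq> 0" using nonzero by blast
  have "(\<integral>\<^sup>+x\<in>Sh. g (P x) \<partial>H) = (\<Sum>T\<in>\<T>. \<integral>\<^sup>+x\<in>rel_interior T. g (P x) \<partial>H)"
  proof (rule nn_integral_simplices)
    fix T assume T: "T \<in> \<T>"
    have "(\<lambda>x. g (P x)) \<in> borel_measurable (restrict_space borel (rel_interior T))"
      using measurable_compose[OF Pm[OF T] g] .
    then show "(\<lambda>x. g (P x) * indicator (rel_interior T) x) \<in> borel_measurable borel"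
      using borel_ri[OF T] by (subst (asm) borel_measurable_restrict_space_iff_ennreal) auto
  qed
  also have "\<dots> \<le> (\<Sum>T\<in>\<T>. ennreal (2 ^ d) * (\<integral>\<^sup>+y\<in>P ` rel_interior T. g y \<partial>H))"
  proof (rule sum_mono)
    fix T assume T: "T \<in> \<T>"
    show "(\<integral>\<^sup>+x\<in>rel_interior T. g (P x) \<partial>H) \<le> ennreal (2 ^ d) * (\<integral>\<^sup>+y\<in>P ` rel_interior T. g y \<partial>H)"
      by (rule nn_integral_expanding[OF d1 T0 _ borel_ri[OF T] bP[OF T] order_refl Pm[OF T] _ g])
        (use expand[OF T] ri_sub[OF T] in auto)
  qed
  also have "\<dots> = ennreal (2 ^ d) * (\<integral>\<^sup>+y. (\<Sum>T\<in>\<T>. g y * indicator (P ` rel_interior T) y) \<partial>H)"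
    using g bP by (subst nn_integral_sum) (auto simp: sum_distrib_left)
  also have "(\<integral>\<^sup>+y. (\<Sum>T\<in>\<T>. g y * indicator (P ` rel_interior T) y) \<partial>H) \<le> (\<integral>\<^sup>+y\<in>S. g y \<partial>H)"
  proof (rule nn_integral_mono)
    fix y
    show "(\<Sum>T\<in>\<T>. g y * indicator (P ` rel_interior T) y) \<le> g y * indicator S y"
    proof (cases "\<exists>T\<in>\<T>. y \<in> P ` rel_interior T")
      case True
      then obtain T x where T: "T \<in> \<T>" "x \<in> rel_interior T" "y = P x" by blast
      have "y \<in> S" using T ri_sub P_in by blast
      have "T' = T" if T': "T' \<in> \<T>" "y \<in> P ` rel_interior T'" for T'
      proof -
        obtain x' where x': "x' \<in> rel_interior T'" "y = P x'" using T' by blast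
        have "x \<in> Sh" "x' \<in> Sh" using ri_sub[OF T(1,2)] T(1) ri_sub[OF T'(1) x'(1)] T'(1) by auto
        then have "x' = x" using inj_onD[OF P_inj, of x' x] T(3) x'(2) by simp
        then show ?thesis using ri_unique[OF T(1,2) T'(1)] x'(1) by simp
      qed
      then have out: "y \<notin> P ` rel_interior T'" if "T' \<in> \<T>" "T' \<noteq> T" for T' using that by metis
      have "y \<in> P ` rel_interior T" using T by (metis imageI)
      then have "(\<Sum>T'\<in>\<T>. g y * indicator (P ` rel_interior T') y) = (\<Sum>T'\<in>\<T>. if T' = T then g y else 0)"
        using out by (intro sum.cong) simp_all
      then show ?thesis using T finT \<open>y \<in> S\<close> by simp
    next
      case False
      then have "(\<Sum>T\<in>\<T>. g y * indicator (P ` rel_interior T) y) = 0" by (intro sum.neutral) simp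
      then show ?thesis by (metis zero_le)
    qed
  qed
  finally show ?thesis by (simp add: mult_left_mono)
qed

text \<open>Null sets of \<open>S\<close> pull back to null sets of the polyhedral surface, by the pullback inequality for
  an indicator function.\<close>

lemma AE_pullback:
  assumes "AE y in surface_measure d S. Q y" shows "AE x in surface_measure d Sh. Q (P x)"
proof -
  have "AE y in H. y \<in> S \<longrightarrow> Q y" using assms surface_measure_AE[OF borel_S] by simp
  then obtain N where N: "N \<in> null_sets H" "\<And>y. y \<notin> N \<Longrightarrow> y \<in> S \<longrightarrow> Q y"
    by (elim AE_E3) (metis Diff_iff UNIV_I space_hausdorff)
  have le: "(\<integral>\<^sup>+x\<in>Sh. indicator N (P x) \<partial>H) \<le> ennreal (2 ^ d) * (\<integral>\<^sup>+y\<in>S. indicator N y \<partial>H)"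
    using N by (intro nn_integral_pullback) auto
  have "(\<integral>\<^sup>+y\<in>S. indicator N y \<partial>H) \<le> (\<integral>\<^sup>+y. indicator N y \<partial>H)"
    by (intro nn_integral_mono) (auto split: split_indicator)
  also have "(\<integral>\<^sup>+y. indicator N y \<partial>H) = 0"
    using N(1) by (subst nn_integral_indicator) (auto simp: null_sets_def)
  finally have "(\<integral>\<^sup>+y\<in>S. indicator N y \<partial>H) = 0" by simp
  with le have z: "(\<integral>\<^sup>+x\<in>Sh. indicator N (P x) \<partial>H) = 0" by simp
  have "(\<lambda>x. indicator N (P x)) \<in> borel_measurable (restrict_space borel Sh)"
    using N by (intro measurable_compose[OF borel_measurable_continuous_on_restrict[OF P_continuous]]) auto
  then have m: "(\<lambda>x. indicator N (P x) * indicator Sh x :: ennreal) \<in> borel_measurable borel"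
    using borel_Sh by (subst (asm) borel_measurable_restrict_space_iff_ennreal) auto
  then have "AE x in H. indicator N (P x) * indicator Sh x = (0 :: ennreal)"
    using z by (subst (asm) nn_integral_0_iff_AE) auto
  then have "AE x in H. x \<in> Sh \<longrightarrow> Q (P x)"
  proof (elim eventually_mono, intro impI)
    fix x assume "indicator N (P x) * indicator Sh x = (0 :: ennreal)" and x: "x \<in> Sh"
    then have "P x \<notin> N" by (auto split: split_indicator_asm)
    then show "Q (P x)" using N(2) P_in[OF x] by blast
  qed
  then show ?thesis using surface_measure_AE[OF borel_Sh] by simp
qed

text \<open>The function \<open>\<phi>\<close> is only measurable for the completed measure. Replace \<open>\<phi>\<close>
  by a Borel function equal almost everywhere, pull that back, and use that null sets pull back to null sets.\<close>

lemma surface_pullback: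
  assumes \<phi>: "\<phi> \<in> borel_measurable (surface_measure d S)"
  obtains \<psi> where "\<psi> \<in> borel_measurable (surface_measure d Sh)" "AE x in surface_measure d Sh. \<phi> (P x) = \<psi> x"
    "(\<integral>\<^sup>+x. \<psi> x \<partial>surface_measure d Sh) \<le> ennreal (2 ^ d) * (\<integral>\<^sup>+y. \<phi> y \<partial>surface_measure d S)"
proof -
  obtain g where g: "g \<in> borel_measurable (restrict_space H S)" and ae: "AE y in restrict_space H S. \<phi> y = (g y :: ennreal)"
    using completion_ex_borel_measurable \<phi> unfolding surface_measure_def by blast
  define g' where "g' y = g y * indicator S y" for y
  have g': "g' \<in> borel_measurable borel"
    using g borel_S unfolding g'_def by (subst (asm) borel_measurable_restrict_space_iff_ennreal) (auto cong: measurable_cong_sets)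
  have ae': "AE y in surface_measure d S. \<phi> y = g y" using ae unfolding surface_measure_def by (simp add: AE_completion_iff)
  show thesis
  proof (rule that[of "\<lambda>x. g' (P x)"])
    show "(\<lambda>x. g' (P x)) \<in> borel_measurable (surface_measure d Sh)"
      by (intro surface_measure_measurable measurable_compose[OF borel_measurable_continuous_on_restrict[OF P_continuous] g'])
    have "AE x in surface_measure d Sh. \<phi> (P x) = g (P x)" by (rule AE_pullback[OF ae'])
    then show "AE x in surface_measure d Sh. \<phi> (P x) = g' (P x)"
      using AE_space by eventually_elim (simp add: g'_def space_surface_measure P_in del: Union_iff)
    have "(\<integral>\<^sup>+x. g' (P x) \<partial>surface_measure d Sh) \<le> ennreal (2 ^ d) * (\<integral>\<^sup>+y\<in>S. g' y \<partial>H)"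
      using nn_integral_pullback[OF g'] surface_measure_nn_integral[OF borel_Sh] by simp
    also have "(\<integral>\<^sup>+y\<in>S. g' y \<partial>H) = (\<integral>\<^sup>+y. g' y \<partial>surface_measure d S)"
      using surface_measure_nn_integral[OF borel_S] by simp
    also have "\<dots> = (\<integral>\<^sup>+y. \<phi> y \<partial>surface_measure d S)"
    proof (rule nn_integral_cong_AE)
      show "AE y in surface_measure d S. g' y = \<phi> y"
        using ae' AE_space by eventually_elim (simp add: g'_def space_surface_measure)
    qed
    finally show "(\<integral>\<^sup>+x. g' (P x) \<partial>surface_measure d Sh) \<le> ennreal (2 ^ d) * (\<integral>\<^sup>+y. \<phi> y \<partial>surface_measure d S)" .
  qed
qed

definition energy :: "real \<Rightarrow> (nat \<Rightarrow> real) \<Rightarrow> real" where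
  "energy p a = (\<Sum>T\<in>\<T>. norm (simplex_gradient T (fe a)) powr p * measure H T)"

lemma energy_nonneg: "0 \<le> energy p a" unfolding energy_def by (intro sum_nonneg) auto

lemma energy_nn_integral:
  assumes "\<And>T x. T \<in> \<T> \<Longrightarrow> x \<in> rel_interior T \<Longrightarrow> g x = norm (simplex_gradient T (fe a)) powr p"
  shows "(\<integral>\<^sup>+x. ennreal (g x) \<partial>surface_measure d Sh) = ennreal (energy p a)"
proof -
  have eq: "ennreal (g x) * indicator (rel_interior T) x = ennreal (norm (simplex_gradient T (fe a)) powr p) * indicator (rel_interior T) x"
    if "T \<in> \<T>" for T x using assms[OF that] by (auto split: split_indicator)
  have "(\<integral>\<^sup>+x. ennreal (g x) \<partial>surface_measure d Sh) = (\<Sum>T\<in>\<T>. \<integral>\<^sup>+x\<in>rel_interior T. ennreal (g x) \<partial>H)"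
    unfolding surface_measure_nn_integral[OF borel_Sh] using eq borel_ri by (intro nn_integral_simplices) simp
  also have "\<dots> = (\<Sum>T\<in>\<T>. ennreal (norm (simplex_gradient T (fe a)) powr p) * emeasure H (rel_interior T))"
    using eq borel_ri by (intro sum.cong) (auto simp: nn_integral_cmult_indicator)
  also have "\<dots> = (\<Sum>T\<in>\<T>. ennreal (norm (simplex_gradient T (fe a)) powr p * measure H T))"
    using emeasure_ri emeasure_T by (intro sum.cong) (auto simp: ennreal_mult)
  also have "\<dots> = ennreal (energy p a)" unfolding energy_def by (intro sum_ennreal) auto
  finally show ?thesis .
qed

text \<open>The lift of \<open>fe a\<close> is Lipschitz on the image of \<open>T\<close> with twice the norm of the
  gradient as constant, and vanishes on the boundary of \<open>S\<close>. Its upper gradient counts several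
  simplices only on a null set. The constant does not depend on the mesh.\<close>

lemma discrete_poincare:
  assumes p: "1 < p" and C: "0 < C" "\<And>w G. boundary_zero_pair S w G \<Longrightarrow>
     (\<integral>\<^sup>+z\<in>S. ennreal (\<bar>w z\<bar> powr p) \<partial>H) \<le> ennreal C * (\<integral>\<^sup>+z\<in>S. ennreal (G z powr p) \<partial>H)"
    and a: "\<forall>j\<in>{n+1..nb}. a j = 0"
  shows "(\<integral>\<^sup>+x. ennreal (\<bar>fe a x\<bar> powr p) \<partial>surface_measure d Sh) \<le> ennreal (4 ^ d * C * 2 powr p * energy p a)"
proof -
  define Q where "Q = the_inv_into Sh P"
  have QP: "Q (P x) = x" if "x \<in> Sh" for x unfolding Q_def by (rule the_inv_into_f_f[OF P_inj that])
  define w where "w y = fe a (Q y)" for y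
  define c where "c T = 2 * norm (simplex_gradient T (fe a))" for T
  define G where "G y = (\<Sum>T\<in>\<T>. c T * indicator (P ` T) y)" for y
  have Sun: "S = (\<Union>T\<in>\<T>. P ` T)" using P_image by blast
  have wlip: "\<bar>w y - w y'\<bar> \<le> c T * dist y y'" if T: "T \<in> \<T>" and y: "y \<in> P ` T" "y' \<in> P ` T" for T y y'
  proof -
    obtain x x' where x: "x \<in> T" "y = P x" "x' \<in> T" "y' = P x'" using y by blast
    have "w y - w y' = simplex_gradient T (fe a) \<bullet> (x - x')"
    proof -
      have "Q (P x) = x" "Q (P x') = x'" using QP T x by (metis UnionI)+
      then show ?thesis using simplex_gradient_works[OF T fe_pl x(1,3)] x by (simp add: w_def)
    qed
    then have "\<bar>w y - w y'\<bar> \<le> norm (simplex_gradient T (fe a)) * norm (x - x')"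
      using Cauchy_Schwarz_ineq2 by simp
    also have "\<dots> \<le> norm (simplex_gradient T (fe a)) * (2 * dist y y')"
      using expand[OF T x(1,3)] x by (intro mult_left_mono) (auto simp: dist_norm)
    finally show ?thesis by (simp add: c_def mult_ac)
  qed
  have "boundary_zero_pair S w G"
    unfolding boundary_zero_pair_def
  proof (intro conjI ballI allI)
    have "continuous_on (\<Union>T\<in>\<T>. P ` T) w"
    proof (rule continuous_on_closed_Union[OF finT])
      fix T assume T: "T \<in> \<T>"
      show "closed (P ` T)" using compact_K[OF T] by (rule compact_imp_closed)
      have "(c T)-lipschitz_on (P ` T) w" using wlip[OF T] by (intro lipschitz_onI) (auto simp: dist_real_def c_def)
      then show "continuous_on (P ` T) w" by (rule lipschitz_on_continuous_on)
    qed
    then show "continuous_on S w" using Sun by simp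
    fix y assume "y \<in> surface_boundary S"
    then obtain x where x: "x \<in> poly_boundary \<T>" "y = P x" using P_boundary by blast
    have "fe a x = fe (\<lambda>_. 0) x" by (rule fe_eq_boundary[OF x(1)]) (use a in auto)
    moreover have "Q (P x) = x" using QP x(1) poly_boundary_sub by (metis subsetD)
    ultimately show "w y = 0" using x(2) by (simp add: w_def) (simp add: fe_def)
  next
    show "G \<in> borel_measurable borel" unfolding G_def using compact_K
      by (intro borel_measurable_sum borel_measurable_times borel_measurable_indicator) (auto simp: borel_compact)
    show "0 \<le> G x" for x unfolding G_def c_def by (intro sum_nonneg) auto
    show "upper_gradient S w G"
      unfolding G_def[abs_def]
    proof (rule upper_gradient_piecewise_lipschitz[OF finT])
      show "closed (P ` T)" if "T \<in> \<T>" for T using compact_K[OF that] by (rule compact_imp_closed)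
      show "S \<subseteq> (\<Union>T\<in>\<T>. P ` T)" using Sun by simp
      show "0 \<le> c T" for T by (simp add: c_def)
      show "\<bar>w x - w y\<bar> \<le> c T * dist x y" if "T \<in> \<T>" "x \<in> P ` T" "y \<in> P ` T" for T x y using wlip[OF that] .
    qed
  qed
  from C(2)[OF this] have PI: "(\<integral>\<^sup>+z\<in>S. ennreal (\<bar>w z\<bar> powr p) \<partial>H) \<le> ennreal C * (\<integral>\<^sup>+z\<in>S. ennreal (G z powr p) \<partial>H)" .
  have "(\<integral>\<^sup>+z\<in>S. ennreal (G z powr p) \<partial>H) \<le> (\<integral>\<^sup>+z. (\<Sum>T\<in>\<T>. ennreal (c T powr p) * indicator (P ` T) z) \<partial>H)"
  proof (rule nn_integral_mono_AE, use AE_open_image in \<open>elim eventually_mono\<close>)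
    fix y assume y: "y \<in> S \<longrightarrow> (\<exists>T\<in>\<T>. y \<in> P ` rel_interior T)"
    show "ennreal (G y powr p) * indicator S y \<le> (\<Sum>T\<in>\<T>. ennreal (c T powr p) * indicator (P ` T) y)"
    proof (cases "y \<in> S")
      case True
      then obtain T x where T: "T \<in> \<T>" "x \<in> rel_interior T" "y = P x" using y by blast
      have un: "T' = T" if T': "T' \<in> \<T>" "y \<in> P ` T'" for T'
      proof -
        obtain x' where x': "x' \<in> T'" "y = P x'" using T' by blast
        have "x \<in> Sh" "x' \<in> Sh" using ri_sub[OF T(1,2)] T(1) x'(1) T'(1) by auto
        then have "x' = x" using inj_onD[OF P_inj, of x' x] T(3) x'(2) by simp
        then show ?thesis using ri_subset_eq[OF T(1,2) T'(1)] x'(1) by simp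
      qed
      have yT: "y \<in> P ` T" using T(3) ri_sub[OF T(1,2)] by (metis imageI)
      have out: "y \<notin> P ` T'" if "T' \<in> \<T>" "T' \<noteq> T" for T' using that un by metis
      have "G y = (\<Sum>T'\<in>\<T>. if T' = T then c T else 0)"
        unfolding G_def using out yT by (intro sum.cong) simp_all
      also have "\<dots> = c T" using finT T by simp
      finally have "ennreal (G y powr p) = ennreal (c T powr p) * indicator (P ` T) y" using yT by simp
      also have "\<dots> \<le> (\<Sum>T\<in>\<T>. ennreal (c T powr p) * indicator (P ` T) y)"
        using finT T(1) by (intro member_le_sum) auto
      finally show ?thesis using True by simp
    qed simp
  qed
  also have "\<dots> = (\<Sum>T\<in>\<T>. ennreal (c T powr p) * emeasure H (P ` T))"
  proof -
    have "P ` T \<in> sets H" if "T \<in> \<T>" for T using borel_compact[OF compact_K[OF that]] by simp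
    then show ?thesis by (subst nn_integral_sum) (simp_all add: nn_integral_cmult_indicator)
  qed
  also have "\<dots> \<le> (\<Sum>T\<in>\<T>. ennreal (c T powr p) * (ennreal (2 ^ d) * ennreal (measure H T)))"
    using emeasure_K emeasure_T by (intro sum_mono mult_left_mono) auto
  also have "\<dots> = (\<Sum>T\<in>\<T>. ennreal (2 ^ d * 2 powr p * (norm (simplex_gradient T (fe a)) powr p * measure H T)))"
    by (intro sum.cong) (auto simp: c_def powr_mult ennreal_mult[symmetric] mult_ac)
  also have "\<dots> = ennreal (2 ^ d * 2 powr p * energy p a)"
    unfolding energy_def by (subst sum_ennreal) (auto simp: sum_distrib_left)
  finally have GI: "(\<integral>\<^sup>+z\<in>S. ennreal (G z powr p) \<partial>H) \<le> ennreal (2 ^ d * 2 powr p * energy p a)" .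
  define g where "g y = ennreal (\<bar>w y\<bar> powr p) * indicator S y" for y
  have g: "g \<in> borel_measurable borel"
  proof -
    have "continuous_on S w" using \<open>boundary_zero_pair S w G\<close> by (simp add: boundary_zero_pair_def)
    then have "w \<in> borel_measurable (restrict_space borel S)" by (rule borel_measurable_continuous_on_restrict)
    then have "(\<lambda>z. ennreal (\<bar>w z\<bar> powr p)) \<in> borel_measurable (restrict_space borel S)" by measurable
    then show ?thesis unfolding g_def using borel_S by (subst (asm) borel_measurable_restrict_space_iff_ennreal) auto
  qed
  have "(\<integral>\<^sup>+x. ennreal (\<bar>fe a x\<bar> powr p) \<partial>surface_measure d Sh) = (\<integral>\<^sup>+x\<in>Sh. g (P x) \<partial>H)"
    unfolding surface_measure_nn_integral[OF borel_Sh]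
    using QP P_in by (intro nn_integral_cong) (auto simp: g_def w_def split: split_indicator)
  also have "\<dots> \<le> ennreal (2 ^ d) * (\<integral>\<^sup>+y\<in>S. g y \<partial>H)" by (rule nn_integral_pullback[OF g])
  also have "(\<integral>\<^sup>+y\<in>S. g y \<partial>H) = (\<integral>\<^sup>+z\<in>S. ennreal (\<bar>w z\<bar> powr p) \<partial>H)"
    by (intro nn_integral_cong) (auto simp: g_def split: split_indicator)
  also have "ennreal (2 ^ d) * \<dots> \<le> ennreal (2 ^ d) * (ennreal C * ennreal (2 ^ d * 2 powr p * energy p a))"
    by (intro mult_left_mono order_trans[OF PI] mult_left_mono GI) auto
  also have "\<dots> = ennreal (4 ^ d * C * 2 powr p * energy p a)"
  proof -
    have "(4::real) ^ d = 2 ^ d * 2 ^ d" by (simp flip: power_mult_distrib)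
    then show ?thesis using C(1) energy_nonneg by (simp add: ennreal_mult[symmetric] mult_ac)
  qed
  finally show ?thesis .
qed

end

section \<open>Splitting a discrete function at a level\<close>

text \<open>Young inequality with the constants in the form needed for absorbing the first term. Compare \<open>x\<close>
  with \<open>\<eta> y\<^bsup>p-1\<^esup>\<close>: if it is smaller, the first term suffices, otherwise the
  second.\<close>

lemma young_absorbed:
  fixes x y \<eta> p :: real
  assumes p: "1 < p" and \<eta>: "0 < \<eta>" and xy: "0 \<le> x" "0 \<le> y"
  shows "x * y \<le> \<eta> * y powr p + \<eta> powr (- 1 / (p - 1)) * x powr (p / (p - 1))"
proof (cases "x \<le> \<eta> * y powr (p - 1)")
  case True
  then have "x * y \<le> \<eta> * y powr (p - 1) * y" using xy by (intro mult_right_mono)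
  also have "y powr (p - 1) * y = y powr p" using xy p by (cases "y = 0") (auto simp: powr_diff)
  then have "\<eta> * y powr (p - 1) * y = \<eta> * y powr p" by (simp add: mult.assoc)
  finally have "x * y \<le> \<eta> * y powr p" .
  moreover have "0 \<le> \<eta> powr (- 1 / (p - 1)) * x powr (p / (p - 1))" by simp
  ultimately show ?thesis by linarith
next
  case False
  then have lt: "y powr (p - 1) < x / \<eta>" using \<eta> by (simp add: field_simps)
  have x0: "0 < x" using False \<eta> xy by (smt (verit) mult_nonneg_nonneg powr_ge_zero)
  have "y = (y powr (p - 1)) powr (1 / (p - 1))" using p xy by (simp add: powr_powr)
  also have "\<dots> \<le> (x / \<eta>) powr (1 / (p - 1))" using lt p by (intro powr_mono2) auto
  finally have "x * y \<le> x * (x / \<eta>) powr (1 / (p - 1))" using x0 by simp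
  also have "(x / \<eta>) powr (1 / (p - 1)) = x powr (1 / (p - 1)) * \<eta> powr (- 1 / (p - 1))"
    using x0 \<eta> by (simp add: powr_divide powr_minus_divide)
  also have "x * (x powr (1 / (p - 1)) * \<eta> powr (- 1 / (p - 1))) = \<eta> powr (- 1 / (p - 1)) * x powr (p / (p - 1))"
  proof -
    have "x * x powr (1 / (p - 1)) = x powr (1 + 1 / (p - 1))" using x0 by (simp add: powr_add)
    also have "1 + 1 / (p - 1) = p / (p - 1)" using p by (simp add: field_simps)
    finally show ?thesis by (simp add: mult_ac)
  qed
  finally show ?thesis using \<eta> by (smt (verit) mult_nonneg_nonneg powr_ge_zero)
qed

text \<open>Used for the gradients of the parts above and below a level, whose difference is the gradient of the whole
  function.\<close>

lemma obtuse_difference: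
  fixes x y :: "'a::real_inner"
  assumes "x \<bullet> y \<le> 0"
  shows "(norm x)\<^sup>2 \<le> (x - y) \<bullet> x" "norm x \<le> norm (x - y)"
proof -
  show 1: "(norm x)\<^sup>2 \<le> (x - y) \<bullet> x"
    unfolding inner_diff_left inner_commute[of y x] using assms by (simp add: dot_square_norm)
  have "(norm x)\<^sup>2 \<le> norm (x - y) * norm x" using 1 Cauchy_Schwarz_ineq2[of "x - y" x] by linarith
  then show "norm x \<le> norm (x - y)" by (cases "x = 0") (auto simp: power2_eq_square)
qed

definition nodal_above :: "(nat \<Rightarrow> real) \<Rightarrow> real \<Rightarrow> nat \<Rightarrow> real" where "nodal_above a K j = max 0 (a j - K)"
definition nodal_below :: "(nat \<Rightarrow> real) \<Rightarrow> real \<Rightarrow> nat \<Rightarrow> real" where "nodal_below a K j = max 0 (K - a j)"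

context simplicial_mesh
begin

text \<open>Subtracting the level changes nothing since the gradients of the hat functions add up to zero.\<close>

lemma cut_gradient:
  assumes T: "T \<in> \<T>"
  shows "simplex_gradient T (fe a) = simplex_gradient T (fe (nodal_above a K)) - simplex_gradient T (fe (nodal_below a K))"
proof -
  have "(\<Sum>j=1..nb. a j *\<^sub>R grad T j) = (\<Sum>j=1..nb. (nodal_above a K j - nodal_below a K j) *\<^sub>R grad T j) + K *\<^sub>R (\<Sum>j=1..nb. grad T j)"
    unfolding scaleR_sum_right sum.distrib[symmetric] scaleR_left_distrib[symmetric]
    by (intro sum.cong) (auto simp: nodal_above_def nodal_below_def max_def)
  then show ?thesis
    unfolding simplex_gradient_fe[OF T] grad_sum[OF T] by (simp add: scaleR_left_diff_distrib sum_subtractf)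
qed

lemma simplex_gradient_idx:
  assumes T: "T \<in> \<T>" shows "simplex_gradient T (fe a) = (\<Sum>j\<in>idx T. a j *\<^sub>R grad T j)"
  unfolding simplex_gradient_fe[OF T]
  by (rule sum.mono_neutral_right) (use grad_zero[OF T] idx_sub in auto)

text \<open>No vertex is both above and below \<open>K\<close>, so only products of different hat functions occur. The
  hypothesis on the boundary values ensures that one of the two parts lives on interior vertices, where the
  angle condition applies.\<close>

lemma cut_product:
  assumes T: "T \<in> \<T>" and s: "0 \<le> s"
    and acute: "\<And>i j. i \<in> idx T \<Longrightarrow> i \<le> n \<Longrightarrow> j \<in> idx T \<Longrightarrow> i \<noteq> j \<Longrightarrow> grad T i \<bullet> grad T j \<le> - s"
    and bd: "(\<forall>j\<in>{n+1..nb}. a j \<le> K) \<or> (\<forall>j\<in>{n+1..nb}. K \<le> a j)"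
  shows "simplex_gradient T (fe (nodal_above a K)) \<bullet> simplex_gradient T (fe (nodal_below a K))
     \<le> - s * (\<Sum>i\<in>idx T. nodal_above a K i) * (\<Sum>j\<in>idx T. nodal_below a K j)"
proof -
  have "simplex_gradient T (fe (nodal_above a K)) \<bullet> simplex_gradient T (fe (nodal_below a K))
     = (\<Sum>i\<in>idx T. \<Sum>j\<in>idx T. nodal_above a K i * nodal_below a K j * (grad T i \<bullet> grad T j))"
    unfolding simplex_gradient_idx[OF T]
    by (simp only: inner_sum_left, simp only: inner_sum_right)
      (intro sum.cong refl, simp)
  also have "\<dots> \<le> (\<Sum>i\<in>idx T. \<Sum>j\<in>idx T. nodal_above a K i * nodal_below a K j * (- s))"
  proof (intro sum_mono)
    fix i j assume ij: "i \<in> idx T" "j \<in> idx T"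
    show "nodal_above a K i * nodal_below a K j * (grad T i \<bullet> grad T j) \<le> nodal_above a K i * nodal_below a K j * (- s)"
    proof (cases "K < a i \<and> a j < K")
      case True
      then have "i \<noteq> j" by auto
      have "i \<le> n \<or> j \<le> n"
      proof (rule ccontr)
        assume "\<not> (i \<le> n \<or> j \<le> n)"
        then have "i \<in> {n+1..nb}" "j \<in> {n+1..nb}" using ij by (auto simp: idx_def)
        then have "a i \<le> K \<or> K \<le> a j" using bd by blast
        then show False using True by linarith
      qed
      then have "grad T i \<bullet> grad T j \<le> - s"
        using acute[of i j] acute[of j i] ij \<open>i \<noteq> j\<close> by (auto simp: inner_commute)
      then show ?thesis by (intro mult_left_mono) (auto simp: nodal_above_def nodal_below_def)
    qed (auto simp: nodal_above_def nodal_below_def)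
  qed
  also have "\<dots> = - s * (\<Sum>i\<in>idx T. nodal_above a K i) * (\<Sum>j\<in>idx T. nodal_below a K j)"
    by (simp add: sum_product sum_distrib_left mult_ac)
  finally show ?thesis .
qed

lemma card_idx: assumes "T \<in> \<T>" shows "card (idx T) = d + 1"
proof -
  obtain C where C: "\<not> affine_dependent C" "int (card C) = int d + 1" "T = convex hull C"
    using simp[OF assms] unfolding simplex_def by blast
  then have "B ` idx T = C" using extreme_eq[OF assms] extreme_point_of_convex_hull_affine_independent by blast
  moreover have "inj_on B (idx T)" using inj idx_sub by (rule inj_on_subset)
  ultimately show ?thesis using C(2) card_image by force
qed

end

section \<open>Energy bound and lower bound for a discrete solution\<close>

text \<open>The equation is required for coefficient vectors rather than for test functions, and the angle condition for
  gradients on single simplices; the Poincare constant \<open>C\<close> is a parameter because it must not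
  depend on the mesh.\<close>

locale discrete_problem = lifted_mesh d \<T> B n nb S P
  for d and \<T> :: "'a::euclidean_space set set" and B n nb S P +
  fixes b :: "'a \<Rightarrow> real \<Rightarrow> 'a \<Rightarrow> real" and q :: "'a \<Rightarrow> real \<Rightarrow> real" and f :: "'a \<Rightarrow> real"
    and u :: "nat \<Rightarrow> real" and p \<mu>0 \<mu>1 s C :: real
  assumes p: "2 \<le> p" and \<mu>: "0 < \<mu>0" "0 < \<mu>1"
    and b_cont: "continuous_on (S \<times> UNIV \<times> UNIV) (\<lambda>(x, z, \<xi>). b x z \<xi>)"
    and q_cont: "continuous_on (S \<times> UNIV) (\<lambda>(x, z). q x z)"
    and b_lower: "\<And>x z \<xi>. x \<in> S \<Longrightarrow> \<mu>0 + \<mu>1 * rpow (norm \<xi>) (p - 2) \<le> b x z \<xi>"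
    and q_neg: "\<And>x z. x \<in> S \<Longrightarrow> z \<le> 0 \<Longrightarrow> q x z = q x 0"
    and q_pos: "\<And>x z. x \<in> S \<Longrightarrow> 0 \<le> z \<Longrightarrow> 0 \<le> q x z - q x 0"
    and s: "0 \<le> s"
    and acute: "\<And>T i j. T \<in> \<T> \<Longrightarrow> i \<in> idx T \<Longrightarrow> i \<le> n \<Longrightarrow> j \<in> idx T \<Longrightarrow> i \<noteq> j \<Longrightarrow> grad T i \<bullet> grad T j \<le> - s"
    and C0: "0 < C"
    and poincare: "\<And>w G. boundary_zero_pair S w G \<Longrightarrow>
       (\<integral>\<^sup>+z\<in>S. ennreal (\<bar>w z\<bar> powr p) \<partial>hausdorff_measure d) \<le> ennreal C * (\<integral>\<^sup>+z\<in>S. ennreal (G z powr p) \<partial>hausdorff_measure d)"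
    and solution: "\<And>a. \<forall>j\<in>{n+1..nb}. a j = 0 \<Longrightarrow>
       (LINT x|surface_measure d (\<Union>\<T>). b (P x) (fe u x) (surface_gradient \<T> (fe u) x) *
            (surface_gradient \<T> (fe u) x \<bullet> surface_gradient \<T> (fe a) x) + (q (P x) (fe u x) - q (P x) 0) * fe a x)
       = (LINT x|surface_measure d (\<Union>\<T>). (f (P x) - q (P x) 0) * fe a x)"
begin

abbreviation "\<sigma> \<equiv> surface_measure d (\<Union>\<T>) :: 'a measure"

definition integrand :: "(nat \<Rightarrow> real) \<Rightarrow> 'a \<Rightarrow> real" where
  "integrand a x = b (P x) (fe u x) (surface_gradient \<T> (fe u) x) *
     (surface_gradient \<T> (fe u) x \<bullet> surface_gradient \<T> (fe a) x) + (q (P x) (fe u x) - q (P x) 0) * fe a x"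

lemma integrand_simplex:
  assumes "T \<in> \<T>" "x \<in> rel_interior T"
  shows "integrand a x = b (P x) (fe u x) (simplex_gradient T (fe u)) *
     (simplex_gradient T (fe u) \<bullet> simplex_gradient T (fe a)) + (q (P x) (fe u x) - q (P x) 0) * fe a x"
  unfolding integrand_def surface_gradient_simplex[OF assms] ..

lemma q_cont_Sh: "continuous_on Sh (\<lambda>x. (q (P x) (fe u x) - q (P x) 0) * fe a x)"
proof -
  have "continuous_on Sh (\<lambda>x. (\<lambda>(x, z). q x z) (P x, fe u x))"
    by (rule continuous_on_compose2[OF q_cont]) (use P_in in \<open>auto intro!: continuous_intros P_continuous fe_continuous\<close>)
  moreover have "continuous_on Sh (\<lambda>x. (\<lambda>(x, z). q x z) (P x, 0))"
    by (rule continuous_on_compose2[OF q_cont]) (use P_in in \<open>auto intro!: continuous_intros P_continuous\<close>)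
  ultimately show ?thesis by (auto intro!: continuous_intros fe_continuous)
qed

lemma integrand_integrable: "integrable \<sigma> (integrand a)"
proof (rule integrable_piecewise_continuous)
  fix T assume T: "T \<in> \<T>"
  then have TS: "T \<subseteq> Sh" by blast
  have "continuous_on T (\<lambda>x. (\<lambda>(x, z, \<xi>). b x z \<xi>) (P x, fe u x, simplex_gradient T (fe u)))"
  proof (rule continuous_on_compose2[OF b_cont])
    show "continuous_on T (\<lambda>x. (P x, fe u x, simplex_gradient T (fe u)))"
      by (intro continuous_intros P_continuous_T[OF T] continuous_on_subset[OF fe_continuous TS])
    show "(\<lambda>x. (P x, fe u x, simplex_gradient T (fe u))) ` T \<subseteq> S \<times> UNIV \<times> UNIV"
    proof -
      have "P x \<in> S" if "x \<in> T" for x using P_in[of x] TS that by blast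
      then show ?thesis by auto
    qed
  qed
  then have "continuous_on T (\<lambda>x. b (P x) (fe u x) (simplex_gradient T (fe u)))" by simp
  then show "continuous_on T (\<lambda>x. b (P x) (fe u x) (simplex_gradient T (fe u)) *
     (simplex_gradient T (fe u) \<bullet> simplex_gradient T (fe a)) + (q (P x) (fe u x) - q (P x) 0) * fe a x)"
    by (intro continuous_intros continuous_on_subset[OF q_cont_Sh TS])
next
  fix x assume "x \<in> Sh" and "\<And>T. T \<in> \<T> \<Longrightarrow> x \<notin> rel_interior T"
  then have "x \<notin> open_simplices \<T>" by (auto simp: open_simplices_def)
  then show "integrand a x = (q (P x) (fe u x) - q (P x) 0) * fe a x"
    by (simp add: integrand_def surface_gradient_def)
qed (rule integrand_simplex q_cont_Sh; assumption)+

lemma AE_simplex: "AE x in \<sigma>. \<exists>T\<in>\<T>. x \<in> rel_interior T"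
  using AE_open_simplex surface_measure_AE[OF borel_Sh] by blast

lemma q_diff_nonneg: "x \<in> S \<Longrightarrow> 0 \<le> q x z - q x 0" using q_neg[of x z] q_pos[of x z] by (cases "z \<le> 0") auto

lemma fe_nonneg: "x \<in> Sh \<Longrightarrow> (\<And>i. 0 \<le> a i) \<Longrightarrow> 0 \<le> fe a x" using fe_ge by blast

text \<open>The case \<open>p = 2\<close> is separate because there the growth factor is 1 even where the gradient
  \<open>v\<close> vanishes.\<close>

lemma coercive:
  assumes "norm w \<le> norm v"
  shows "norm w powr p \<le> rpow (norm v) (p - 2) * (norm w)\<^sup>2"
proof (cases "w = 0 \<or> p = 2")
  case True then show ?thesis by (auto simp: rpow_def)
next
  case False
  have "norm w powr p = norm w powr ((p - 2) + 2)" by simp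
  also have "\<dots> = norm w powr (p - 2) * norm w powr 2" by (rule powr_add)
  also have "\<dots> \<le> norm v powr (p - 2) * (norm w)\<^sup>2"
    using assms p by (auto intro!: mult_mono powr_mono2)
  finally show ?thesis using False by (simp add: rpow_def)
qed

text \<open>Test functions built from values above \<open>K\<close> are nonnegative, so the reaction helps; the negative
  product of the two parts of the gradient helps as well.\<close>

lemma integrand_above:
  assumes K: "\<forall>j\<in>{n+1..nb}. u j \<le> K" and T: "T \<in> \<T>" "x \<in> rel_interior T"
  shows "\<mu>1 * norm (simplex_gradient T (fe (nodal_above u K))) powr p \<le> integrand (nodal_above u K) x"
proof -
  let ?g = "simplex_gradient T (fe u)" and ?gp = "simplex_gradient T (fe (nodal_above u K))"
    and ?gm = "simplex_gradient T (fe (nodal_below u K))"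
  have x: "x \<in> Sh" "P x \<in> S" using ri_sub[OF T] T(1) P_in by blast+
  have "?gp \<bullet> ?gm \<le> - s * (\<Sum>i\<in>idx T. nodal_above u K i) * (\<Sum>j\<in>idx T. nodal_below u K j)"
    using K by (intro cut_product T s acute) auto
  also have "\<dots> \<le> 0" using s by (auto intro!: mult_nonneg_nonneg sum_nonneg simp: nodal_above_def nodal_below_def)
  finally have neg: "?gp \<bullet> ?gm \<le> 0" .
  have g: "?g = ?gp - ?gm" by (rule cut_gradient[OF T(1)])
  have 1: "(norm ?gp)\<^sup>2 \<le> ?g \<bullet> ?gp" and 2: "norm ?gp \<le> norm ?g"
    unfolding g using obtuse_difference[OF neg] by auto
  have r0: "0 \<le> rpow (norm ?g) (p - 2)" by (simp add: rpow_def)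
  have "\<mu>1 * norm ?gp powr p \<le> \<mu>1 * (rpow (norm ?g) (p - 2) * (norm ?gp)\<^sup>2)"
    using coercive[OF 2] \<mu> by (intro mult_left_mono) auto
  also have "\<dots> \<le> b (P x) (fe u x) ?g * (norm ?gp)\<^sup>2"
    using b_lower[OF x(2), of ?g "fe u x"] \<mu> by (simp add: mult.assoc[symmetric] mult_right_mono)
  also have "\<dots> \<le> b (P x) (fe u x) ?g * (?g \<bullet> ?gp)"
  proof (rule mult_left_mono[OF 1])
    have "0 \<le> \<mu>0 + \<mu>1 * rpow (norm ?g) (p - 2)" using \<mu> r0 by simp
    then show "0 \<le> b (P x) (fe u x) ?g" using b_lower[OF x(2), of ?g "fe u x"] by linarith
  qed
  also have "\<dots> \<le> integrand (nodal_above u K) x"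
    unfolding integrand_simplex[OF T]
    using q_diff_nonneg[OF x(2), of "fe u x"] fe_nonneg[OF x(1), of "nodal_above u K"] by (simp add: nodal_above_def)
  finally show ?thesis .
qed

text \<open>By \<open>integrand_above\<close> the left side of the equation dominates \<open>\<mu>1\<close> times the
  energy. On the right, \<open>\<eta>\<close> is chosen so that the Poincare inequality turns the first term of
  Young's inequality into half of this. If the source is not integrable against the test function, the integral
  is zero and there is nothing to estimate.\<close>

lemma upper_energy_bound:
  fixes F0 :: real
  assumes K: "\<forall>j\<in>{n+1..nb}. u j \<le> K" "0 \<le> K"
    and f_meas: "(\<lambda>y. f y - q y 0) \<in> borel_measurable (surface_measure d S)"
    and F0: "0 \<le> F0" "(\<integral>\<^sup>+y. ennreal (\<bar>f y - q y 0\<bar> powr (p / (p - 1))) \<partial>surface_measure d S) \<le> ennreal F0"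
  shows "energy p (nodal_above u K) \<le> 2 * (\<mu>1 / (2 * (4 ^ d * C * 2 powr p))) powr (- 1 / (p - 1)) * 2 ^ d * F0 / \<mu>1"
proof -
  \<comment> \<open>\<open>\<kappa>\<close> is the Poincare constant on the polyhedral surface; \<open>\<eta> \<kappa>\<close> is half of \<open>\<mu>1\<close>\<close>
  define v where "v = nodal_above u K"
  define \<kappa> where "\<kappa> = 4 ^ d * C * 2 powr p"
  define \<eta> where "\<eta> = \<mu>1 / (2 * \<kappa>)"
  define c\<eta> where "c\<eta> = \<eta> powr (- 1 / (p - 1))"
  define E where "E = energy p v"
  define \<phi> where "\<phi> y = ennreal (\<bar>f y - q y 0\<bar> powr (p / (p - 1)))" for y
  have pos: "0 < \<kappa>" "0 < \<eta>" "0 < c\<eta>" using C0 \<mu> by (auto simp: \<kappa>_def \<eta>_def c\<eta>_def)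
  have E0: "0 \<le> E" unfolding E_def by (rule energy_nonneg)
  have v0: "\<forall>j\<in>{n+1..nb}. v j = 0" using K(1) by (auto simp: v_def nodal_above_def)
  have \<phi>m: "\<phi> \<in> borel_measurable (surface_measure d S)" using f_meas unfolding \<phi>_def by measurable
  obtain \<psi> where \<psi>: "\<psi> \<in> borel_measurable \<sigma>" "AE x in \<sigma>. \<phi> (P x) = \<psi> x"
    "(\<integral>\<^sup>+x. \<psi> x \<partial>\<sigma>) \<le> ennreal (2 ^ d) * (\<integral>\<^sup>+y. \<phi> y \<partial>surface_measure d S)"
    using surface_pullback[OF \<phi>m] by blast
  have vm: "(\<lambda>x. ennreal (\<bar>fe v x\<bar> powr p)) \<in> borel_measurable \<sigma>"
  proof -
    have "fe v \<in> borel_measurable \<sigma>"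
      by (intro surface_measure_measurable borel_measurable_continuous_on_restrict fe_continuous)
    then show ?thesis by measurable
  qed
  let ?R = "LINT x|\<sigma>. (f (P x) - q (P x) 0) * fe v x"
  have "ennreal (\<mu>1 * E) = (\<integral>\<^sup>+x. ennreal \<mu>1 * ennreal (norm (surface_gradient \<T> (fe v) x) powr p) \<partial>\<sigma>)"
  proof -
    have m: "(\<lambda>x. ennreal (norm (surface_gradient \<T> (fe v) x) powr p)) \<in> borel_measurable \<sigma>"
    proof -
      have "integrable \<sigma> (\<lambda>x. norm (surface_gradient \<T> (fe v) x) powr p)"
      proof (rule integrable_piecewise_continuous)
        fix T x assume "T \<in> \<T>" "x \<in> rel_interior T"
        then show "norm (surface_gradient \<T> (fe v) x) powr p = norm (simplex_gradient T (fe v)) powr p"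
          by (simp add: surface_gradient_simplex)
      next
        fix x assume "\<And>T. T \<in> \<T> \<Longrightarrow> x \<notin> rel_interior T"
        then have "x \<notin> open_simplices \<T>" by (auto simp: open_simplices_def)
        then show "norm (surface_gradient \<T> (fe v) x) powr p = 0" by (simp add: surface_gradient_def)
      qed auto
      then have "(\<lambda>x. norm (surface_gradient \<T> (fe v) x) powr p) \<in> borel_measurable \<sigma>" by (rule borel_measurable_integrable)
      then show ?thesis by measurable
    qed
    have "(\<integral>\<^sup>+x. ennreal (norm (surface_gradient \<T> (fe v) x) powr p) \<partial>\<sigma>) = ennreal E"
      unfolding E_def by (rule energy_nn_integral) (simp add: surface_gradient_simplex)
    then show ?thesis using m \<mu> E0 by (simp add: nn_integral_cmult ennreal_mult)
  qed
  also have "\<dots> \<le> (\<integral>\<^sup>+x. ennreal (integrand v x) \<partial>\<sigma>)"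
  proof (rule nn_integral_mono_AE, use AE_simplex in \<open>elim eventually_mono\<close>)
    fix x assume "\<exists>T\<in>\<T>. x \<in> rel_interior T"
    then obtain T where T: "T \<in> \<T>" "x \<in> rel_interior T" by blast
    have "\<mu>1 * norm (surface_gradient \<T> (fe v) x) powr p \<le> integrand v x"
      using integrand_above[OF K(1) T] by (simp add: v_def surface_gradient_simplex[OF T])
    then show "ennreal \<mu>1 * ennreal (norm (surface_gradient \<T> (fe v) x) powr p) \<le> ennreal (integrand v x)"
      using \<mu> by (simp add: ennreal_mult'[symmetric] ennreal_leI)
  qed
  also have "\<dots> = ennreal (LINT x|\<sigma>. integrand v x)"
  proof (rule nn_integral_eq_integral[OF integrand_integrable], use AE_simplex in \<open>elim eventually_mono\<close>)
    fix x assume "\<exists>T\<in>\<T>. x \<in> rel_interior T"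
    then obtain T where T: "T \<in> \<T>" "x \<in> rel_interior T" by blast
    have "0 \<le> \<mu>1 * norm (simplex_gradient T (fe v)) powr p" using \<mu> by simp
    then show "0 \<le> integrand v x" using integrand_above[OF K(1) T] by (simp add: v_def)
  qed
  also have "(LINT x|\<sigma>. integrand v x) = ?R" using solution[OF v0] unfolding integrand_def .
  also have "ennreal ?R \<le> (\<integral>\<^sup>+x. ennreal \<bar>(f (P x) - q (P x) 0) * fe v x\<bar> \<partial>\<sigma>)"
  proof (cases "integrable \<sigma> (\<lambda>x. (f (P x) - q (P x) 0) * fe v x)")
    case True
    have "ennreal ?R \<le> ennreal (norm ?R)" by (intro ennreal_leI) simp
    also have "\<dots> \<le> (\<integral>\<^sup>+x. ennreal (norm ((f (P x) - q (P x) 0) * fe v x)) \<partial>\<sigma>)" by (rule integral_norm_bound_ennreal[OF True])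
    finally show ?thesis by simp
  next
    case False then show ?thesis by (simp add: not_integrable_integral_eq)
  qed
  also have "\<dots> \<le> (\<integral>\<^sup>+x. ennreal \<eta> * ennreal (\<bar>fe v x\<bar> powr p) + ennreal c\<eta> * \<psi> x \<partial>\<sigma>)"
  proof (rule nn_integral_mono_AE, use \<psi>(2) in \<open>elim eventually_mono\<close>)
    fix x assume eq: "\<phi> (P x) = \<psi> x"
    have "\<bar>(f (P x) - q (P x) 0) * fe v x\<bar> \<le> \<eta> * \<bar>fe v x\<bar> powr p + c\<eta> * \<bar>f (P x) - q (P x) 0\<bar> powr (p / (p - 1))"
      unfolding abs_mult c\<eta>_def using p pos by (intro young_absorbed) auto
    then have "ennreal \<bar>(f (P x) - q (P x) 0) * fe v x\<bar> \<le> ennreal (\<eta> * \<bar>fe v x\<bar> powr p + c\<eta> * \<bar>f (P x) - q (P x) 0\<bar> powr (p / (p - 1)))"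
      by (rule ennreal_leI)
    also have "\<dots> = ennreal \<eta> * ennreal (\<bar>fe v x\<bar> powr p) + ennreal c\<eta> * \<phi> (P x)"
      using pos by (simp add: \<phi>_def ennreal_mult' ennreal_plus)
    finally show "ennreal \<bar>(f (P x) - q (P x) 0) * fe v x\<bar> \<le> ennreal \<eta> * ennreal (\<bar>fe v x\<bar> powr p) + ennreal c\<eta> * \<psi> x"
      using eq by simp
  qed
  also have "\<dots> = ennreal \<eta> * (\<integral>\<^sup>+x. ennreal (\<bar>fe v x\<bar> powr p) \<partial>\<sigma>) + ennreal c\<eta> * (\<integral>\<^sup>+x. \<psi> x \<partial>\<sigma>)"
    using vm \<psi>(1) by (simp add: nn_integral_add nn_integral_cmult)
  also have "\<dots> \<le> ennreal \<eta> * ennreal (\<kappa> * E) + ennreal c\<eta> * (ennreal (2 ^ d) * ennreal F0)"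
  proof (intro add_mono mult_left_mono)
    show "(\<integral>\<^sup>+x. ennreal (\<bar>fe v x\<bar> powr p) \<partial>\<sigma>) \<le> ennreal (\<kappa> * E)"
      unfolding \<kappa>_def E_def using p by (intro discrete_poincare[OF _ C0 poincare v0]) auto
    have "(\<integral>\<^sup>+x. \<psi> x \<partial>\<sigma>) \<le> ennreal (2 ^ d) * (\<integral>\<^sup>+y. \<phi> y \<partial>surface_measure d S)" by (rule \<psi>(3))
    also have "\<dots> \<le> ennreal (2 ^ d) * ennreal F0" using F0(2) unfolding \<phi>_def by (rule mult_left_mono) simp
    finally show "(\<integral>\<^sup>+x. \<psi> x \<partial>\<sigma>) \<le> ennreal (2 ^ d) * ennreal F0" .
  qed auto
  also have "\<dots> = ennreal (\<eta> * (\<kappa> * E) + c\<eta> * (2 ^ d * F0))"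
    using pos E0 F0(1) by (simp add: ennreal_mult[symmetric] ennreal_plus)
  finally have "\<mu>1 * E \<le> \<eta> * (\<kappa> * E) + c\<eta> * (2 ^ d * F0)"
    using pos E0 F0(1) by (subst (asm) ennreal_le_iff) auto
  moreover have "\<eta> * (\<kappa> * E) = \<mu>1 * E / 2" using pos by (simp add: \<eta>_def)
  ultimately have "\<mu>1 * E \<le> 2 * c\<eta> * 2 ^ d * F0" by simp
  then show ?thesis using \<mu> unfolding E_def v_def c\<eta>_def \<eta>_def \<kappa>_def by (simp add: field_simps)
qed

text \<open>The products of nodal values above and below \<open>M\<close> gain \<open>\<mu>0 s Z W\<close>, and the
  hypothesis \<open>dom\<close> lets this absorb the reaction. On a simplex with no vertex below
  \<open>M\<close> the test function vanishes.\<close>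

lemma integrand_below:
  assumes M: "\<forall>j\<in>{n+1..nb}. M \<le> u j" "M \<le> 0" and T: "T \<in> \<T>" "x \<in> rel_interior T"
    and dom: "\<And>j. j \<in> idx T \<Longrightarrow> u j < M \<Longrightarrow> q (P x) (fe u x) - q (P x) 0 \<le> \<mu>0 * s * (\<Sum>i\<in>idx T. nodal_above u M i)"
  shows "\<mu>0 * (norm (simplex_gradient T (fe (nodal_below u M))))\<^sup>2 \<le> - integrand (nodal_below u M) x"
proof -
  let ?g = "simplex_gradient T (fe u)" and ?gp = "simplex_gradient T (fe (nodal_above u M))"
    and ?gm = "simplex_gradient T (fe (nodal_below u M))"
  define Z W where "Z = (\<Sum>i\<in>idx T. nodal_above u M i)" and "W = (\<Sum>i\<in>idx T. nodal_below u M i)"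
  have ZW: "0 \<le> Z" "0 \<le> W" unfolding Z_def W_def by (auto intro!: sum_nonneg simp: nodal_above_def nodal_below_def)
  have xT: "x \<in> T" by (rule ri_sub[OF T])
  have x: "x \<in> Sh" "P x \<in> S" using xT T(1) P_in by blast+
  have prod: "?gp \<bullet> ?gm \<le> - s * Z * W" unfolding Z_def W_def
    using M(1) by (intro cut_product T s acute) auto
  have sZW: "0 \<le> s * Z * W" using s ZW by simp
  have g: "?g = ?gp - ?gm" by (rule cut_gradient[OF T(1)])
  have 1: "?g \<bullet> ?gm \<le> - (s * Z * W + (norm ?gm)\<^sup>2)"
    unfolding g inner_diff_left using prod by (simp add: dot_square_norm)
  have b0: "\<mu>0 \<le> b (P x) (fe u x) ?g"
  proof -
    have "\<mu>0 \<le> \<mu>0 + \<mu>1 * rpow (norm ?g) (p - 2)" using \<mu> by (simp add: rpow_def)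
    also have "\<dots> \<le> b (P x) (fe u x) ?g" by (rule b_lower[OF x(2)])
    finally show ?thesis .
  qed
  have "b (P x) (fe u x) ?g * (?g \<bullet> ?gm) \<le> b (P x) (fe u x) ?g * (- (s * Z * W + (norm ?gm)\<^sup>2))"
    using 1 b0 \<mu> by (intro mult_left_mono) auto
  also have "\<dots> \<le> - (\<mu>0 * (s * Z * W + (norm ?gm)\<^sup>2))"
    unfolding mult_minus_right using mult_right_mono[OF b0, of "s * Z * W + (norm ?gm)\<^sup>2"] sZW
    by (intro le_imp_neg_le) simp
  finally have 2: "b (P x) (fe u x) ?g * (?g \<bullet> ?gm) \<le> - (\<mu>0 * (s * Z * W + (norm ?gm)\<^sup>2))" .
  have w0: "0 \<le> fe (nodal_below u M) x" by (rule fe_nonneg[OF x(1)]) (simp add: nodal_below_def)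
  have wW: "fe (nodal_below u M) x \<le> W"
  proof (rule fe_le[OF T(1) xT])
    fix i assume "i \<in> idx T"
    then show "nodal_below u M i \<le> W" unfolding W_def by (intro member_le_sum idx_finite) (auto simp: nodal_below_def)
  qed
  have 3: "(q (P x) (fe u x) - q (P x) 0) * fe (nodal_below u M) x \<le> \<mu>0 * s * Z * W"
  proof (cases "\<exists>j\<in>idx T. u j < M")
    case True
    then have "(q (P x) (fe u x) - q (P x) 0) \<le> \<mu>0 * s * Z" using dom unfolding Z_def by blast
    then show ?thesis using w0 wW ZW s \<mu> by (intro mult_mono) auto
  next
    case False
    then have "W = 0" unfolding W_def by (intro sum.neutral) (auto simp: nodal_below_def max_def not_less)
    then have "fe (nodal_below u M) x = 0" using w0 wW by simp
    then show ?thesis using \<open>W = 0\<close> by simp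
  qed
  show ?thesis unfolding integrand_simplex[OF T] using 2 3 by (simp add: algebra_simps)
qed

text \<open>Testing with the part below \<open>M\<close>, the right side of the equation is nonnegative and the left side
  is at most a negative multiple of the squared gradient. So this gradient vanishes on every simplex, the
  Poincare inequality makes the integral of the test function vanish, and a constant with zero integral on a
  simplex is zero.\<close>

lemma lower_bound:
  assumes M: "\<forall>j\<in>{n+1..nb}. M \<le> u j" "M \<le> 0"
    and dom: "\<And>T x j. T \<in> \<T> \<Longrightarrow> x \<in> T \<Longrightarrow> j \<in> idx T \<Longrightarrow> u j < M \<Longrightarrow>
       q (P x) (fe u x) - q (P x) 0 \<le> \<mu>0 * s * (\<Sum>i\<in>idx T. nodal_above u M i)"
    and sign: "AE y in surface_measure d S. 0 \<le> f y - q y 0"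
    and i: "i \<in> {1..nb}"
  shows "M \<le> u i"
proof -
  define w where "w = nodal_below u M"
  have w0: "\<forall>j\<in>{n+1..nb}. w j = 0" using M(1) by (auto simp: w_def nodal_below_def)
  have wpos: "0 \<le> fe w x" if "x \<in> Sh" for x by (rule fe_nonneg[OF that]) (simp add: w_def nodal_below_def)
  have low: "\<mu>0 * (norm (simplex_gradient T (fe w)))\<^sup>2 \<le> - integrand w x" if "T \<in> \<T>" "x \<in> rel_interior T" for T x
    unfolding w_def using that by (intro integrand_below M dom) (auto intro: ri_sub)
  have "0 \<le> (LINT x|\<sigma>. (f (P x) - q (P x) 0) * fe w x)"
  proof (rule integral_nonneg_AE)
    show "AE x in \<sigma>. 0 \<le> (f (P x) - q (P x) 0) * fe w x"
      using AE_pullback[OF sign] AE_space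
    proof eventually_elim
      case (elim x)
      then show ?case using wpos[of x] by (simp add: space_surface_measure del: Union_iff)
    qed
  qed
  also have "\<dots> = (LINT x|\<sigma>. integrand w x)" using solution[OF w0] unfolding integrand_def by simp
  finally have R: "0 \<le> (LINT x|\<sigma>. integrand w x)" .
  have "(\<integral>\<^sup>+x. ennreal (- integrand w x) \<partial>\<sigma>) = ennreal (LINT x|\<sigma>. - integrand w x)"
  proof (rule nn_integral_eq_integral, use integrand_integrable in simp, use AE_simplex in \<open>elim eventually_mono\<close>)
    fix x assume "\<exists>T\<in>\<T>. x \<in> rel_interior T"
    then obtain T where T: "T \<in> \<T>" "x \<in> rel_interior T" by blast
    have "0 \<le> \<mu>0 * (norm (simplex_gradient T (fe w)))\<^sup>2" using \<mu> by simp
    then show "0 \<le> - integrand w x" using low[OF T] by linarith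
  qed
  also have "\<dots> = 0" using R by (simp add: ennreal_neg)
  finally have I0: "(\<integral>\<^sup>+x. ennreal (- integrand w x) \<partial>\<sigma>) = 0" .
  have grad0: "simplex_gradient T (fe w) = 0" if T: "T \<in> \<T>" for T
  proof -
    have "ennreal (\<mu>0 * (norm (simplex_gradient T (fe w)))\<^sup>2) * emeasure H (rel_interior T)
       = (\<integral>\<^sup>+x. ennreal (\<mu>0 * (norm (simplex_gradient T (fe w)))\<^sup>2) * indicator (rel_interior T) x \<partial>H)"
      using borel_ri[OF T] by (simp add: nn_integral_cmult_indicator)
    also have "\<dots> \<le> (\<integral>\<^sup>+x\<in>Sh. ennreal (- integrand w x) \<partial>H)"
    proof (intro nn_integral_mono)
      fix x
      show "ennreal (\<mu>0 * (norm (simplex_gradient T (fe w)))\<^sup>2) * indicator (rel_interior T) x \<le> ennreal (- integrand w x) * indicator Sh x"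
      proof (cases "x \<in> rel_interior T")
        case True
        then have "x \<in> Sh" using ri_sub T by blast
        then show ?thesis using low[OF T True] True by (simp add: ennreal_leI)
      qed simp
    qed
    also have "\<dots> = 0" using I0 surface_measure_nn_integral[OF borel_Sh] by metis
    finally have "ennreal (\<mu>0 * (norm (simplex_gradient T (fe w)))\<^sup>2) * emeasure H (rel_interior T) = 0" by simp
    moreover have "emeasure H (rel_interior T) \<noteq> 0" using emeasure_ri[OF T] emeasure_T[OF T] measure_pos[OF T] by simp
    ultimately have "\<mu>0 * (norm (simplex_gradient T (fe w)))\<^sup>2 \<le> 0" by (simp add: ennreal_eq_0_iff)
    then show ?thesis using \<mu> by (simp add: mult_le_0_iff)
  qed
  then have "energy p w = 0" unfolding energy_def by simp
  then have P0: "(\<integral>\<^sup>+x\<in>Sh. ennreal (\<bar>fe w x\<bar> powr p) \<partial>H) = 0"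
    using discrete_poincare[OF _ C0 poincare w0] p unfolding surface_measure_nn_integral[OF borel_Sh] by simp
  obtain T where T: "T \<in> \<T>" "B i \<in> T" using verts i extreme_in by blast
  have const: "fe w x = w i" if "x \<in> T" for x
    using simplex_gradient_works[OF T(1) fe_pl that T(2), of w] grad0[OF T(1)] fe_vertex[OF i, of w] by simp
  have "ennreal (\<bar>w i\<bar> powr p) * emeasure H T = (\<integral>\<^sup>+x. ennreal (\<bar>w i\<bar> powr p) * indicator T x \<partial>H)"
    using borel_T[OF T(1)] by (simp add: nn_integral_cmult_indicator)
  also have "\<dots> \<le> (\<integral>\<^sup>+x\<in>Sh. ennreal (\<bar>fe w x\<bar> powr p) \<partial>H)"
  proof (intro nn_integral_mono)
    fix x
    show "ennreal (\<bar>w i\<bar> powr p) * indicator T x \<le> ennreal (\<bar>fe w x\<bar> powr p) * indicator Sh x"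
    proof (cases "x \<in> T")
      case True
      then have "x \<in> Sh" using T by blast
      then show ?thesis using const[OF True] True by simp
    qed simp
  qed
  finally have "ennreal (\<bar>w i\<bar> powr p) * emeasure H T = 0" using P0 by simp
  then have "w i = 0" using emeasure_T[OF T(1)] measure_pos[OF T(1)] by (simp add: ennreal_eq_0_iff)
  then show ?thesis by (simp add: w_def nodal_below_def max_def split: if_splits)
qed

end

section \<open>Mesh size and subcritical growth\<close>

context discrete_problem
begin

text \<open>On a simplex with a vertex below \<open>M \<le> K\<close> the part above \<open>K\<close> has a zero, so its
  nodal values are at most \<open>h\<close> times the gradient. The energy bounds the gradient, since a single
  simplex has measure at least \<open>m1 h\<^sup>d\<close>. The term \<open>2 K\<close> accounts for the
  difference of the levels, and \<open>d + 1\<close> counts the vertices.\<close>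

lemma crossing_bound:
  fixes h K E m1 :: real
  assumes h: "0 < h" and m1: "0 < m1" and diam: "\<And>T x y. T \<in> \<T> \<Longrightarrow> x \<in> T \<Longrightarrow> y \<in> T \<Longrightarrow> dist x y \<le> h"
    and meas: "\<And>T. T \<in> \<T> \<Longrightarrow> m1 * h ^ d \<le> measure H T"
    and E: "energy p (nodal_above u K) \<le> E" "0 \<le> E" and KM: "- K \<le> M" "M \<le> 0"
    and T: "T \<in> \<T>" and j: "j \<in> idx T" "u j < M"
  shows "(\<Sum>i\<in>idx T. nodal_above u M i) \<le> (real d + 1) * (2 * K + h * (E / (m1 * h ^ d)) powr (1 / p))"
proof -
  let ?g = "simplex_gradient T (fe (nodal_above u K))"
  have mh: "0 < m1 * h ^ d" using h m1 by simp
  have "norm ?g powr p * (m1 * h ^ d) \<le> norm ?g powr p * measure H T"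
    using meas[OF T] by (intro mult_left_mono) auto
  also have "\<dots> \<le> energy p (nodal_above u K)"
    unfolding energy_def using finT T by (intro member_le_sum) auto
  finally have "norm ?g powr p \<le> E / (m1 * h ^ d)" using E mh by (simp add: field_simps)
  then have "(norm ?g powr p) powr (1 / p) \<le> (E / (m1 * h ^ d)) powr (1 / p)"
    using p by (intro powr_mono2) auto
  then have g: "norm ?g \<le> (E / (m1 * h ^ d)) powr (1 / p)" using p by (simp add: powr_powr)
  have "nodal_above u M i \<le> 2 * K + h * (E / (m1 * h ^ d)) powr (1 / p)" if i: "i \<in> idx T" for i
  proof -
    have ij: "i \<in> {1..nb}" "j \<in> {1..nb}" "B i \<in> T" "B j \<in> T" using i j by (auto simp: idx_def)
    have "nodal_above u K i = fe (nodal_above u K) (B i) - fe (nodal_above u K) (B j)"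
      using fe_vertex[OF ij(1)] fe_vertex[OF ij(2)] j KM by (simp add: nodal_above_def)
    also have "\<dots> = ?g \<bullet> (B i - B j)" by (rule simplex_gradient_works[OF T fe_pl ij(3,4)])
    also have "\<dots> \<le> norm ?g * norm (B i - B j)" by (rule norm_cauchy_schwarz)
    also have "\<dots> \<le> (E / (m1 * h ^ d)) powr (1 / p) * h"
      using g diam[OF T ij(3,4)] by (intro mult_mono) (auto simp: dist_norm)
    finally have 1: "nodal_above u K i \<le> h * (E / (m1 * h ^ d)) powr (1 / p)" by (simp add: mult.commute)
    have "nodal_above u M i \<le> nodal_above u K i + 2 * K" using KM unfolding nodal_above_def by linarith
    with 1 show ?thesis by linarith
  qed
  then have "(\<Sum>i\<in>idx T. nodal_above u M i) \<le> of_nat (card (idx T)) * (2 * K + h * (E / (m1 * h ^ d)) powr (1 / p))"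
    by (rule sum_bounded_above)
  then show ?thesis by (simp add: card_idx[OF T] add.commute)
qed

text \<open>As \<open>M \<le> 0\<close>, positive values of \<open>u\<close> are at most the sum of the nodal values above
  \<open>M\<close>; where \<open>u \<le> 0\<close> the reaction vanishes.\<close>

lemma reaction_dominated:
  fixes Zb \<alpha> \<beta> p1 :: real
  assumes growth: "\<And>x z. x \<in> S \<Longrightarrow> 0 \<le> z \<Longrightarrow> q x z - q x 0 \<le> \<alpha> * z + \<beta> * rpow z (p1 - 1)"
    and ab: "0 \<le> \<alpha>" "0 \<le> \<beta>" and p1: "2 \<le> p1" and M: "M \<le> 0"
    and T: "T \<in> \<T>" and x: "x \<in> T" and Z: "(\<Sum>i\<in>idx T. nodal_above u M i) \<le> Zb"
    and small: "\<alpha> + \<beta> * Zb powr (p1 - 2) \<le> \<mu>0 * s"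
  shows "q (P x) (fe u x) - q (P x) 0 \<le> \<mu>0 * s * (\<Sum>i\<in>idx T. nodal_above u M i)"
proof -
  define Z where "Z = (\<Sum>i\<in>idx T. nodal_above u M i)"
  have Z0: "0 \<le> Z" unfolding Z_def by (intro sum_nonneg) (simp add: nodal_above_def)
  have xS: "P x \<in> S" using P_in[OF UnionI[OF T x]] .
  show ?thesis
  proof (cases "fe u x \<le> 0")
    case True
    then have "q (P x) (fe u x) - q (P x) 0 = 0" using q_neg[OF xS True] by simp
    also have "0 \<le> \<mu>0 * s * Z" using \<mu> s Z0 by simp
    finally show ?thesis by (simp add: Z_def)
  next
    case False
    have uZ: "fe u x \<le> Z"
    proof (rule fe_le[OF T x])
      fix i assume i: "i \<in> idx T"
      have "u i \<le> nodal_above u M i" using M by (simp add: nodal_above_def)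
      also have "\<dots> \<le> Z" unfolding Z_def by (intro member_le_sum idx_finite i) (auto simp: nodal_above_def)
      finally show "u i \<le> Z" .
    qed
    then have Zp: "0 < Z" using False by linarith
    have "q (P x) (fe u x) - q (P x) 0 \<le> \<alpha> * fe u x + \<beta> * rpow (fe u x) (p1 - 1)"
      using growth[OF xS, of "fe u x"] False by simp
    also have "rpow (fe u x) (p1 - 1) = fe u x powr (p1 - 1)" using p1 by (simp add: rpow_def)
    also have "\<alpha> * fe u x + \<beta> * fe u x powr (p1 - 1) \<le> \<alpha> * Z + \<beta> * Z powr (p1 - 1)"
      using uZ False ab p1 by (intro add_mono mult_left_mono powr_mono2) auto
    also have "Z powr (p1 - 1) = Z powr (p1 - 2) * Z" using Zp powr_add[of Z "p1 - 2" 1] by simp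
    also have "\<alpha> * Z + \<beta> * (Z powr (p1 - 2) * Z) = (\<alpha> + \<beta> * Z powr (p1 - 2)) * Z" by (simp add: algebra_simps)
    also have "\<dots> \<le> (\<alpha> + \<beta> * Zb powr (p1 - 2)) * Z"
      using Z Zp ab p1 unfolding Z_def[symmetric] by (intro mult_right_mono add_left_mono mult_left_mono powr_mono2) auto
    also have "\<dots> \<le> \<mu>0 * s * Z" using small Z0 by (rule mult_right_mono)
    finally show ?thesis by (simp add: Z_def)
  qed
qed

end

text \<open>For \<open>h \<le> 1\<close> the base of the power is at most \<open>(A + A') h\<^bsup>-t\<^esup>\<close> with
  \<open>t = max 0 (d/p - 1)\<close>, and \<open>p1 < 2 d/(d-p)\<close> is equivalent to
  \<open>t (p1 - 2) < 2\<close> when \<open>d > p\<close>.\<close>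

lemma subcritical_smallness:
  fixes A \<alpha> \<beta> c \<theta>0 p p1 :: real and d :: nat
  assumes p: "2 \<le> p" and p1: "2 \<le> p1" "real d > p \<longrightarrow> p1 < 2 * real d / (real d - p)"
    and ab: "0 \<le> \<alpha>" "0 \<le> \<beta>" and A: "0 < A" "0 \<le> A'" and c: "0 < c"
  shows "\<exists>h0>0. \<forall>h. 0 < h \<longrightarrow> h < h0 \<longrightarrow>
     \<alpha> + \<beta> * (A + A' * (h * (1 / h ^ d) powr (1 / p))) powr (p1 - 2) \<le> c / h\<^sup>2"
proof -
  define t where "t = max 0 (real d / p - 1)"
  define \<theta> where "\<theta> = 2 - t * (p1 - 2)"
  have t0: "0 \<le> t" by (simp add: t_def)
  have \<theta>: "0 < \<theta>"
  proof (cases "real d > p")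
    case True
    then have "p1 * (real d - p) < 2 * real d" using p1(2) by (simp add: field_simps)
    then have "(real d - p) * (p1 - 2) < 2 * p" by (simp add: algebra_simps)
    then have "(real d / p - 1) * (p1 - 2) < 2" using p by (simp add: field_simps)
    moreover have "t = real d / p - 1" using True p by (simp add: t_def)
    ultimately show ?thesis by (simp add: \<theta>_def)
  next
    case False
    then have "t = 0" using p by (simp add: t_def)
    then show ?thesis by (simp add: \<theta>_def)
  qed
  have "((\<lambda>h. \<alpha> * h\<^sup>2 + \<beta> * (A + A') powr (p1 - 2) * h powr \<theta>) \<longlongrightarrow> \<alpha> * 0\<^sup>2 + \<beta> * (A + A') powr (p1 - 2) * 0) (at_right 0)"
    using \<theta> by (intro tendsto_intros tendsto_zero_powrI[of _ _ _ \<theta>]) (auto intro: eventually_at_rightI[of 0 1])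
  then have "eventually (\<lambda>h. \<alpha> * h\<^sup>2 + \<beta> * (A + A') powr (p1 - 2) * h powr \<theta> < c) (at_right 0)"
    by (rule order_tendstoD) (use c in simp)
  then obtain h1 where h1: "0 < h1" "\<And>h. 0 < h \<Longrightarrow> h < h1 \<Longrightarrow> \<alpha> * h\<^sup>2 + \<beta> * (A + A') powr (p1 - 2) * h powr \<theta> < c"
    unfolding eventually_at_right_field by auto
  show ?thesis
  proof (intro exI[of _ "min h1 1"] conjI allI impI)
    show "0 < min h1 1" using h1 by simp
    fix h :: real assume h: "0 < h" "h < min h1 1"
    have "(1 / h ^ d) powr (1 / p) = h powr (- (real d / p))"
      using h by (simp add: powr_realpow[symmetric] powr_divide powr_powr powr_minus_divide)
    then have "h * (1 / h ^ d) powr (1 / p) = h powr (1 - real d / p)"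
      using h by (simp add: powr_diff powr_minus_divide)
    also have "\<dots> \<le> h powr (- t)" using h by (intro powr_mono') (auto simp: t_def)
    finally have 1: "h * (1 / h ^ d) powr (1 / p) \<le> h powr (- t)" .
    have 2: "1 \<le> h powr (- t)" using h t0 powr_mono'[of "- t" 0 h] by simp
    have "A + A' * (h * (1 / h ^ d) powr (1 / p)) \<le> A * h powr (- t) + A' * h powr (- t)"
      using A 1 2 by (intro add_mono mult_left_mono) (auto simp: mult_le_cancel_left1)
    then have "(A + A' * (h * (1 / h ^ d) powr (1 / p))) powr (p1 - 2) \<le> ((A + A') * h powr (- t)) powr (p1 - 2)"
      using A h p1 by (intro powr_mono2) (auto simp: algebra_simps intro!: add_nonneg_nonneg mult_nonneg_nonneg)
    also have "\<dots> = (A + A') powr (p1 - 2) * h powr (- t * (p1 - 2))"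
      using A by (simp add: powr_mult powr_powr)
    finally have "\<beta> * (A + A' * (h * (1 / h ^ d) powr (1 / p))) powr (p1 - 2) \<le> \<beta> * ((A + A') powr (p1 - 2) * h powr (- t * (p1 - 2)))"
      using ab by (intro mult_left_mono)
    then have "\<beta> * (A + A' * (h * (1 / h ^ d) powr (1 / p))) powr (p1 - 2) * h\<^sup>2 \<le> \<beta> * ((A + A') powr (p1 - 2) * h powr (- t * (p1 - 2))) * h\<^sup>2"
      by (rule mult_right_mono) simp
    also have "\<dots> = \<beta> * (A + A') powr (p1 - 2) * h powr \<theta>"
    proof -
      have "h powr \<theta> = h powr 2 * h powr (- t * (p1 - 2))" unfolding \<theta>_def by (simp add: powr_add[symmetric])
      then show ?thesis using h by simp
    qed
    finally have "(\<alpha> + \<beta> * (A + A' * (h * (1 / h ^ d) powr (1 / p))) powr (p1 - 2)) * h\<^sup>2 \<le> c"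
      using h1(2)[of h] h by (simp add: distrib_right)
    then show "\<alpha> + \<beta> * (A + A' * (h * (1 / h ^ d) powr (1 / p))) powr (p1 - 2) \<le> c / h\<^sup>2"
      using h by (simp add: field_simps)
  qed
qed

text \<open>The subtracted function is bounded and \<open>S\<close> has finite measure.\<close>

lemma surface_source_integrable:
  fixes S :: "'a::euclidean_space set"
  assumes S: "compact S" and fin: "emeasure (hausdorff_measure d) S \<noteq> \<infinity>" and r: "1 \<le> r"
    and f: "Lp_fun (surface_measure d S) r f" and q: "continuous_on S q0"
  obtains F0 :: real where "0 \<le> F0" "(\<integral>\<^sup>+y. ennreal (\<bar>f y - q0 y\<bar> powr r) \<partial>surface_measure d S) \<le> ennreal F0"
    "(\<lambda>y. f y - q0 y) \<in> borel_measurable (surface_measure d S)"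
proof -
  let ?\<sigma> = "surface_measure d S"
  have bS: "S \<in> sets borel" using S by (rule borel_compact)
  have qm: "q0 \<in> borel_measurable ?\<sigma>"
    by (intro surface_measure_measurable borel_measurable_continuous_on_restrict q)
  have fm: "f \<in> borel_measurable ?\<sigma>" and fi: "integrable ?\<sigma> (\<lambda>x. \<bar>f x\<bar> powr r)"
    using f unfolding Lp_fun_def by auto
  obtain Q where Q: "\<And>y. y \<in> S \<Longrightarrow> \<bar>q0 y\<bar> \<le> Q"
    using compact_imp_bounded[OF compact_continuous_image[OF q S]] by (auto simp: bounded_iff)
  define I where "I = (LINT x|?\<sigma>. \<bar>f x\<bar> powr r)"
  have "(\<integral>\<^sup>+y. ennreal (\<bar>f y - q0 y\<bar> powr r) \<partial>?\<sigma>) \<le> (\<integral>\<^sup>+y. ennreal (2 powr r) * ennreal (\<bar>f y\<bar> powr r) + ennreal (2 powr r * \<bar>Q\<bar> powr r) \<partial>?\<sigma>)"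
  proof (rule nn_integral_mono)
    fix y assume "y \<in> space ?\<sigma>"
    then have y: "y \<in> S" by (simp add: space_surface_measure)
    define m where "m = max \<bar>f y\<bar> \<bar>Q\<bar>"
    have "\<bar>f y\<bar> \<le> m" "\<bar>q0 y\<bar> \<le> m" using Q[OF y] by (auto simp: m_def)
    then have "\<bar>f y - q0 y\<bar> powr r \<le> (2 * m) powr r" using r by (intro powr_mono2) auto
    also have "\<dots> = 2 powr r * m powr r" by (simp add: m_def powr_mult)
    also have "m powr r \<le> \<bar>f y\<bar> powr r + \<bar>Q\<bar> powr r" by (simp add: m_def max_def)
    finally show "ennreal (\<bar>f y - q0 y\<bar> powr r) \<le> ennreal (2 powr r) * ennreal (\<bar>f y\<bar> powr r) + ennreal (2 powr r * \<bar>Q\<bar> powr r)"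
      by (simp add: ennreal_mult'[symmetric] ennreal_plus[symmetric] distrib_left ennreal_leI del: ennreal_plus)
  qed
  also have "\<dots> = ennreal (2 powr r) * (\<integral>\<^sup>+y. ennreal (\<bar>f y\<bar> powr r) \<partial>?\<sigma>) + ennreal (2 powr r * \<bar>Q\<bar> powr r) * emeasure ?\<sigma> (space ?\<sigma>)"
    using fm by (simp add: nn_integral_add nn_integral_cmult)
  also have "(\<integral>\<^sup>+y. ennreal (\<bar>f y\<bar> powr r) \<partial>?\<sigma>) = ennreal I"
    unfolding I_def by (rule nn_integral_eq_integral[OF fi]) simp
  also have "emeasure ?\<sigma> (space ?\<sigma>) = ennreal (measure (hausdorff_measure d) S)"
  proof -
    have "emeasure ?\<sigma> (space ?\<sigma>) = emeasure (hausdorff_measure d) S"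
      using surface_measure_nn_integral[OF bS, of d "\<lambda>_. 1"] bS by simp
    then show ?thesis using fin by (simp add: emeasure_eq_ennreal_measure)
  qed
  finally have "(\<integral>\<^sup>+y. ennreal (\<bar>f y - q0 y\<bar> powr r) \<partial>?\<sigma>) \<le> ennreal (2 powr r * I + 2 powr r * \<bar>Q\<bar> powr r * measure (hausdorff_measure d) S)"
    by (simp add: I_def ennreal_mult'[symmetric] ennreal_plus[symmetric] del: ennreal_plus)
  moreover have "0 \<le> 2 powr r * I + 2 powr r * \<bar>Q\<bar> powr r * measure (hausdorff_measure d) S" by (simp add: I_def)
  moreover have "(\<lambda>y. f y - q0 y) \<in> borel_measurable ?\<sigma>" using fm qm by (rule borel_measurable_diff)
  ultimately show thesis by (intro that)
qed

section \<open>The discrete maximum principle\<close>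

theorem theorem3p4:
  fixes d :: nat
    and S :: "'a::euclidean_space set" and \<nu> :: "'a \<Rightarrow> 'a" and \<epsilon> :: real and \<delta> :: "'a \<Rightarrow> real"
    and p \<gamma> p1 \<mu>0 \<mu>1 M0 M1 \<alpha> \<beta> :: real
    and b :: "'a \<Rightarrow> real \<Rightarrow> 'a \<Rightarrow> real" and q :: "'a \<Rightarrow> real \<Rightarrow> real"
    and f g gstar :: "'a \<Rightarrow> real"
    and H :: "real set" and \<T> :: "real \<Rightarrow> 'a set set" and B :: "real \<Rightarrow> nat \<Rightarrow> 'a"
    and n nb :: "real \<Rightarrow> nat" and c \<sigma>0 m1 m2 :: real
  assumes dim: "1 \<le> d" "DIM('a) = d + 1"
    and surface: "compact S" "connected S" "smooth_hypersurface S" "surface_boundary S \<noteq> {}"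
      "unit_normal_field S \<nu>" "signed_distance S \<nu> \<epsilon> \<delta>"
    and A1: "2 \<le> p"
    and A2_coeff: "continuous_on (S \<times> UNIV \<times> UNIV) (\<lambda>(x, z, \<xi>). b x z \<xi>)"
      "continuous_on (S \<times> UNIV) (\<lambda>(x, z). q x z)"
    and A2_source: "Lp_fun (surface_measure d S) (p / (p - 1)) f"
    and A2_boundary: "if p > real d then \<gamma> \<ge> p else \<gamma> > real d"
      "sobolev_W1 d S \<nu> \<gamma> gstar" "continuous_on S gstar"
      "\<forall>x\<in>surface_boundary S. g x = gstar x"
    and A3_const: "0 < \<mu>0" "0 < \<mu>1" "0 < M0" "0 < M1"
    and A3: "\<forall>x\<in>S. \<forall>z \<xi>. \<mu>0 + \<mu>1 * rpow (norm \<xi>) (p - 2) \<le> b x z \<xi> \<and>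
                       b x z \<xi> \<le> M0 + M1 * rpow (norm \<xi>) (p - 2)"
    and A4_const: "2 \<le> p1" "real d > p \<longrightarrow> p1 < 2 * real d / (real d - p)" "0 \<le> \<alpha>" "0 \<le> \<beta>"
    and A4_neg: "\<forall>x\<in>S. \<forall>z\<le>0. 0 \<le> q x 0 \<and> q x 0 = q x z"
    and A4_pos: "\<forall>x\<in>S. \<forall>z\<ge>0. 0 \<le> q x z - q x 0 \<and> q x z - q x 0 \<le> \<alpha> * z + \<beta> * rpow z (p1 - 1)"
    and sign: "AE x in surface_measure d S. f x - q x 0 \<ge> 0"
    and family_const: "H \<subseteq> {0<..}" "0 < c" "0 < \<sigma>0" "0 < m1" "0 < m2"
    and mesh: "\<forall>h\<in>H. admissible_triangulation d S c h (\<T> h) (B h) (n h) (nb h)"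
    and lift_ok: "\<forall>h\<in>H. lift_well_defined S \<nu> \<epsilon> \<delta> (\<T> h)"
    and acute: "\<forall>h\<in>H. \<forall>i\<in>{1..n h}. \<forall>j\<in>{1..nb h}. i \<noteq> j \<longrightarrow>
       (\<forall>x \<in> nodal_support (\<T> h) (B h) (nb h) i \<inter> nodal_support (\<T> h) (B h) (nb h) j
              \<inter> open_simplices (\<T> h).
          surface_gradient (\<T> h) (nodal_basis (\<T> h) (B h) (nb h) i) x
            \<bullet> surface_gradient (\<T> h) (nodal_basis (\<T> h) (B h) (nb h) j) x
          \<le> - \<sigma>0 / h\<^sup>2)"
    and quasi_uniform: "\<forall>h\<in>H. \<forall>T\<in>\<T> h. m1 * h ^ d \<le> measure (hausdorff_measure d) T \<and>
                                    measure (hausdorff_measure d) T \<le> m2 * h ^ d"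
  shows "\<exists>h0>0. \<forall>h\<in>H. h < h0 \<longrightarrow>
    (\<forall>u. discrete_solution d S \<nu> \<delta> b q f g (\<T> h) (B h) (n h) (nb h) u \<longrightarrow>
      (\<exists>m mb.
         is_minimum (lift S \<nu> \<delta> (\<T> h) u) S m \<and>
         is_minimum (lift S \<nu> \<delta> (\<T> h) (boundary_interpolant (\<T> h) (B h) (n h) (nb h) g))
           (surface_boundary S) mb \<and>
         m \<ge> min 0 mb \<and>
         ((\<forall>x\<in>surface_boundary S. g x \<le> 0) \<longrightarrow> m = mb) \<and>
         ((\<forall>x\<in>surface_boundary S. g x \<ge> 0) \<longrightarrow> m \<ge> 0)))"
proof -
  obtain h1 where h1: "0 < h1" and bilip: "\<And>d h \<T> B n nb T x y. admissible_triangulation d S c h \<T> B n nb \<Longrightarrow> 0 < h \<Longrightarrow> h < h1 \<Longrightarrow>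
     lift_well_defined S \<nu> \<epsilon> \<delta> \<T> \<Longrightarrow> T \<in> \<T> \<Longrightarrow> x \<in> T \<Longrightarrow> y \<in> T \<Longrightarrow>
     dist x y \<le> 2 * dist (foot_point S \<nu> \<delta> x) (foot_point S \<nu> \<delta> y) \<and>
     dist (foot_point S \<nu> \<delta> x) (foot_point S \<nu> \<delta> y) \<le> 2 * dist x y"
    by (rule foot_point_bilipschitz[OF surface(1,3,5,6) family_const(2)]) (rule that, assumption, blast)
  define P where "P = foot_point S \<nu> \<delta>"
  have hpos: "0 < h" if "h \<in> H" for h using family_const(1) that by auto
  have lm: "lifted_mesh d (\<T> h) (B h) (n h) (nb h) S P" if h: "h \<in> H" "h < h1" for h
  proof -
    have ad: "admissible_triangulation d S c h (\<T> h) (B h) (n h) (nb h)" using mesh h by blast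
    have lw: "lift_well_defined S \<nu> \<epsilon> \<delta> (\<T> h)" using lift_ok h by blast
    have sm: "simplicial_mesh d (\<T> h) (B h) (n h) (nb h)"
      using ad dim unfolding admissible_triangulation_def by (intro simplicial_mesh.intro) auto
    have "0 < m1 * h ^ d" using family_const(4) hpos[OF h(1)] by simp
    then have mp: "0 < measure (hausdorff_measure d) T" if "T \<in> \<T> h" for T
      using quasi_uniform h(1) that by (meson less_le_trans)
    have "lifted_mesh_axioms d (\<T> h) S P"
    proof (rule lifted_mesh_axioms.intro)
      show "bij_betw P (\<Union> (\<T> h)) S" "P ` poly_boundary (\<T> h) = surface_boundary S"
        using lw unfolding lift_well_defined_def P_def by blast+
      show "dist x y \<le> 2 * dist (P x) (P y)" "dist (P x) (P y) \<le> 2 * dist x y" if "T \<in> \<T> h" "x \<in> T" "y \<in> T" for T x y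
        using bilip[OF ad hpos[OF h(1)] h(2) lw that] unfolding P_def by blast+
      show "\<T> h \<noteq> {}" using ad unfolding admissible_triangulation_def by blast
    qed (rule mp)
    with sm show ?thesis by (rule lifted_mesh.intro)
  qed
  show ?thesis
  proof (cases "\<exists>h\<in>H. h < h1")
    case False
    then show ?thesis using h1 by blast
  next
    case True
    then obtain hs where hs: "hs \<in> H" "hs < h1" by blast
    have finS: "emeasure (hausdorff_measure d) S \<noteq> \<infinity>" by (rule lifted_mesh.finite_S[OF lm[OF hs]])
    \<comment> \<open>one fine mesh is enough to see that Hausdorff measure is nontrivial and finite on \<open>S\<close>; without any the claim is void\<close>
    obtain T0 :: "'a set" where T0: "emeasure (hausdorff_measure d) T0 \<noteq> 0"
      using lifted_mesh.nonzero[OF lm[OF hs]] by blast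
    have p1': "1 < p" using A1 by simp
    have hsurf: "hausdorff_surface d S T0 p" using dim(1) p1' surface(1) finS T0 by (rule hausdorff_surface.intro)
    obtain C where C: "0 < C" "\<And>w G. boundary_zero_pair S w G \<Longrightarrow>
       (\<integral>\<^sup>+z\<in>S. ennreal (\<bar>w z\<bar> powr p) \<partial>hausdorff_measure d) \<le> ennreal C * (\<integral>\<^sup>+z\<in>S. ennreal (G z powr p) \<partial>hausdorff_measure d)"
      by (rule hausdorff_surface.poincare_inequality[OF hsurf surface(2,3,4)]) (rule that, assumption, blast)
    have q0c: "continuous_on S (\<lambda>y. q y 0)"
    proof -
      have "continuous_on S (\<lambda>y. (\<lambda>(x, z). q x z) (y, 0))"
        by (rule continuous_on_compose2[OF A2_coeff(2)]) (auto intro!: continuous_intros)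
      then show ?thesis by simp
    qed
    have r1: "1 \<le> p / (p - 1)" using A1 by simp
    obtain F0 where F0: "0 \<le> F0" "(\<integral>\<^sup>+y. ennreal (\<bar>f y - q y 0\<bar> powr (p / (p - 1))) \<partial>surface_measure d S) \<le> ennreal F0"
      and fmeas: "(\<lambda>y. f y - q y 0) \<in> borel_measurable (surface_measure d S)"
      using surface_source_integrable[OF surface(1) finS r1 A2_source q0c] by blast
    obtain K0 where K0: "\<And>y. y \<in> S \<Longrightarrow> \<bar>gstar y\<bar> \<le> K0"
      using compact_imp_bounded[OF compact_continuous_image[OF A2_boundary(3) surface(1)]] by (auto simp: bounded_iff)
    \<comment> \<open>positive, so that \<open>A\<close> below is positive and its power with exponent \<open>p1 - 2 = 0\<close> is 1\<close>
    define K where "K = max 1 K0"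
    have K: "0 < K" "0 \<le> K" by (auto simp: K_def)
    have gK: "\<bar>g y\<bar> \<le> K" if "y \<in> surface_boundary S" for y
    proof -
      have "y \<in> S" using that by (simp add: surface_boundary_def)
      then show ?thesis using K0[of y] A2_boundary(4) that by (simp add: K_def)
    qed
    define E where "E = 2 * (\<mu>1 / (2 * (4 ^ d * C * 2 powr p))) powr (- 1 / (p - 1)) * 2 ^ d * F0 / \<mu>1"
    have E0: "0 \<le> E" unfolding E_def using F0(1) A3_const(2) by simp
    define A A' where "A = (real d + 1) * (2 * K)" and "A' = (real d + 1) * (E / m1) powr (1 / p)"
    have A: "0 < A" "0 \<le> A'" using K unfolding A_def A'_def by auto
    obtain h2 where h2: "0 < h2" "\<And>h. 0 < h \<Longrightarrow> h < h2 \<Longrightarrow>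
       \<alpha> + \<beta> * (A + A' * (h * (1 / h ^ d) powr (1 / p))) powr (p1 - 2) \<le> \<mu>0 * \<sigma>0 / h\<^sup>2"
      using subcritical_smallness[OF A1 A4_const A, of "\<mu>0 * \<sigma>0"] A3_const(1) family_const(3) by auto
    show ?thesis
    proof (rule exI[of _ "min h1 h2"], intro conjI ballI impI allI)
      show "0 < min h1 h2" using h1 h2 by simp
      fix h uh
      assume h: "h \<in> H" "h < min h1 h2"
        and sol: "discrete_solution d S \<nu> \<delta> b q f g (\<T> h) (B h) (n h) (nb h) uh"
      have h0: "0 < h" using hpos[OF h(1)] .
      have ad: "admissible_triangulation d S c h (\<T> h) (B h) (n h) (nb h)" using mesh h by blast
      interpret L: lifted_mesh d "\<T> h" "B h" "n h" "nb h" S P using lm h by simp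
      define gc where "gc j = (if n h + 1 \<le> j then g (B h j) else 0)" for j
      have gI: "boundary_interpolant (\<T> h) (B h) (n h) (nb h) g = L.fe gc"
        unfolding gc_def by (rule L.boundary_interpolant_fe)
      from sol have u1: "uh \<in> fe_space (\<T> h) (B h) (nb h) (nb h)"
        and u2: "(\<lambda>x. uh x - boundary_interpolant (\<T> h) (B h) (n h) (nb h) g x) \<in> fe_space (\<T> h) (B h) (nb h) (n h)"
        unfolding discrete_solution_def Let_def by blast+
      have eqn: "\<forall>v\<in>fe_space (\<T> h) (B h) (nb h) (n h).
         (LINT x|surface_measure d (\<Union>(\<T> h)). b (P x) (uh x) (surface_gradient (\<T> h) uh x) * (surface_gradient (\<T> h) uh x \<bullet> surface_gradient (\<T> h) v x)
                    + (q (P x) (uh x) - q (P x) 0) * v x)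
         = (LINT x|surface_measure d (\<Union>(\<T> h)). (f (P x) - q (P x) 0) * v x)"
        using sol unfolding discrete_solution_def Let_def P_def by (elim conjE)
      obtain a where a: "uh = L.fe a" using u1 L.fe_space_full by auto
      have abd: "a j = g (B h j)" if j: "j \<in> {n h + 1..nb h}" for j
      proof -
        have "(\<lambda>x. uh x - boundary_interpolant (\<T> h) (B h) (n h) (nb h) g x) = L.fe (\<lambda>j. a j - gc j)"
          unfolding a gI by (rule ext, rule L.fe_diff[symmetric])
        then obtain a' where a': "L.fe (\<lambda>j. a j - gc j) = L.fe a'" "\<forall>j\<in>{n h + 1..nb h}. a' j = 0"
          using u2 L.fe_space_interior by auto
        have "a j - gc j = a' j" by (rule L.fe_inject[OF a'(1)]) (use j in auto)
        then show ?thesis using a'(2) j by (simp add: gc_def)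
      qed
      have Bbd: "B h j \<in> poly_boundary (\<T> h)" "B h j \<in> surface_boundary S" if "j \<in> {n h + 1..nb h}" for j
        using ad that unfolding admissible_triangulation_def by blast+
      have agc: "a j = gc j" if "j \<in> {n h + 1..nb h}" for j using abd[OF that] that by (simp add: gc_def)
      have aK: "\<bar>a j\<bar> \<le> K" if "j \<in> {n h + 1..nb h}" for j using abd[OF that] gK[OF Bbd(2)[OF that]] by simp
      define s where "s = \<sigma>0 / h\<^sup>2"
      have s0: "0 \<le> s" using family_const(3) by (simp add: s_def)
      interpret D: discrete_problem d "\<T> h" "B h" "n h" "nb h" S P b q f a p \<mu>0 \<mu>1 s C
      proof unfold_locales
        show "q x z = q x 0" if "x \<in> S" "z \<le> 0" for x z using A4_neg that by metis
        show "0 \<le> q x z - q x 0" if "x \<in> S" "0 \<le> z" for x z using A4_pos that by blast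
        show "\<mu>0 + \<mu>1 * rpow (norm \<xi>) (p - 2) \<le> b x z \<xi>" if "x \<in> S" for x z \<xi> using A3 that by blast
        show "L.grad T i \<bullet> L.grad T j \<le> - s" if "T \<in> \<T> h" "i \<in> L.idx T" "i \<le> n h" "j \<in> L.idx T" "i \<noteq> j" for T i j
        proof (rule L.acute_products[OF _ that])
          show "\<forall>i\<in>{1..n h}. \<forall>j\<in>{1..nb h}. i \<noteq> j \<longrightarrow>
             (\<forall>x\<in>nodal_support (\<T> h) (B h) (nb h) i \<inter> nodal_support (\<T> h) (B h) (nb h) j \<inter> open_simplices (\<T> h).
                 surface_gradient (\<T> h) (L.hat i) x \<bullet> surface_gradient (\<T> h) (L.hat j) x \<le> - s)"
            using acute h(1) by (simp add: s_def)
        qed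
        show "(LINT x|surface_measure d (\<Union> (\<T> h)). b (P x) (L.fe a x) (surface_gradient (\<T> h) (L.fe a) x) *
            (surface_gradient (\<T> h) (L.fe a) x \<bullet> surface_gradient (\<T> h) (L.fe v) x) + (q (P x) (L.fe a x) - q (P x) 0) * L.fe v x)
           = (LINT x|surface_measure d (\<Union> (\<T> h)). (f (P x) - q (P x) 0) * L.fe v x)"
          if "\<forall>j\<in>{n h + 1..nb h}. v j = 0" for v
        proof -
          have "L.fe v \<in> fe_space (\<T> h) (B h) (nb h) (n h)" using that L.fe_space_interior by auto
          from bspec[OF eqn this] show ?thesis unfolding a .
        qed
      qed (use A1 A2_coeff A3_const s0 C in auto)
      have energy: "L.energy p (nodal_above a K) \<le> E"
        unfolding E_def using aK by (intro D.upper_energy_bound[OF _ K(2) fmeas F0]) (auto simp: abs_le_iff)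
      have diam: "dist x y \<le> h" if "T \<in> \<T> h" "x \<in> T" "y \<in> T" for T x y
      proof -
        have "dist x y \<le> diameter T" using that L.compactT by (intro diameter_bounded_bound compact_imp_bounded)
        also have "\<dots> \<le> Max (diameter ` \<T> h)" using that(1) L.finT by (intro Max_ge) auto
        also have "\<dots> = h" using ad unfolding admissible_triangulation_def by (elim conjE) (rule sym)
        finally show ?thesis .
      qed
      have lift_eq: "lift S \<nu> \<delta> (\<T> h) \<eta> (P x) = \<eta> x" if "x \<in> \<Union> (\<T> h)" for \<eta> x
        using inv_into_f_f[OF L.P_inj that] unfolding lift_def P_def by simp
      have lift_img: "lift S \<nu> \<delta> (\<T> h) \<eta> ` (P ` X) = \<eta> ` X" if "X \<subseteq> \<Union> (\<T> h)" for \<eta> X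
        unfolding image_image
        by (rule image_cong[OF refl]) (rule lift_eq[OF subsetD[OF that]])
      have pb: "poly_boundary (\<T> h) \<noteq> {}" using surface(4) L.P_boundary by (metis image_is_empty)
      obtain x0 where x0: "x0 \<in> poly_boundary (\<T> h)" "\<And>x. x \<in> poly_boundary (\<T> h) \<Longrightarrow> L.fe gc x0 \<le> L.fe gc x"
        using continuous_attains_inf[OF L.compact_poly_boundary pb continuous_on_subset[OF L.fe_continuous L.poly_boundary_sub]] by blast
      define mb where "mb = L.fe gc x0"
      have Sne: "\<Union> (\<T> h) \<noteq> {}" using pb L.poly_boundary_sub by blast
      obtain x1 where x1: "x1 \<in> \<Union> (\<T> h)" "\<And>x. x \<in> \<Union> (\<T> h) \<Longrightarrow> L.fe a x1 \<le> L.fe a x"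
        using continuous_attains_inf[OF L.compact_surface Sne L.fe_continuous] by blast
      define m where "m = L.fe a x1"
      have mb_le: "mb \<le> a j" if "j \<in> {n h + 1..nb h}" for j
        using x0(2)[OF Bbd(1)[OF that]] L.fe_vertex[of j gc] agc[OF that] that by (simp add: mb_def)
      have mbK: "- K \<le> mb" unfolding mb_def
        by (rule L.fe_ge_boundary[OF x0(1)]) (use aK agc in \<open>fastforce simp: abs_le_iff\<close>)
      define M where "M = min 0 mb"
      have M: "\<forall>j\<in>{n h + 1..nb h}. M \<le> a j" "M \<le> 0" "- K \<le> M" using mb_le mbK K by (force simp: M_def)+
      have "M \<le> a i" if "i \<in> {1..nb h}" for i
      proof (rule D.lower_bound[OF M(1,2) _ sign that])
        fix T x j assume T: "T \<in> \<T> h" "x \<in> T" and j: "j \<in> L.idx T" "a j < M"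
        have meas: "m1 * h ^ d \<le> measure (hausdorff_measure d) T" if "T \<in> \<T> h" for T
          using quasi_uniform h(1) that by blast
        have "(\<Sum>i\<in>L.idx T. nodal_above a M i) \<le> (real d + 1) * (2 * K + h * (E / (m1 * h ^ d)) powr (1 / p))"
          by (rule D.crossing_bound[OF h0 family_const(4) diam meas energy E0 M(3,2) T(1) j])
        also have "\<dots> = A + A' * (h * (1 / h ^ d) powr (1 / p))"
        proof -
          have "E / (m1 * h ^ d) = (E / m1) * (1 / h ^ d)" by simp
          then have "(E / (m1 * h ^ d)) powr (1 / p) = (E / m1) powr (1 / p) * (1 / h ^ d) powr (1 / p)"
            using E0 family_const(4) h0 powr_mult[of "E / m1" "1 / h ^ d" "1 / p"] by simp
          then show ?thesis by (simp add: A_def A'_def algebra_simps)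
        qed
        finally have Z: "(\<Sum>i\<in>L.idx T. nodal_above a M i) \<le> A + A' * (h * (1 / h ^ d) powr (1 / p))" .
        show "q (P x) (L.fe a x) - q (P x) 0 \<le> \<mu>0 * s * (\<Sum>i\<in>L.idx T. nodal_above a M i)"
        proof (rule D.reaction_dominated[OF _ A4_const(3,4,1) M(2) T Z])
          show "q x z - q x 0 \<le> \<alpha> * z + \<beta> * rpow z (p1 - 1)" if "x \<in> S" "0 \<le> z" for x z
            using A4_pos that by blast
          show "\<alpha> + \<beta> * (A + A' * (h * (1 / h ^ d) powr (1 / p))) powr (p1 - 2) \<le> \<mu>0 * s"
            using h2(2)[OF h0] h(2) by (simp add: s_def)
        qed
      qed
      then have mM: "M \<le> m" unfolding m_def using x1(1) L.fe_ge[of _ x1 M a] L.idx_sub by blast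
      have minS: "is_minimum (lift S \<nu> \<delta> (\<T> h) uh) S m"
      proof -
        have "lift S \<nu> \<delta> (\<T> h) uh ` S = uh ` \<Union> (\<T> h)" using lift_img[of "\<Union> (\<T> h)" uh] L.P_image by simp
        then show ?thesis unfolding is_minimum_def using x1 unfolding m_def a by (metis (no_types, lifting) imageE imageI)
      qed
      have minB: "is_minimum (lift S \<nu> \<delta> (\<T> h) (boundary_interpolant (\<T> h) (B h) (n h) (nb h) g)) (surface_boundary S) mb"
      proof -
        have "lift S \<nu> \<delta> (\<T> h) (L.fe gc) ` surface_boundary S = L.fe gc ` poly_boundary (\<T> h)"
          using lift_img[OF L.poly_boundary_sub] L.P_boundary by simp
        then show ?thesis unfolding is_minimum_def gI using x0 unfolding mb_def by (metis (no_types, lifting) imageE imageI)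
      qed
      have 1: "m = mb" if neg: "\<forall>x\<in>surface_boundary S. g x \<le> 0"
      proof (rule antisym)
        have "L.fe a x0 = L.fe gc x0" by (rule L.fe_eq_boundary[OF x0(1) agc])
        then show "m \<le> mb" using x1(2)[of x0] x0(1) L.poly_boundary_sub unfolding m_def mb_def by auto
        have nb: "nb h \<in> {n h + 1..nb h}" using L.n_nb by simp
        have "mb \<le> 0" using mb_le[OF nb] abd[OF nb] neg Bbd(2)[OF nb] by force
        then show "mb \<le> m" using mM by (simp add: M_def)
      qed
      have 2: "0 \<le> m" if pos: "\<forall>x\<in>surface_boundary S. 0 \<le> g x"
      proof -
        have "0 \<le> mb" unfolding mb_def
          by (rule L.fe_ge_boundary[OF x0(1)]) (use pos Bbd(2) in \<open>simp add: gc_def\<close>)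
        then show ?thesis using mM by (simp add: M_def)
      qed
      show "\<exists>m mb. is_minimum (lift S \<nu> \<delta> (\<T> h) uh) S m \<and>
         is_minimum (lift S \<nu> \<delta> (\<T> h) (boundary_interpolant (\<T> h) (B h) (n h) (nb h) g)) (surface_boundary S) mb \<and>
         min 0 mb \<le> m \<and>
         ((\<forall>x\<in>surface_boundary S. g x \<le> 0) \<longrightarrow> m = mb) \<and>
         ((\<forall>x\<in>surface_boundary S. 0 \<le> g x) \<longrightarrow> 0 \<le> m)"
        using minS minB mM 1 2 unfolding M_def by blast
    qed
  qed
qed

end
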